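(* The map $\mathcal{A}\ni A\mapsto\mathcal{P}_A\in\Pi$ is a homeomorphism onto its image, where $\mathcal{A}$ carries the weak topology of $\ell^2$ and $\Pi$ carries the topology of weak convergence.
   Context: mm-spaces are triples $(X,d_X,\mu_X)$ with $(X,d_X)$ complete separable metric and $\mu_X$ a Borel probability measure, with $X=\operatorname{supp}\mu_X$. $\mathcal{X}$ is the set of their isomorphism classes under measure-preserving isometries. $\square$ is the box distance on $\mathcal{X}$: $\square(X,Y)$ is the infimum of $\varepsilon\ge0$ such that there exist Borel maps $\varphi,\psi$ from $[0,1)$ pushing Lebesgue measure to $\mu_X,\mu_Y$ and a Borel set $I_0$ of measure $\ge1-\varepsilon$ with $|d_X(\varphi(s),\varphi(t))-d_Y(\psi(s),\psi(t))|\le\varepsilon$ on $I_0$. $Y\prec X$ means there is a 1-Lipschitz $f\colon X\to Y$ with $f_*\mu_X=\mu_Y$. A pyramid is a nonempty $\square$-closed subset of $\mathcal{X}$ that is downward closed under $\prec$ and such that any two elements are dominated by a common element. $\Pi$ is the set of pyramids. Weak convergence: $\mathcal{P}_n\to\mathcal{P}$ iff $\square(X,\mathcal{P}_n)\to0$ for every $X\in\mathcal{P}$ and $\liminf\square(X,\mathcal{P}_n)>0$ for every $X\notin\mathcal{P}$. This topology is metrizable and compact. $\mathcal{A}$ is the set of monotone non-increasing sequences $A=\{a_i\}_{i\ge1}$ of nonnegative reals with $\sum a_i\le1$, viewed in $\ell^2$. For $A\in\mathcal{A}$, $\mathcal{P}_A=\{X\in\mathcal{X}:\exists\{x_i\}\subset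 X\text{ with }\sum_ia_i\delta_{x_i}\le\mu_X\}$, which is a pyramid. *)

theory Defs
  imports "HOL-Probability.Probability"
begin

text \<open>An mm-space is represented by a pair (d, mu) where mu is a measure on a
subset (space mu) of the real line and d is a metric on space mu.  Every complete
separable metric space has cardinality at most the continuum, so every mm-space is
isomorphic to one of this form; all notions below are invariant under
measure-preserving isometries.\<close>

type_synonym mm = "(real \<Rightarrow> real \<Rightarrow> real) \<times> real measure"

definition mm_space :: "mm \<Rightarrow> bool" where
  "mm_space X \<longleftrightarrow>
     (let d = fst X; \<mu> = snd X; M = space \<mu> in
        Metric_space M d \<and>
        Metric_space.mcomplete M d \<and>
        separable_space (Metric_space.mtopology M d) \<and>
        sets \<mu> = sigma_sets M {U. openin (Metric_space.mtopology M d) U} \<and>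
        prob_space \<mu> \<and>
        \<comment> \<open>X = supp mu: every open ball has positive measure\<close>
        (\<forall>x\<in>M. \<forall>r>0. measure \<mu> (Metric_space.mball M d x r) > 0))"

definition unit_leb :: "real measure" where
  "unit_leb = restrict_space lborel {0..<1}"

definition parameter :: "(real \<Rightarrow> real) \<Rightarrow> mm \<Rightarrow> bool" where
  "parameter \<phi> X \<longleftrightarrow> \<phi> \<in> measurable unit_leb (snd X) \<and> distr unit_leb (snd X) \<phi> = snd X"

definition box_dist :: "mm \<Rightarrow> mm \<Rightarrow> real" where
  "box_dist X Y = Inf {\<epsilon>. \<epsilon> \<ge> 0 \<and>
     (\<exists>\<phi> \<psi> I0. parameter \<phi> X \<and> parameter \<psi> Y \<and> I0 \<in> sets unit_leb \<and>
        measure unit_leb I0 \<ge> 1 - \<epsilon> \<and>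
        (\<forall>s\<in>I0. \<forall>t\<in>I0. \<bar>fst X (\<phi> s) (\<phi> t) - fst Y (\<psi> s) (\<psi> t)\<bar> \<le> \<epsilon>))}"

definition lip_dom :: "mm \<Rightarrow> mm \<Rightarrow> bool" where
  "lip_dom Y X \<longleftrightarrow> (\<exists>f. f ` space (snd X) \<subseteq> space (snd Y) \<and>
      (\<forall>x\<in>space (snd X). \<forall>x'\<in>space (snd X). fst Y (f x) (f x') \<le> fst X x x') \<and>
      f \<in> measurable (snd X) (snd Y) \<and> distr (snd X) (snd Y) f = snd Y)"

definition box_dist_set :: "mm \<Rightarrow> mm set \<Rightarrow> real" where
  "box_dist_set X P = Inf (box_dist X ` P)"

definition pyramid :: "mm set \<Rightarrow> bool" where
  "pyramid P \<longleftrightarrow>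
     P \<noteq> {} \<and> P \<subseteq> {X. mm_space X} \<and>
     \<comment> \<open>closed w.r.t. the box distance\<close>
     (\<forall>X. mm_space X \<and> (\<forall>\<epsilon>>0. \<exists>Y\<in>P. box_dist X Y < \<epsilon>) \<longrightarrow> X \<in> P) \<and>
     \<comment> \<open>downward closed under the Lipschitz order\<close>
     (\<forall>X\<in>P. \<forall>Y. mm_space Y \<and> lip_dom Y X \<longrightarrow> Y \<in> P) \<and>
     \<comment> \<open>directed\<close>
     (\<forall>X\<in>P. \<forall>Y\<in>P. \<exists>Z\<in>P. lip_dom X Z \<and> lip_dom Y Z)"

definition Pyramids :: "mm set set" where
  "Pyramids = {P. pyramid P}"

definition weak_conv :: "(nat \<Rightarrow> mm set) \<Rightarrow> mm set \<Rightarrow> bool" where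
  "weak_conv Ps P \<longleftrightarrow>
     (\<forall>X\<in>P. (\<lambda>n. box_dist_set X (Ps n)) \<longlonglongrightarrow> 0) \<and>
     (\<forall>X. mm_space X \<and> X \<notin> P \<longrightarrow> liminf (\<lambda>n. ereal (box_dist_set X (Ps n))) > 0)"

text \<open>The topology of weak convergence on the set of pyramids: the topology whose
open sets are exactly those U such that every sequence of pyramids weakly converging
to a point of U eventually lies in U (this is the topology determined by weak
convergence; it is metrizable).\<close>
definition weak_Pi_topology :: "mm set topology" where
  "weak_Pi_topology = topology (\<lambda>U. U \<subseteq> Pyramids \<and>
     (\<forall>P\<in>U. \<forall>Ps. range Ps \<subseteq> Pyramids \<and> weak_conv Ps P \<longrightarrow> (\<forall>\<^sub>F n in sequentially. Ps n \<in> U)))"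

text \<open>Sequences are indexed from 0 instead of 1.\<close>

definition l2 :: "(nat \<Rightarrow> real) set" where
  "l2 = {x. summable (\<lambda>i. (x i)\<^sup>2)}"

definition l2_inner :: "(nat \<Rightarrow> real) \<Rightarrow> (nat \<Rightarrow> real) \<Rightarrow> real" where
  "l2_inner x y = (\<Sum>i. x i * y i)"

definition weak_l2_topology :: "(nat \<Rightarrow> real) topology" where
  "weak_l2_topology = topology_generated_by
     (insert l2 {{x\<in>l2. l2_inner x y \<in> U} | y U. y \<in> l2 \<and> open U})"

definition seqA :: "(nat \<Rightarrow> real) set" where
  "seqA = {a. (\<forall>i. 0 \<le> a i) \<and> antimono a \<and> summable a \<and> suminf a \<le> 1}"

definition pyrA :: "(nat \<Rightarrow> real) \<Rightarrow> mm set" where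
  "pyrA a = {X. mm_space X \<and> (\<exists>x::nat \<Rightarrow> real. (\<forall>i. x i \<in> space (snd X)) \<and>
      (\<forall>B\<in>sets (snd X). (\<Sum>i. a i * indicator B (x i)) \<le> measure (snd X) B))}"

end

(*
  Cut [0,1) into consecutive intervals J_0, J_1, ... of lengths a_0, a_1, ...  An mm-space X lies
  in P_A iff X has a parameter that is constant on every J_i: the law of any map that is constant
  on the J_i lies in P_A, and conversely the part of mu_X left over after removing the atoms
  a_i at x_i can be parametrized by the rest of [0,1).

  On A the weak topology of l^2 is the topology of pointwise convergence, because a_i <= 1/i for
  all A in A; in this topology A is compact and metrizable.  Pointwise convergence A_n -> A implies
  weak convergence of the pyramids.  First, a parameter of X in P_A that is constant on the J_i is
  changed on a small set so that it becomes constant on the intervals of A_n: the finitely many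
  large intervals hardly move, and the remaining ones are so short that, outside a small set, the
  parameter is nearly constant on each of them (Lusin).  Secondly, if Y_n in P_{A_n} approaches X in
  the box distance, the atoms of Y_n correspond to points of X with heavy neighbourhoods; such
  points accumulate, and the limits of a diagonal subsequence show that X is in P_A.

  Injectivity is seen on a space that has exactly the atoms a_i besides a diffuse part.  Since weak
  limits are unique and A is compact, images of closed sets are closed.
*)
theory Submission
  imports Defs
begin

section \<open>Borel measures on complete separable metric spaces\<close>

text \<open>Parameters are preferred to lists of atoms because the operations on spaces become
  operations on maps from [0,1): composing with a Lipschitz map or pairing two maps keeps constancy
  on the intervals. The price is that every Borel probability on a complete separable metric space
  must be an image of Lebesgue measure; points are coded as reals, and the quantile function of the
  coded law is decoded again. Two features of the representation shape the constructions. The law of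
  a map need not have full support, so the space is cut down to the support and the map corrected on
  a null set; hence the almost everywhere clauses. Carriers are sets of reals, so a product has to
  be recoded into the line. In the limit argument different atoms of Y_n may merge in X, so masses
  are compared for finite groups of atoms, not one by one. Mass may also escape in a pointwise
  limit; the condition sum \<le> 1 instead of sum = 1 keeps A closed, and the lost mass becomes mass
  without prescribed atoms.\<close>

locale polish_metric = Metric_space +
  assumes complete: "mcomplete"
    and separable: "separable_space mtopology"
    and nonempty: "M \<noteq> {}"
begin

definition mborel :: "'a measure" where
  "mborel = sigma M {U. openin mtopology U}"

lemma space_mborel [simp]: "space mborel = M"
  unfolding mborel_def using openin_subset by (intro space_measure_of) fastforce

lemma sets_mborel: "sets mborel = sigma_sets M {U. openin mtopology U}"
  unfolding mborel_def using openin_subset by (intro sets_measure_of) fastforce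

lemma openin_sets_mborel: "openin mtopology U \<Longrightarrow> U \<in> sets mborel"
  unfolding sets_mborel by (intro sigma_sets.Basic) simp

lemma mball_sets_mborel [measurable]: "mball x r \<in> sets mborel"
  by (intro openin_sets_mborel openin_mball)

lemma dense_sequence:
  obtains q :: "nat \<Rightarrow> 'a" where "\<And>n. q n \<in> M" "\<And>x e. \<lbrakk>x \<in> M; e > 0\<rbrakk> \<Longrightarrow> \<exists>n. d x (q n) < e"
proof -
  obtain C where C: "countable C" "C \<subseteq> M" "mtopology closure_of C = M"
    using separable unfolding separable_space_def by auto
  have ne: "C \<noteq> {}"
    using C(3) nonempty by auto
  show thesis
  proof (rule that)
    show "from_nat_into C n \<in> M" for n
      using from_nat_into[OF ne] C(2) by blast
    show "\<exists>n. d x (from_nat_into C n) < e" if xe: "x \<in> M" "e > 0" for x e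
    proof -
      have "x \<in> mtopology closure_of C"
        using C xe by simp
      then obtain y where "y \<in> C" "y \<in> mball x e"
        unfolding metric_closure_of using xe by blast
      then show ?thesis
        using from_nat_into_surj[OF C(1)] by (metis in_mball)
    qed
  qed
qed

text \<open>A countable base in disguise: a ball of radius below r/2 that contains x cannot leave
  \<open>mball x r\<close>. Measurability, supports and second countability all reduce to these
  countably many balls.\<close>

lemma between_dense_balls:
  assumes "\<And>n. q n \<in> M" "\<And>x e. \<lbrakk>x \<in> M; e > 0\<rbrakk> \<Longrightarrow> \<exists>n. d x (q n) < e"
    and "x \<in> M" "r > 0"
  obtains n m :: nat where "x \<in> mball (q n) (1 / Suc m)" "mball (q n) (1 / Suc m) \<subseteq> mball x r"
proof -
  obtain m :: nat where m: "1 / Suc m < r / 2"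
    using nat_approx_posE[of "r / 2"] assms(4) by (metis half_gt_zero)
  obtain n where n: "d x (q n) < 1 / Suc m"
    using assms(2)[OF assms(3), of "1 / Suc m"] by auto
  show thesis
  proof (rule that)
    show "x \<in> mball (q n) (1 / Suc m)"
      using assms n by (simp add: commute)
    show "mball (q n) (1 / Suc m) \<subseteq> mball x r"
    proof
      fix y assume y: "y \<in> mball (q n) (1 / Suc m)"
      then have "d x y \<le> d x (q n) + d (q n) y"
        using assms by (intro triangle) auto
      with y m n show "y \<in> mball x r"
        using assms(3) by simp
    qed
  qed
qed

text \<open>Preimages of balls are sublevel sets of the given distance functions, and by
  separability every open set is a countable union of balls.\<close>

lemma measurable_mborelI:
  assumes f: "f \<in> space N \<rightarrow> M"
    and *: "\<And>z. z \<in> M \<Longrightarrow> (\<lambda>w. d z (f w)) \<in> borel_measurable N"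
  shows "f \<in> measurable N mborel"
proof -
  obtain q :: "nat \<Rightarrow> 'a" where q: "\<And>n. q n \<in> M" "\<And>x e. \<lbrakk>x \<in> M; e > 0\<rbrakk> \<Longrightarrow> \<exists>n. d x (q n) < e"
    using dense_sequence by metis
  have ball: "f -` mball z r \<inter> space N \<in> sets N" if "z \<in> M" for z r
  proof -
    have "f -` mball z r \<inter> space N = {w \<in> space N. d z (f w) < r}"
      using f that by auto
    also have "\<dots> \<in> sets N"
      using *[OF that] by measurable
    finally show ?thesis .
  qed
  show ?thesis
    unfolding mborel_def
  proof (rule measurable_measure_of)
    show "{U. openin mtopology U} \<subseteq> Pow M"
      using openin_subset by fastforce
    show "f \<in> space N \<rightarrow> M" by (rule f)
    fix U assume "U \<in> {U. openin mtopology U}"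
    then have U: "openin mtopology U" by simp
    let ?I = "{(n, m). mball (q n) (1 / Suc m) \<subseteq> U}"
    have "U = (\<Union>(n, m)\<in>?I. mball (q n) (1 / Suc m))"
    proof
      show "U \<subseteq> (\<Union>(n, m)\<in>?I. mball (q n) (1 / Suc m))"
      proof
        fix x assume x: "x \<in> U"
        then obtain r where r: "r > 0" "mball x r \<subseteq> U"
          using U unfolding openin_mtopology by blast
        have "x \<in> M" using x U unfolding openin_mtopology by blast
        obtain n m :: nat where nm: "x \<in> mball (q n) (1 / Suc m)" "mball (q n) (1 / Suc m) \<subseteq> mball x r"
          using between_dense_balls[OF q \<open>x \<in> M\<close> r(1)] by blast
        then have "(n, m) \<in> ?I" using r by blast
        then show "x \<in> (\<Union>(n, m)\<in>?I. mball (q n) (1 / Suc m))" using nm(1) by blast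
      qed
    qed auto
    then have "f -` U \<inter> space N = f -` (\<Union>(n, m)\<in>?I. mball (q n) (1 / Suc m)) \<inter> space N"
      by (rule arg_cong)
    also have "\<dots> = (\<Union>(n, m)\<in>?I. f -` mball (q n) (1 / Suc m) \<inter> space N)"
      by blast
    also have "\<dots> \<in> sets N"
      using ball q(1) by (intro sets.countable_UN') auto
    finally show "f -` U \<inter> space N \<in> sets N" .
  qed
qed

lemma borel_measurable_dist:
  assumes "z \<in> M" shows "d z \<in> borel_measurable mborel"
proof (rule borel_measurableI_less)
  fix r
  have "{w \<in> space mborel. d z w < r} = mball z r"
    using assms by auto
  then show "{w \<in> space mborel. d z w < r} \<in> sets mborel" by simp
qed

lemma singleton_sets_mborel: 
  assumes "x \<in> M" shows "{x} \<in> sets mborel"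
proof -
  have "{x} = {w \<in> space mborel. d x w \<le> 0}"
    using assms nonneg zero by (auto simp: antisym_conv)
  also have "\<dots> \<in> sets mborel"
    using borel_measurable_dist[OF assms] by measurable
  finally show ?thesis .
qed

text \<open>A strict inequality leaves room for a dense point: d (f w) (g w) < r holds iff d (q n)
  (f w) + d (q n) (g w) < r for some n. Distances to fixed points thus suffice, and no product
  sigma-algebra enters.\<close>

lemma borel_measurable_dist2:
  assumes f: "f \<in> measurable N mborel" and g: "g \<in> measurable N mborel"
  shows "(\<lambda>w. d (f w) (g w)) \<in> borel_measurable N"
proof (rule borel_measurableI_less)
  fix r
  obtain q :: "nat \<Rightarrow> 'a" where q: "\<And>n. q n \<in> M" "\<And>x e. \<lbrakk>x \<in> M; e > 0\<rbrakk> \<Longrightarrow> \<exists>n. d x (q n) < e"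
    using dense_sequence by metis
  have fM: "f w \<in> M" and gM: "g w \<in> M" if "w \<in> space N" for w
    using that measurable_space[OF f] measurable_space[OF g] by auto
  have "{w \<in> space N. d (f w) (g w) < r} = (\<Union>n. {w \<in> space N. d (q n) (f w) + d (q n) (g w) < r})"
  proof (intro equalityI subsetI)
    fix w assume w: "w \<in> {w \<in> space N. d (f w) (g w) < r}"
    \<comment> \<open>Half of the slack, because the distance from \<open>f w\<close> to
      \<open>q n\<close> is spent twice: once directly and once in the triangle inequality.\<close>
    define e where "e = (r - d (f w) (g w)) / 2"
    have "e > 0" unfolding e_def using w by simp
    then obtain n where n: "d (f w) (q n) < e"
      using q(2) fM w by blast
    have "d (q n) (g w) \<le> d (q n) (f w) + d (f w) (g w)"
      using fM gM q(1) w by (intro triangle) auto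
    then have "d (q n) (f w) + d (q n) (g w) < r"
      using n unfolding e_def by (simp add: commute)
    then show "w \<in> (\<Union>n. {w \<in> space N. d (q n) (f w) + d (q n) (g w) < r})"
      using w by blast
  next
    fix w assume "w \<in> (\<Union>n. {w \<in> space N. d (q n) (f w) + d (q n) (g w) < r})"
    then obtain n where w: "w \<in> space N" "d (q n) (f w) + d (q n) (g w) < r" by blast
    have "d (f w) (g w) \<le> d (f w) (q n) + d (q n) (g w)"
      using fM gM q(1) w by (intro triangle) auto
    then show "w \<in> {w \<in> space N. d (f w) (g w) < r}"
      using w by (simp add: commute)
  qed
  also have "\<dots> \<in> sets N"
  proof -
    have [measurable]: "(\<lambda>w. d (q n) (f w)) \<in> borel_measurable N" "(\<lambda>w. d (q n) (g w)) \<in> borel_measurable N" for n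
      using measurable_compose[OF f borel_measurable_dist[OF q(1)]]
        measurable_compose[OF g borel_measurable_dist[OF q(1)]] by auto
    show ?thesis by measurable
  qed
  finally show "{w \<in> space N. d (f w) (g w) < r} \<in> sets N" .
qed

definition supp :: "'a measure \<Rightarrow> 'a set" where
  "supp \<nu> = {x \<in> M. \<forall>r>0. measure \<nu> (mball x r) > 0}"

text \<open>A point outside the support has a null ball, hence lies in a null ball of the countable
  base. The complement of the support is therefore a countable union of null balls, which makes it
  open and null at once.\<close>

lemma
  assumes "prob_space \<nu>" "sets \<nu> = sets mborel"
  shows closedin_supp: "closedin mtopology (supp \<nu>)"
    and AE_supp: "AE x in \<nu>. x \<in> supp \<nu>"
proof -
  interpret prob_space \<nu> by fact
  obtain q :: "nat \<Rightarrow> 'a" where q: "\<And>n. q n \<in> M" "\<And>x e. \<lbrakk>x \<in> M; e > 0\<rbrakk> \<Longrightarrow> \<exists>n. d x (q n) < e"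
    using dense_sequence by metis
  let ?I = "{(n, m). measure \<nu> (mball (q n) (1 / Suc m)) = 0}"
  let ?U = "\<Union>(n, m)\<in>?I. mball (q n) (1 / Suc m)"
  have "M - supp \<nu> = ?U"
  proof (intro equalityI subsetI)
    fix x assume x: "x \<in> M - supp \<nu>"
    then obtain r where r: "r > 0" "measure \<nu> (mball x r) = 0"
      unfolding supp_def by (auto simp: zero_less_measure_iff)
    obtain n m :: nat where nm: "x \<in> mball (q n) (1 / Suc m)" "mball (q n) (1 / Suc m) \<subseteq> mball x r"
      using between_dense_balls[OF q _ r(1)] x by blast
    have "measure \<nu> (mball (q n) (1 / Suc m)) \<le> measure \<nu> (mball x r)"
      by (intro finite_measure_mono) (use nm assms(2) in auto)
    then have "(n, m) \<in> ?I" using r by (simp add: measure_le_0_iff)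
    then show "x \<in> ?U" using nm(1) by blast
  next
    fix x assume "x \<in> ?U"
    then obtain n m where nm: "measure \<nu> (mball (q n) (1 / Suc m)) = 0" "x \<in> mball (q n) (1 / Suc m)"
      by auto
    then obtain r where r: "r > 0" "mball x r \<subseteq> mball (q n) (1 / Suc m)"
      using openin_mball openin_mtopology by metis
    have "measure \<nu> (mball x r) \<le> measure \<nu> (mball (q n) (1 / Suc m))"
      by (intro finite_measure_mono) (use r assms(2) in auto)
    then have "\<not> measure \<nu> (mball x r) > 0" using nm by simp
    then show "x \<in> M - supp \<nu>" using nm(2) r(1) unfolding supp_def by auto
  qed
  note eq = this
  have op: "openin mtopology ?U"
    by auto
  show "closedin mtopology (supp \<nu>)"
    unfolding closedin_def using op eq by (auto simp: supp_def)
  have null: "?U \<in> null_sets \<nu>"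
  proof (rule null_sets_UN')
    show "countable ?I" by simp
    fix p assume "p \<in> ?I"
    then show "(case p of (n, m) \<Rightarrow> mball (q n) (1 / real (Suc m))) \<in> null_sets \<nu>"
      using assms(2) by (auto simp: null_sets_def emeasure_eq_measure split: prod.splits)
  qed
  have sp: "space \<nu> = M" using assms(2) sets_eq_imp_space_eq space_mborel by metis
  show "AE x in \<nu>. x \<in> supp \<nu>"
    by (rule AE_I'[OF null]) (use sp eq in auto)
qed

end

section \<open>Parameters\<close>

lemma space_unit_leb [simp]: "space unit_leb = {0..<1}"
  by (simp add: unit_leb_def space_restrict_space)

lemma sets_unit_leb: "A \<in> sets unit_leb \<longleftrightarrow> A \<in> sets borel \<and> A \<subseteq> {0..<1}"
  unfolding unit_leb_def by (subst sets_restrict_space_iff) auto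

lemma emeasure_unit_leb: "A \<subseteq> {0..<1} \<Longrightarrow> emeasure unit_leb A = emeasure lborel A"
  unfolding unit_leb_def by (subst emeasure_restrict_space) auto

lemma measure_unit_leb: "A \<subseteq> {0..<1} \<Longrightarrow> measure unit_leb A = measure lborel A"
  by (simp add: measure_def emeasure_unit_leb)

lemma prob_space_unit_leb: "prob_space unit_leb"
  by (intro prob_spaceI) (simp add: emeasure_unit_leb)

interpretation unit_leb: prob_space unit_leb
  by (rule prob_space_unit_leb)

section \<open>Borel probabilities as images of Lebesgue measure\<close>

lemma sum_base4_shift:
  fixes b :: "nat \<Rightarrow> nat"
  assumes "\<And>k. b k \<le> 1"
  defines "S \<equiv> \<lambda>k. \<Sum>j. real (b (j + k)) / 4 ^ Suc j"
  shows "4 * S k = real (b k) + S (Suc k)" "0 \<le> S k" "S k < 1"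
proof -
  have sm: "summable (\<lambda>j. real (b (j + k)) / 4 ^ Suc j)" for k
  proof (rule summable_comparison_test'[where g = "\<lambda>j. (1/4) ^ Suc j" and N = 0])
    show "summable (\<lambda>j. (1/4::real) ^ Suc j)"
      by (subst summable_Suc_iff) (simp add: summable_geometric)
    show "norm (real (b (n + k)) / 4 ^ Suc n) \<le> (1/4) ^ Suc n" for n
      using assms(1)[of "n + k"] by (simp add: field_simps power_divide)
  qed
  show "0 \<le> S k" unfolding S_def by (intro suminf_nonneg sm) auto
  \<comment> \<open>Digits 0 and 1 bound the tail by 1/4 + 1/16 + ... = 1/3. In base 2 the bound
    would be 1, and digits would not be unique.\<close>
  have "S k \<le> (\<Sum>j. (1/4::real) ^ Suc j)"
    unfolding S_def
  proof (rule suminf_le)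
    show "summable (\<lambda>j. (1/4::real) ^ Suc j)"
      by (subst summable_Suc_iff) (simp add: summable_geometric)
    show "real (b (n + k)) / 4 ^ Suc n \<le> (1/4) ^ Suc n" for n
      using assms(1)[of "n + k"] by (simp add: field_simps power_divide)
  qed (rule sm)
  also have "\<dots> = 1/3"
    by (subst suminf_split_head) (auto simp: summable_geometric suminf_geometric)
  finally show "S k < 1" by simp
  have "S k = real (b k) / 4 + (\<Sum>j. real (b (Suc j + k)) / 4 ^ Suc (Suc j))"
    unfolding S_def using suminf_split_head[OF sm[of k]] by simp
  also have "(\<Sum>j. real (b (Suc j + k)) / 4 ^ Suc (Suc j)) = S (Suc k) / 4"
    unfolding S_def by (subst suminf_divide[OF sm, symmetric]) (simp add: field_simps)
  finally show "4 * S k = real (b k) + S (Suc k)" by simp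
qed

text \<open>Scaling by 4^(k+1) moves the digits 0, ..., k in front of the point. All but the last
  contribute a multiple of 4, and the remaining tail lies in [0,1), so the floor drops it.\<close>

lemma floor_base4_digit:
  fixes b :: "nat \<Rightarrow> nat"
  assumes "\<And>k. b k \<le> 1"
  shows "\<lfloor>4 ^ Suc k * (\<Sum>j. real (b j) / 4 ^ Suc j)\<rfloor> mod 4 = int (b k)"
proof -
  define S where "S = (\<lambda>k. \<Sum>j. real (b (j + k)) / 4 ^ Suc j)"
  have S: "4 * S k = real (b k) + S (Suc k)" "0 \<le> S k" "S k < 1" for k
    unfolding S_def using sum_base4_shift[where b = b and k = k] assms by blast+
  have "\<exists>m::int. 4 ^ k * S 0 = of_int m + S k" for k
  proof (induction k)
    case (Suc k)
    then obtain m :: int where "4 ^ k * S 0 = of_int m + S k" by blast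
    then have "4 ^ Suc k * S 0 = 4 * (of_int m + S k)" by simp
    also have "\<dots> = of_int (4 * m + int (b k)) + S (Suc k)"
      using S(1)[of k] by simp
    finally show ?case by blast
  qed (auto intro: exI[of _ 0])
  then obtain m :: int where "4 ^ k * S 0 = of_int m + S k" by blast
  then have "4 ^ Suc k * S 0 = of_int (4 * m + int (b k)) + S (Suc k)"
    using S(1)[of k] by simp
  then have "\<lfloor>4 ^ Suc k * S 0\<rfloor> = 4 * m + int (b k)"
    using S(2,3)[of "Suc k"] by (intro floor_unique) auto
  moreover have "b k = 0 \<or> b k = 1" using assms[of k] by linarith
  ultimately show ?thesis unfolding S_def by auto
qed

text \<open>Inverse transform: \<open>I\<close> is the quantile function of \<rho>, and its law
  under Lebesgue measure on (0,1) is \<rho>. The extra point 0 of [0,1) is null, so the value chosen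
  there does not affect the law.\<close>

lemma exists_real_parameter:
  fixes \<rho> :: "real measure"
  assumes "real_distribution \<rho>"
  obtains \<phi> where "\<phi> \<in> borel_measurable unit_leb" "distr unit_leb borel \<phi> = \<rho>"
proof -
  interpret cdf_distribution \<rho> unfolding cdf_distribution_def by fact
  define \<phi> where "\<phi> t = (if t \<in> {0<..<1} then I t else 0)" for t
  have eq: "{0<..<1::real} = {x. 0 < x \<and> x < 1}" by auto
  have m: "\<phi> \<in> borel_measurable borel"
    using measurable_CI unfolding \<phi>_def eq
    by (subst measurable_If_restrict_space_iff) (simp_all add: eq)
  show thesis
  proof (rule that)
    show m': "\<phi> \<in> borel_measurable unit_leb"
      unfolding unit_leb_def using m by (intro measurable_restrict_space1) simp
    have "distr unit_leb borel \<phi> = distr (restrict_space lborel {0<..<1}) borel I"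
    proof (rule measure_eqI)
      fix B assume "B \<in> sets (distr unit_leb borel \<phi>)"
      then have B: "B \<in> sets borel" by simp
      have m2: "I \<in> borel_measurable (restrict_space lborel {0<..<1})"
        using measurable_CI by (simp cong: measurable_cong_sets sets_restrict_space_cong)
      have "emeasure (distr unit_leb borel \<phi>) B = emeasure lborel (\<phi> -` B \<inter> {0..<1})"
        using B m' by (simp add: emeasure_distr emeasure_unit_leb)
      also have "\<dots> = emeasure lborel (\<phi> -` B \<inter> {0<..<1})"
      proof (rule emeasure_eq_AE)
        show "AE x in lborel. (x \<in> \<phi> -` B \<inter> {0..<1}) = (x \<in> \<phi> -` B \<inter> {0<..<1})"
          using AE_lborel_singleton[of 0] by eventually_elim auto
      qed (use measurable_sets_borel[OF m B] in auto)
      also have "\<phi> -` B \<inter> {0<..<1} = I -` B \<inter> {0<..<1}"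
        by (auto simp: \<phi>_def)
      also have "emeasure lborel \<dots> = emeasure (distr (restrict_space lborel {0<..<1}) borel I) B"
        using B m2 by (simp add: emeasure_distr emeasure_restrict_space space_restrict_space)
      finally show "emeasure (distr unit_leb borel \<phi>) B = emeasure (distr (restrict_space lborel {0<..<1}) borel I) B" .
    qed simp
    then show "distr unit_leb borel \<phi> = \<rho>" using distr_I_eq_M by simp
  qed
qed

context polish_metric
begin

text \<open>Serves the passage to supports: second countability is inherited by subspaces and gives
  back their separability.\<close>

lemma second_countable_mtopology: "second_countable mtopology"
proof -
  obtain q :: "nat \<Rightarrow> 'a" where q: "\<And>n. q n \<in> M" "\<And>x e. \<lbrakk>x \<in> M; e > 0\<rbrakk> \<Longrightarrow> \<exists>n. d x (q n) < e"
    using dense_sequence by metis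
  let ?B = "range (\<lambda>(n, m). mball (q n) (1 / Suc m))"
  show ?thesis
    unfolding second_countable_def
  proof (intro exI[of _ ?B] conjI ballI allI impI)
    fix U x assume "openin mtopology U \<and> x \<in> U"
    then obtain r where r: "r > 0" "mball x r \<subseteq> U" "x \<in> M"
      unfolding openin_mtopology by blast
    obtain n m :: nat where "x \<in> mball (q n) (1 / Suc m)" "mball (q n) (1 / Suc m) \<subseteq> mball x r"
      using between_dense_balls[OF q r(3,1)] by blast
    then show "\<exists>V\<in>?B. x \<in> V \<and> V \<subseteq> U"
      using r(2) by (intro bexI[of _ "mball (q n) (1 / Suc m)"]) auto
  qed auto
qed

text \<open>A point x is coded by the 0-1 sequence of the truth values of d (q j) x < 1 / (n + 1), where q
is a dense sequence. Base 4 with digits 0 and 1 makes the digits of the code unique.\<close>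

lemma exists_real_coding:
  "\<exists>(code :: 'a \<Rightarrow> real) dec. code \<in> borel_measurable mborel \<and> dec \<in> measurable borel mborel \<and>
    (\<forall>x\<in>M. dec (code x) = x)"
proof -
  obtain q :: "nat \<Rightarrow> 'a" where q: "\<And>n. q n \<in> M" "\<And>x e. \<lbrakk>x \<in> M; e > 0\<rbrakk> \<Longrightarrow> \<exists>n. d x (q n) < e"
    using dense_sequence by metis
  define b where "b k x = (case prod_decode k of (n, j) \<Rightarrow> if d (q j) x < 1 / Suc n then 1::nat else 0)" for k x
  define code where "code x = (\<Sum>k. real (b k x) / 4 ^ Suc k)" for x
  define digit where "digit k y = \<lfloor>4 ^ Suc k * y\<rfloor> mod (4::int)" for k and y :: real
  \<comment> \<open>On the code of x this finds the first dense point at distance less than 1/(n+1)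
    from x, since digit \<open>prod_encode (n, j)\<close> is 1 exactly for such j.\<close>
  define g where "g n y = (LEAST j. digit (prod_encode (n, j)) y = 1)" for n y
  \<comment> \<open>A Cauchy estimate that every code satisfies by the triangle inequality. As a
    countable conjunction it is a Borel condition on y; where it fails, \<open>dec\<close> takes the
    default \<open>q 0\<close>, so that it is defined on the whole line.\<close>
  define Good where "Good y \<longleftrightarrow> (\<forall>n m. d (q (g n y)) (q (g m y)) \<le> 1 / Suc n + 1 / Suc m)" for y
  define dec where "dec y = (if Good y then SOME l. limitin mtopology (\<lambda>n. q (g n y)) l sequentially else q 0)" for y
  have b1: "b k x \<le> 1" for k x by (auto simp: b_def split: prod.split)
  have digit_code: "digit k (code x) = int (b k x)" for k x
    unfolding digit_def code_def using b1 by (rule floor_base4_digit)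
  have bm: "(\<lambda>x. real (b k x)) \<in> borel_measurable mborel" for k
  proof -
    obtain n j where k: "prod_decode k = (n, j)" by fastforce
    have [measurable]: "d (q j) \<in> borel_measurable mborel" by (rule borel_measurable_dist[OF q(1)])
    show ?thesis unfolding b_def k by simp
  qed
  have code_m: "code \<in> borel_measurable mborel"
    unfolding code_def using bm by measurable
  have digit_m [measurable]: "digit k \<in> measurable borel (count_space UNIV)" for k
    unfolding digit_def by measurable
  have g_m [measurable]: "g n \<in> measurable borel (count_space UNIV)" for n
    unfolding g_def by measurable
  have Good_m [measurable]: "Measurable.pred borel Good"
  proof -
    have "Measurable.pred borel (\<lambda>y. d (q (g n y)) (q (g m y)) \<le> 1 / Suc n + 1 / Suc m)" for n m
    proof -
      have "(\<lambda>y. q (g n y)) \<in> measurable borel mborel" for n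
        using measurable_compose[OF g_m, of q mborel] q(1) by simp
      then have "(\<lambda>y. d (q (g n y)) (q (g m y))) \<in> borel_measurable borel"
        by (intro borel_measurable_dist2)
      then show ?thesis by measurable
    qed
    then show ?thesis unfolding Good_def by measurable
  qed
  have lim: "limitin mtopology (\<lambda>n. q (g n y)) (dec y) sequentially" if "Good y" for y
  proof -
    have "MCauchy (\<lambda>n. q (g n y))"
      unfolding MCauchy_def
    proof (intro conjI allI impI)
      show "range (\<lambda>n. q (g n y)) \<subseteq> M" using q(1) by auto
      fix e :: real assume "e > 0"
      then obtain N :: nat where N: "1 / Suc N < e / 2"
        using nat_approx_posE[of "e / 2"] by (metis half_gt_zero)
      have "d (q (g n y)) (q (g m y)) < e" if "N \<le> n" "N \<le> m" for n m
      proof -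
        have "d (q (g n y)) (q (g m y)) \<le> 1 / Suc n + 1 / Suc m"
          using \<open>Good y\<close> by (auto simp: Good_def)
        also have "\<dots> \<le> 1 / Suc N + 1 / Suc N"
          using that by (intro add_mono frac_le) auto
        finally show ?thesis using N by simp
      qed
      then show "\<exists>N. \<forall>n m. N \<le> n \<longrightarrow> N \<le> m \<longrightarrow> d (q (g n y)) (q (g m y)) < e" by blast
    qed
    then have "\<exists>l. limitin mtopology (\<lambda>n. q (g n y)) l sequentially"
      using complete unfolding mcomplete_def by blast
    then show ?thesis using that someI_ex[of "\<lambda>l. limitin mtopology (\<lambda>n. q (g n y)) l sequentially"]
      unfolding dec_def by simp
  qed
  have decM: "dec y \<in> M" for y
  proof (cases "Good y")
    case True
    then show ?thesis using lim limitin_mspace by blast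
  next
    case False
    then show ?thesis using q(1) by (simp add: dec_def)
  qed
  have dec_m: "dec \<in> measurable borel mborel"
  proof (rule measurable_mborelI)
    show "dec \<in> space borel \<rightarrow> M" using decM by auto
    fix z assume z: "z \<in> M"
    \<comment> \<open>Measurability of \<open>dec\<close> is inherited from its approximants, which
      depend on y only through \<open>Good y\<close> and a natural number; distances to z converge
      along them.\<close>
    have conv: "(\<lambda>n. if Good y then d z (q (g n y)) else d z (q 0)) \<longlonglongrightarrow> d z (dec y)" for y
    proof (cases "Good y")
      case True
      have le: "\<forall>n. norm (d z (q (g n y)) - d z (dec y)) \<le> d (q (g n y)) (dec y)"
      proof
        fix n
        have "d z (q (g n y)) \<le> d z (dec y) + d (dec y) (q (g n y))" 
          "d z (dec y) \<le> d z (q (g n y)) + d (q (g n y)) (dec y)"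
          using z q(1) decM by (simp_all add: triangle)
        then show "norm (d z (q (g n y)) - d z (dec y)) \<le> d (q (g n y)) (dec y)"
          by (simp add: commute[of "dec y"] abs_le_iff)
      qed
      have "(\<lambda>n. d (q (g n y)) (dec y)) \<longlonglongrightarrow> 0"
        using lim[OF True] unfolding limitin_metric_dist_null by blast
      then have "(\<lambda>n. d z (q (g n y)) - d z (dec y)) \<longlonglongrightarrow> 0"
        by (rule Lim_null_comparison[OF always_eventually[OF le]])
      then have "(\<lambda>n. d z (q (g n y))) \<longlonglongrightarrow> d z (dec y)"
        by (rule LIM_zero_cancel)
      then show ?thesis using True by simp
    next
      case False
      then have "dec y = q 0" unfolding dec_def by (rule if_not_P)
      with False show ?thesis by simp
    qed
    have "(\<lambda>y. d z (q (g n y))) \<in> borel_measurable borel" for n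
      using measurable_compose[OF g_m, of "\<lambda>i. d z (q i)" borel] by simp
    then have meas: "(\<lambda>y. if Good y then d z (q (g n y)) else d z (q 0)) \<in> borel_measurable borel" for n
      using Good_m by measurable
    show "(\<lambda>y. d z (dec y)) \<in> borel_measurable borel"
      by (rule borel_measurable_LIMSEQ_real[OF conv meas])
  qed
  have "dec (code x) = x" if x: "x \<in> M" for x
  proof -
    have close: "d (q (g n (code x))) x < 1 / Suc n" for n
    proof -
      obtain j where "d x (q j) < 1 / Suc n"
        using q(2)[OF x, of "1 / Suc n"] by auto
      then have "digit (prod_encode (n, j)) (code x) = 1"
        by (simp add: digit_code b_def commute)
      then have "digit (prod_encode (n, g n (code x))) (code x) = 1"
        unfolding g_def by (rule LeastI)
      then show ?thesis by (simp add: digit_code b_def split: if_splits)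
    qed
    have "Good (code x)"
      unfolding Good_def
    proof (intro allI)
      fix n m
      have "d (q (g n (code x))) (q (g m (code x))) \<le> d (q (g n (code x))) x + d x (q (g m (code x)))"
        using q(1) x by (intro triangle) auto
      then show "d (q (g n (code x))) (q (g m (code x))) \<le> 1 / Suc n + 1 / Suc m"
        using close[of n] close[of m] by (simp add: commute)
    qed
    moreover have "limitin mtopology (\<lambda>n. q (g n (code x))) x sequentially"
    proof -
      have "(\<lambda>n. d (q (g n (code x))) x) \<longlonglongrightarrow> 0"
        by (rule tendsto_sandwich[OF _ _ tendsto_const LIMSEQ_inverse_real_of_nat])
          (use close in \<open>auto intro!: always_eventually less_imp_le simp: inverse_eq_divide\<close>)
      then show ?thesis using x q(1) by (simp add: limitin_metric_dist_null)
    qed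
    ultimately show ?thesis
      using lim limitin_metric_unique[OF _ _ trivial_limit_sequentially] by blast
  qed
  with code_m dec_m show ?thesis by blast
qed

text \<open>The law of \<open>code\<close> on the line has a quantile parameter. Composing it with
  \<open>dec\<close> returns to M, and \<open>dec (code x) = x\<close> makes the resulting law \<nu>
  itself.\<close>

lemma exists_measure_parameter:
  assumes "prob_space \<nu>" "sets \<nu> = sets mborel"
  obtains \<phi> where "\<phi> \<in> measurable unit_leb mborel" "distr unit_leb mborel \<phi> = \<nu>"
proof -
  obtain code :: "'a \<Rightarrow> real" and dec where code: "code \<in> borel_measurable mborel" and dec: "dec \<in> measurable borel mborel"
    and inv: "\<And>x. x \<in> M \<Longrightarrow> dec (code x) = x"
    using exists_real_coding by blast
  have code': "code \<in> borel_measurable \<nu>"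
    using code unfolding measurable_cong_sets[OF assms(2) refl] .
  have sp: "space \<nu> = M"
    using sets_eq_imp_space_eq[OF assms(2)] by simp
  have "prob_space (distr \<nu> borel code)"
    using prob_space.prob_space_distr[OF assms(1) code'] .
  then have "real_distribution (distr \<nu> borel code)"
    by (simp add: real_distribution_def real_distribution_axioms_def)
  then obtain \<phi> where \<phi>: "\<phi> \<in> borel_measurable unit_leb" "distr unit_leb borel \<phi> = distr \<nu> borel code"
    by (rule exists_real_parameter)
  show thesis
  proof (rule that)
    show "dec \<circ> \<phi> \<in> measurable unit_leb mborel"
      using \<phi>(1) dec by (rule measurable_comp)
    have "distr unit_leb mborel (dec \<circ> \<phi>) = distr (distr unit_leb borel \<phi>) mborel dec"
      by (rule distr_distr[OF dec \<phi>(1), symmetric])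
    also have "\<dots> = distr \<nu> mborel (dec \<circ> code)"
      unfolding \<phi>(2) by (rule distr_distr[OF dec code'])
    also have "\<dots> = distr \<nu> \<nu> (\<lambda>x. x)"
      by (rule distr_cong) (insert assms(2) inv sp,simp, simp, simp)
    also have "\<dots> = \<nu>" by (rule distr_id)
    finally show "distr unit_leb mborel (dec \<circ> \<phi>) = \<nu>" .
  qed
qed

end

section \<open>Parameters of mm-spaces, and laws of maps as mm-spaces\<close>

lemma mm_space_polish:
  assumes "mm_space X"
  shows "polish_metric (space (snd X)) (fst X)"
    and "sets (snd X) = sets (polish_metric.mborel (space (snd X)) (fst X))"
    and "prob_space (snd X)"
    and "\<And>x r. x \<in> space (snd X) \<Longrightarrow> r > 0 \<Longrightarrow> measure (snd X) (Metric_space.mball (space (snd X)) (fst X) x r) > 0"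
proof -
  let ?M = "space (snd X)"
  have X: "Metric_space ?M (fst X)" "Metric_space.mcomplete ?M (fst X)"
    "separable_space (Metric_space.mtopology ?M (fst X))"
    "sets (snd X) = sigma_sets ?M {U. openin (Metric_space.mtopology ?M (fst X)) U}"
    "prob_space (snd X)"
    "\<forall>x\<in>?M. \<forall>r>0. measure (snd X) (Metric_space.mball ?M (fst X) x r) > 0"
    using assms unfolding mm_space_def Let_def by blast+
  show P: "polish_metric ?M (fst X)"
    unfolding polish_metric_def polish_metric_axioms_def
    using X prob_space.not_empty by blast
  show "sets (snd X) = sets (polish_metric.mborel ?M (fst X))"
    using polish_metric.sets_mborel[OF P] X by simp
  show "prob_space (snd X)" by fact
  show "\<And>x r. x \<in> ?M \<Longrightarrow> r > 0 \<Longrightarrow> measure (snd X) (Metric_space.mball ?M (fst X) x r) > 0"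
    using X(6) by blast
qed

lemma exists_parameter:
  assumes "mm_space X"
  obtains \<phi> where "parameter \<phi> X"
proof -
  interpret polish_metric "space (snd X)" "fst X" using assms by (rule mm_space_polish)
  obtain \<phi> where "\<phi> \<in> measurable unit_leb mborel" "distr unit_leb mborel \<phi> = snd X"
    using exists_measure_parameter mm_space_polish[OF assms] by metis
  then have "parameter \<phi> X"
    unfolding parameter_def
    by (metis mm_space_polish(2)[OF assms] measurable_cong_sets distr_cong)
  then show thesis by (rule that)
qed

text \<open>An mm-space has full support, so the law of \<theta> is restricted to its support S,
  which is closed, hence complete, and has measure one. Since \<theta> may leave S on a null set,
  \<open>g\<close> sends everything outside S to one point of S.\<close>

lemma law_mm_space:
  fixes M :: "real set"
  assumes "polish_metric M d" and \<theta>: "\<theta> \<in> measurable unit_leb (polish_metric.mborel M d)"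
  obtains Z g where "mm_space Z" "fst Z = d" "space (snd Z) \<subseteq> M" "parameter (g \<circ> \<theta>) Z"
    "AE t in unit_leb. g (\<theta> t) = \<theta> t"
proof -
  interpret polish_metric M d by fact
  define \<nu> where "\<nu> = distr unit_leb mborel \<theta>"
  have \<nu>: "prob_space \<nu>" "sets \<nu> = sets mborel"
    unfolding \<nu>_def using unit_leb.prob_space_distr[OF \<theta>] by simp_all
  interpret \<nu>: prob_space \<nu> by (rule \<nu>(1))
  define S where "S = supp \<nu>"
  have cl: "closedin mtopology S" and ae: "AE x in \<nu>. x \<in> S"
    unfolding S_def using closedin_supp[OF \<nu>] AE_supp[OF \<nu>] by auto
  have SM: "S \<subseteq> M" using closedin_subset[OF cl] by simp
  have sp: "space \<nu> = M" unfolding \<nu>_def by simp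
  have "S = M - (M - S)" using SM by auto
  moreover have "M - S \<in> sets mborel"
    using cl unfolding closedin_def by (intro openin_sets_mborel) auto
  ultimately have Ss: "S \<in> sets \<nu>"
    unfolding \<nu>(2) using sets.compl_sets[of "M - S" mborel] by simp
  obtain z0 where z0: "z0 \<in> S"
    using eventually_happens[OF ae] \<nu>.ae_filter_bot by blast
  define g where "g x = (if x \<in> S then x else z0)" for x
  define \<mu> where "\<mu> = restrict_space \<nu> S"
  have sp\<mu>: "space \<mu> = S" unfolding \<mu>_def using SM sp by (auto simp: space_restrict_space)
  interpret S: Submetric M d S using SM by unfold_locales
  have mS: "measure \<mu> A = measure \<nu> A" if "A \<in> sets \<nu>" "A \<subseteq> S" for A
    unfolding \<mu>_def using that Ss by (intro measure_restrict_space) auto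
  have emS: "emeasure \<mu> A = emeasure \<nu> A" if "A \<in> sets \<nu>" "A \<subseteq> S" for A
    unfolding \<mu>_def using that Ss by (intro emeasure_restrict_space) auto
  have S1: "emeasure \<nu> S = 1"
    using \<nu>.emeasure_eq_1_AE[OF Ss ae] .
  have "mm_space (d, \<mu>)"
    unfolding mm_space_def Let_def fst_conv snd_conv sp\<mu>
  proof (intro conjI ballI allI impI)
    show "Metric_space S d" by (rule S.sub.Metric_space_axioms)
    show "S.sub.mcomplete"
      using S.closedin_mcomplete_imp_mcomplete[OF cl complete] .
    show "separable_space S.sub.mtopology"
    proof -
      show ?thesis
        unfolding S.mtopology_submetric
        by (intro second_countable_imp_separable_space second_countable_subtopology second_countable_mtopology)
    qed
    show "sets \<mu> = sigma_sets S {U. openin S.sub.mtopology U}"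
    proof -
      have "sets \<mu> = (\<inter>) S ` sigma_sets M {U. openin mtopology U}"
        unfolding \<mu>_def sets_restrict_space \<nu>(2) sets_mborel ..
      also have "\<dots> = sigma_sets S ((\<inter>) S ` {U. openin mtopology U})"
        using Ss SM unfolding \<nu>(2) sets_mborel by (rule sigma_sets_Int)
      also have "(\<inter>) S ` {U. openin mtopology U} = {U. openin S.sub.mtopology U}"
        unfolding S.mtopology_submetric openin_subtopology by auto
      finally show ?thesis .
    qed
    show "prob_space \<mu>"
      by (rule prob_spaceI) (use emS[OF Ss] S1 sp\<mu> in auto)
    fix x r :: real assume x: "x \<in> S" and r: "r > 0"
    have b: "S.sub.mball x r = S \<inter> mball x r"
      using x by (simp add: S.mball_submetric_eq)
    have "measure \<mu> (S.sub.mball x r) = measure \<nu> (S \<inter> mball x r)"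
      unfolding b using Ss \<nu>(2) by (intro mS) auto
    also have "\<dots> = measure \<nu> (mball x r)"
      using ae Ss \<nu>(2) by (intro measure_eq_AE) auto
    also have "\<dots> > 0" using x r unfolding S_def supp_def by auto
    finally show "measure \<mu> (S.sub.mball x r) > 0" .
  qed
  have ae': "AE t in unit_leb. g (\<theta> t) = \<theta> t"
  proof -
    have "AE t in unit_leb. \<theta> t \<in> S"
      using ae unfolding \<nu>_def by (rule AE_distrD[OF \<theta>])
    then show ?thesis by eventually_elim (simp add: g_def)
  qed
  have gm: "g \<in> measurable \<nu> \<mu>"
    unfolding \<mu>_def
  proof (rule measurable_restrict_space2)
    show "g \<in> space \<nu> \<rightarrow> S" using z0 by (auto simp: g_def)
    have "(\<lambda>x. if x \<in> S then x else z0) \<in> measurable \<nu> \<nu>"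
      by (rule measurable_If_set) (use z0 SM sp Ss in auto)
    then show "g \<in> measurable \<nu> \<nu>" unfolding g_def .
  qed
  have m: "g \<circ> \<theta> \<in> measurable unit_leb \<mu>"
    using \<theta> gm measurable_cong_sets[OF refl \<nu>(2)] measurable_comp[of \<theta> unit_leb \<nu>] by blast
  have "distr unit_leb \<mu> (g \<circ> \<theta>) = \<mu>"
  proof (rule measure_eqI)
    fix A assume "A \<in> sets (distr unit_leb \<mu> (g \<circ> \<theta>))"
    then have A: "A \<in> sets \<mu>" by simp
    then have A': "A \<in> sets \<nu>" "A \<subseteq> S"
      using Ss unfolding \<mu>_def by (auto simp: sets_restrict_space_iff)
    have "emeasure (distr unit_leb \<mu> (g \<circ> \<theta>)) A = emeasure unit_leb ((g \<circ> \<theta>) -` A \<inter> space unit_leb)"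
      using m A by (rule emeasure_distr)
    also have "\<dots> = emeasure unit_leb (\<theta> -` A \<inter> space unit_leb)"
    proof (rule emeasure_eq_AE)
      show "AE x in unit_leb. (x \<in> (g \<circ> \<theta>) -` A \<inter> space unit_leb) = (x \<in> \<theta> -` A \<inter> space unit_leb)"
        using ae' by eventually_elim auto
    qed (use measurable_sets[OF m A] measurable_sets[OF \<theta>, of A] A' \<nu>(2) in auto)
    also have "\<dots> = emeasure \<nu> A"
      unfolding \<nu>_def using \<theta> A' \<nu>(2) by (subst emeasure_distr) auto
    also have "\<dots> = emeasure \<mu> A" using emS A' by simp
    finally show "emeasure (distr unit_leb \<mu> (g \<circ> \<theta>)) A = emeasure \<mu> A" .
  qed simp
  with m have "parameter (g \<circ> \<theta>) (d, \<mu>)"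
    unfolding parameter_def by simp
  with \<open>mm_space (d, \<mu>)\<close> ae' show thesis
    using that[of "(d, \<mu>)" g] SM sp\<mu> by simp
qed

section \<open>Parameters that are constant on the mass intervals\<close>

text \<open>Half-open intervals partition [0, \<open>suminf a\<close>) without overlap. A zero mass
  yields the empty interval, on which \<open>constant_on_masses\<close> imposes nothing.\<close>

definition mass_interval :: "(nat \<Rightarrow> real) \<Rightarrow> nat \<Rightarrow> real set" where
  "mass_interval a i = {sum a {..<i}..<sum a {..<Suc i}}"

definition constant_on_masses :: "(nat \<Rightarrow> real) \<Rightarrow> (real \<Rightarrow> 'b) \<Rightarrow> bool" where
  "constant_on_masses a f \<longleftrightarrow> (\<forall>i. \<forall>s\<in>mass_interval a i. \<forall>t\<in>mass_interval a i. f s = f t)"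

lemma seqA_nonneg: "a \<in> seqA \<Longrightarrow> 0 \<le> a i"
  by (simp add: seqA_def)

lemma seqA_summable: "a \<in> seqA \<Longrightarrow> summable a"
  by (simp add: seqA_def)

lemma seqA_antimono: "a \<in> seqA \<Longrightarrow> i \<le> j \<Longrightarrow> a j \<le> a i"
  by (simp add: seqA_def antimonoD)

lemma seqA_sum_mono: "a \<in> seqA \<Longrightarrow> i \<le> j \<Longrightarrow> sum a {..<i} \<le> sum a {..<j}"
  by (intro sum_mono2) (auto simp: seqA_nonneg)

lemma seqA_sum_nonneg: "a \<in> seqA \<Longrightarrow> 0 \<le> sum a {..<i}"
  by (intro sum_nonneg) (auto simp: seqA_nonneg)

lemma seqA_sum_le_suminf: "a \<in> seqA \<Longrightarrow> sum a {..<i} \<le> suminf a"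
  by (intro sum_le_suminf) (auto simp: seqA_nonneg seqA_summable)

lemma seqA_summable_restrict:
  assumes a: "a \<in> seqA" shows "summable (\<lambda>i. a i * indicator B (x i))"
  using seqA_summable[OF a]
  by (rule summable_comparison_test'[where N = 0]) (use seqA_nonneg[OF a] in \<open>auto simp: indicator_def\<close>)

lemma seqA_suminf_le_1: "a \<in> seqA \<Longrightarrow> suminf a \<le> 1"
  by (simp add: seqA_def)

lemma seqA_suminf_nonneg: "a \<in> seqA \<Longrightarrow> 0 \<le> suminf a"
  using seqA_sum_le_suminf[of a 0] by simp

lemma seqA_sum_le_1: "a \<in> seqA \<Longrightarrow> sum a {..<i} \<le> 1"
  using seqA_sum_le_suminf seqA_suminf_le_1 by (meson order_trans)

text \<open>The first i+1 entries are all at least a i by monotonicity and sum to at most 1. This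
  decay is uniform over \<open>seqA\<close>, which is what both the approximation of pyramids and
  the weak topology rely on.\<close>

lemma seqA_le_inverse: 
  assumes "a \<in> seqA" shows "a i \<le> 1 / Suc i"
proof -
  have "real (Suc i) * a i = (\<Sum>j<Suc i. a i)" by simp
  also have "\<dots> \<le> sum a {..<Suc i}"
    by (intro sum_mono seqA_antimono[OF assms]) auto
  also have "\<dots> \<le> 1" by (rule seqA_sum_le_1[OF assms])
  finally show ?thesis by (simp add: field_simps)
qed

lemma mass_interval_borel [measurable]: "mass_interval a i \<in> sets borel"
  by (simp add: mass_interval_def)

lemma mass_interval_subset:
  assumes "a \<in> seqA" shows "mass_interval a i \<subseteq> {0..<suminf a}" "mass_interval a i \<subseteq> {0..<1}"
  using seqA_sum_nonneg[OF assms, of i] seqA_sum_le_suminf[OF assms, of "Suc i"] seqA_suminf_le_1[OF assms]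
  unfolding mass_interval_def by auto

lemma mass_interval_disjoint:
  assumes "a \<in> seqA" "t \<in> mass_interval a i" "t \<in> mass_interval a j"
  shows "i = j"
proof (rule ccontr)
  assume "i \<noteq> j"
  then consider "Suc i \<le> j" | "Suc j \<le> i" by linarith
  then show False
    by cases (use seqA_sum_mono[OF assms(1), of "Suc i" j] seqA_sum_mono[OF assms(1), of "Suc j" i] assms(2,3)
        in \<open>auto simp: mass_interval_def\<close>)
qed

lemma mass_interval_cover:
  assumes "a \<in> seqA" "0 \<le> t" "t < suminf a"
  obtains i where "t \<in> mass_interval a i"
proof -
  have "\<exists>i. t < sum a {..<i}"
  proof (rule ccontr)
    assume "\<not> (\<exists>i. t < sum a {..<i})"
    then have "suminf a \<le> t"
      by (intro suminf_le_const seqA_summable[OF assms(1)]) (simp add: not_less)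
    then show False using assms(3) by simp
  qed
  define i where "i = (LEAST i. t < sum a {..<i})"
  have i: "t < sum a {..<i}"
    unfolding i_def using \<open>\<exists>i. t < sum a {..<i}\<close> by (rule LeastI_ex)
  have "i \<noteq> 0" using i assms(2) by (cases i) auto
  then obtain j where j: "i = Suc j" using not0_implies_Suc by blast
  have "\<not> t < sum a {..<j}"
    using not_less_Least[of j "\<lambda>i. t < sum a {..<i}"] j unfolding i_def by simp
  then have "t \<in> mass_interval a j" using i j by (simp add: mass_interval_def)
  then show thesis by (rule that)
qed

lemma measure_mass_interval:
  assumes "a \<in> seqA" shows "measure unit_leb (mass_interval a i) = a i"
proof -
  have "measure unit_leb (mass_interval a i) = measure lborel (mass_interval a i)"
    by (rule measure_unit_leb[OF mass_interval_subset(2)[OF assms]])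
  also have "\<dots> = a i"
    unfolding mass_interval_def using seqA_sum_mono[OF assms, of i "Suc i"] by simp
  finally show ?thesis .
qed

lemma mass_interval_sets: "a \<in> seqA \<Longrightarrow> mass_interval a i \<in> sets unit_leb"
  using mass_interval_subset(2) by (simp add: sets_unit_leb)

lemma measure_UN_mass_interval:
  assumes "a \<in> seqA" "finite I"
  shows "measure unit_leb (\<Union>i\<in>I. mass_interval a i) = sum a I"
proof -
  have "measure unit_leb (\<Union>i\<in>I. mass_interval a i) = (\<Sum>i\<in>I. measure unit_leb (mass_interval a i))"
    using assms mass_interval_sets[OF assms(1)] mass_interval_disjoint[OF assms(1)]
    by (intro unit_leb.finite_measure_finite_Union) (auto simp: disjoint_family_on_def)
  then show ?thesis using measure_mass_interval[OF assms(1)] by simp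
qed

lemma parameter_measurable: "parameter \<phi> X \<Longrightarrow> \<phi> \<in> measurable unit_leb (snd X)"
  by (simp add: parameter_def)

lemma parameter_space: "parameter \<phi> X \<Longrightarrow> t \<in> {0..<1} \<Longrightarrow> \<phi> t \<in> space (snd X)"
  using parameter_measurable[THEN measurable_space] by simp

lemma parameter_measure:
  assumes "parameter \<phi> X" "B \<in> sets (snd X)"
  shows "measure (snd X) B = measure unit_leb {t \<in> {0..<1}. \<phi> t \<in> B}"
proof -
  have "measure (snd X) B = measure (distr unit_leb (snd X) \<phi>) B"
    using assms by (simp add: parameter_def)
  also have "\<dots> = measure unit_leb (\<phi> -` B \<inter> space unit_leb)"
    using assms parameter_measurable by (intro measure_distr) auto
  also have "\<phi> -` B \<inter> space unit_leb = {t \<in> {0..<1}. \<phi> t \<in> B}" by auto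
  finally show ?thesis .
qed

lemma parameter_sets:
  assumes "parameter \<phi> X" "B \<in> sets (snd X)"
  shows "{t \<in> {0..<1}. \<phi> t \<in> B} \<in> sets unit_leb"
  using measurable_sets[OF parameter_measurable[OF assms(1)] assms(2)]
  by (simp add: vimage_def Int_def conj_commute)

text \<open>The atoms are the values on the intervals. The intervals whose value lies in B are
  disjoint parts of the preimage of B, so every partial sum is bounded by the mass of B.\<close>

lemma in_pyrA_if_parameter:
  assumes a: "a \<in> seqA" and X: "mm_space X" and \<phi>: "parameter \<phi> X" and c: "constant_on_masses a \<phi>"
  shows "X \<in> pyrA a"
proof -
  \<comment> \<open>An empty interval has mass 0, so any point of X will do for it; \<phi> 0 is
    one.\<close>
  define x where "x i = (if mass_interval a i = {} then \<phi> 0 else \<phi> (SOME t. t \<in> mass_interval a i))" for i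
  have some: "(SOME t. t \<in> mass_interval a i) \<in> mass_interval a i" if "t \<in> mass_interval a i" for t i
    using that by (rule someI)
  have x\<phi>: "\<phi> t = x i" if "t \<in> mass_interval a i" for i t
  proof -
    have "x i = \<phi> (SOME t. t \<in> mass_interval a i)" using that by (auto simp: x_def)
    then show ?thesis using some[OF that] that c unfolding constant_on_masses_def by metis
  qed
  have xs: "x i \<in> space (snd X)" for i
  proof (cases "mass_interval a i = {}")
    case True
    then show ?thesis using parameter_space[OF \<phi>, of 0] by (simp add: x_def)
  next
    case False
    then have "(SOME t. t \<in> mass_interval a i) \<in> mass_interval a i" using some by blast
    then show ?thesis
      using False parameter_space[OF \<phi>] mass_interval_subset(2)[OF a, of i] by (auto simp: x_def)
  qed
  have "(\<Sum>i. a i * indicator B (x i)) \<le> measure (snd X) B" if B: "B \<in> sets (snd X)" for B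
  proof (rule suminf_le_const)
    show "summable (\<lambda>i. a i * indicator B (x i))"
      by (rule seqA_summable_restrict[OF a])
    fix n
    let ?I = "{i \<in> {..<n}. x i \<in> B}"
    have "(\<Sum>i<n. a i * indicator B (x i)) = (\<Sum>i<n. if x i \<in> B then a i else 0)"
      by (intro sum.cong) (auto simp: indicator_def)
    also have "\<dots> = sum a ?I" by (rule sum.inter_filter[symmetric]) simp
    also have "\<dots> = measure unit_leb (\<Union>i\<in>?I. mass_interval a i)"
      by (rule measure_UN_mass_interval[OF a, symmetric]) simp
    also have "\<dots> \<le> measure unit_leb {t \<in> {0..<1}. \<phi> t \<in> B}"
      by (intro unit_leb.finite_measure_mono parameter_sets[OF \<phi> B])
        (use x\<phi> mass_interval_subset(2)[OF a] in \<open>auto simp: subset_iff\<close>)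
    also have "\<dots> = measure (snd X) B"
      by (rule parameter_measure[OF \<phi> B, symmetric])
    finally show "(\<Sum>i<n. a i * indicator B (x i)) \<le> measure (snd X) B" .
  qed
  then show ?thesis using X xs unfolding pyrA_def by blast
qed

section \<open>The mass left over after removing the atoms\<close>

lemma emeasure_lborel_rescale:
  assumes s: "s < 1" and A: "A \<subseteq> {s..<1}" "A \<in> sets borel"
  shows "emeasure lborel A = ennreal (1 - s) * emeasure unit_leb {u \<in> {0..<1}. s + (1 - s) * u \<in> A}"
proof -
  have "emeasure lborel A = emeasure (density (distr lborel borel (\<lambda>x. s + (1 - s) * x)) (\<lambda>_. ennreal \<bar>1 - s\<bar>)) A"
    using lborel_real_affine[of "1 - s" s] s by simp
  also have "\<dots> = ennreal (1 - s) * emeasure lborel ((\<lambda>x. s + (1 - s) * x) -` A)"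
    using s A by (simp add: emeasure_density_const emeasure_distr)
  also have "(\<lambda>x. s + (1 - s) * x) -` A = {u \<in> {0..<1}. s + (1 - s) * u \<in> A}"
  proof -
    have "u \<in> {0..<1}" if "s + (1 - s) * u \<in> A" for u
    proof -
      have "s \<le> s + (1 - s) * u" "s + (1 - s) * u < 1" using that A by force+
      then have *: "0 \<le> (1 - s) * u" "(1 - s) * u < 1 - s" by linarith+
      have "0 \<le> u" using *(1) s by (simp add: zero_le_mult_iff)
      moreover have "u < 1" using *(2) s mult_less_cancel_left_pos[of "1 - s" u 1] by simp
      ultimately show ?thesis by simp
    qed
    then show ?thesis by auto
  qed
  also have "emeasure lborel \<dots> = emeasure unit_leb \<dots>"
    by (rule emeasure_unit_leb[symmetric]) auto
  finally show ?thesis .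
qed

lemma emeasure_UN_mass_interval:
  assumes a: "a \<in> seqA"
  shows "emeasure lborel (\<Union>i\<in>I. mass_interval a i) = ennreal (\<Sum>i. a i * indicator I i)"
proof -
  have sm: "summable (\<lambda>i. a i * indicator I i)"
    by (rule seqA_summable_restrict[OF a])
  let ?F = "\<lambda>i. if i \<in> I then mass_interval a i else {}"
  have "emeasure lborel (\<Union>i\<in>I. mass_interval a i) = emeasure lborel (\<Union>i. ?F i)"
    by (rule arg_cong[where f = "emeasure lborel"]) auto
  also have "\<dots> = (\<Sum>i. emeasure lborel (?F i))"
    by (rule suminf_emeasure[symmetric]) (use mass_interval_disjoint[OF a] in \<open>auto simp: disjoint_family_on_def split: if_splits\<close>)
  also have "\<dots> = (\<Sum>i. ennreal (a i * indicator I i))"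
  proof (rule suminf_cong)
    fix i
    have "emeasure lborel (mass_interval a i) = ennreal (a i)"
      unfolding mass_interval_def using seqA_nonneg[OF a, of i] by simp
    then show "emeasure lborel (?F i) = ennreal (a i * indicator I i)" by simp
  qed
  also have "\<dots> = ennreal (\<Sum>i. a i * indicator I i)"
    by (rule suminf_ennreal2[OF _ sm]) (use seqA_nonneg[OF a] in simp)
  finally show ?thesis .
qed

text \<open>Subtracting the atoms from \<mu> leaves a measure because the atomic part is dominated
  on every set; dividing by its mass 1 - \<open>suminf a\<close> > 0 gives \<rho>. The conclusion is
  a product, so no quotient of extended reals occurs.\<close>

lemma exists_diff_probability:
  fixes x :: "nat \<Rightarrow> 'b"
  assumes a: "a \<in> seqA" and s: "suminf a < 1" and \<mu>: "prob_space \<mu>"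
    and x: "\<And>i. x i \<in> space \<mu>"
    and le: "\<And>B. B \<in> sets \<mu> \<Longrightarrow> (\<Sum>i. a i * indicator B (x i)) \<le> measure \<mu> B"
  obtains \<rho> where "prob_space \<rho>" "sets \<rho> = sets \<mu>"
    "\<And>B. B \<in> sets \<mu> \<Longrightarrow> ennreal (1 - suminf a) * emeasure \<rho> B = ennreal (measure \<mu> B - (\<Sum>i. a i * indicator B (x i)))"
proof -
  interpret \<mu>: prob_space \<mu> by fact
  \<comment> \<open>The atomic part is the image under x of a weighted counting measure on the
    indices, so countable additivity and coinciding points need no argument.\<close>
  define \<nu> where "\<nu> = distr (density (count_space UNIV) (\<lambda>i. ennreal (a i))) \<mu> x"
  have sets\<nu>: "sets \<nu> = sets \<mu>" by (simp add: \<nu>_def)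
  have xm: "x \<in> measurable (density (count_space UNIV) (\<lambda>i. ennreal (a i))) \<mu>"
    using x by (simp add: measurable_def)
  have em\<nu>: "emeasure \<nu> B = ennreal (\<Sum>i. a i * indicator B (x i))" if B: "B \<in> sets \<mu>" for B
  proof -
    have sm: "summable (\<lambda>i. a i * indicator B (x i))"
      by (rule seqA_summable_restrict[OF a])
    have "emeasure \<nu> B = emeasure (density (count_space UNIV) (\<lambda>i. ennreal (a i))) (x -` B)"
      unfolding \<nu>_def using emeasure_distr[OF xm B] by simp
    also have "\<dots> = (\<Sum>i. ennreal (a i) * indicator (x -` B) i)"
      by (simp add: emeasure_density nn_integral_count_space_nat)
    also have "\<dots> = (\<Sum>i. ennreal (a i * indicator B (x i)))"
      by (rule suminf_cong) (auto simp: indicator_def)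
    also have "\<dots> = ennreal (\<Sum>i. a i * indicator B (x i))"
      by (rule suminf_ennreal2[OF _ sm]) (use seqA_nonneg[OF a] in simp)
    finally show ?thesis .
  qed
  have "finite_measure \<nu>"
    by (rule finite_measureI) (use em\<nu>[OF sets.top] sets_eq_imp_space_eq[OF sets\<nu>] in simp)
  define D where "D = diff_measure \<mu> \<nu>"
  have setsD: "sets D = sets \<mu>" by (simp add: D_def diff_measure_def)
  have emD: "emeasure D B = ennreal (measure \<mu> B - (\<Sum>i. a i * indicator B (x i)))" if B: "B \<in> sets \<mu>" for B
  proof -
    have pos: "emeasure \<nu> C \<le> emeasure \<mu> C" if "C \<in> sets \<mu>" for C
      using em\<nu>[OF that] le[OF that] by (simp add: \<mu>.emeasure_eq_measure ennreal_leI)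
    have nn: "0 \<le> (\<Sum>i. a i * indicator B (x i))"
    proof (rule suminf_nonneg)
      show "summable (\<lambda>i. a i * indicator B (x i))"
        by (rule seqA_summable_restrict[OF a])
    qed (use seqA_nonneg[OF a] in simp)
    have "emeasure D B = emeasure \<mu> B - emeasure \<nu> B"
      unfolding D_def
      by (rule emeasure_diff_measure) (use \<open>finite_measure \<nu>\<close> \<mu>.finite_measure_axioms sets\<nu> pos B in auto)
    also have "\<dots> = ennreal (measure \<mu> B - (\<Sum>i. a i * indicator B (x i)))"
      unfolding em\<nu>[OF B] \<mu>.emeasure_eq_measure using nn by (simp add: ennreal_minus)
    finally show ?thesis .
  qed
  define \<rho> where "\<rho> = scale_measure (ennreal (1 / (1 - suminf a))) D"
  have em\<rho>: "emeasure \<rho> B = ennreal (1 / (1 - suminf a)) * ennreal (measure \<mu> B - (\<Sum>i. a i * indicator B (x i)))"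
    if "B \<in> sets \<mu>" for B
    unfolding \<rho>_def using emD[OF that] by simp
  have sets\<rho>: "sets \<rho> = sets \<mu>" unfolding \<rho>_def using setsD by simp
  show thesis
  proof (rule that)
    show "sets \<rho> = sets \<mu>" by (rule sets\<rho>)
    show "ennreal (1 - suminf a) * emeasure \<rho> B = ennreal (measure \<mu> B - (\<Sum>i. a i * indicator B (x i)))"
      if "B \<in> sets \<mu>" for B
    proof -
      have "ennreal (1 - suminf a) * ennreal (1 / (1 - suminf a)) = 1"
        using s by (simp add: ennreal_mult[symmetric])
      then show ?thesis unfolding em\<rho>[OF that] by (simp add: mult.assoc[symmetric])
    qed
    show "prob_space \<rho>"
    proof (rule prob_spaceI)
      have "(\<Sum>i. a i * indicator (space \<mu>) (x i)) = suminf a" using x by simp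
      then show "emeasure \<rho> (space \<rho>) = 1"
        using em\<rho>[OF sets.top] s by (simp add: sets_eq_imp_space_eq[OF sets\<rho>] \<mu>.prob_space ennreal_mult[symmetric])
    qed
  qed
qed

text \<open>The parameter is glued from two pieces: the value x i on the i-th interval, and on [s,1)
  with s = \<open>suminf a\<close> an affinely rescaled parameter of the normalized remainder. The
  two pieces account for the two summands of the mass of B.\<close>

lemma exists_constant_parameter:
  assumes a: "a \<in> seqA" and "X \<in> pyrA a"
  obtains \<phi> where "parameter \<phi> X" "constant_on_masses a \<phi>"
proof -
  have X: "mm_space X" using assms(2) by (simp add: pyrA_def)
  define M where "M = space (snd X)"
  obtain x where x: "\<And>i. x i \<in> M"
    and le: "\<And>B. B \<in> sets (snd X) \<Longrightarrow> (\<Sum>i. a i * indicator B (x i)) \<le> measure (snd X) B"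
    using assms(2) unfolding pyrA_def M_def by blast
  interpret \<mu>: prob_space "snd X" using X by (rule mm_space_polish)
  interpret polish_metric "space (snd X)" "fst X" using X by (rule mm_space_polish)
  define s where "s = suminf a"
  have s01: "0 \<le> s" "s \<le> 1" using seqA_suminf_nonneg[OF a] seqA_suminf_le_1[OF a] by (auto simp: s_def)
  have "\<exists>\<psi>. \<psi> \<in> measurable unit_leb (snd X) \<and> (\<forall>B\<in>sets (snd X).
      emeasure lborel {t \<in> {s..<1}. \<psi> ((t - s) / (1 - s)) \<in> B} =
      ennreal (measure (snd X) B - (\<Sum>i. a i * indicator B (x i))))"
  proof (cases "s < 1")
    case True
    then obtain \<rho> where \<rho>: "prob_space \<rho>" "sets \<rho> = sets (snd X)"
      "\<And>B. B \<in> sets (snd X) \<Longrightarrow> ennreal (1 - suminf a) * emeasure \<rho> B = ennreal (measure (snd X) B - (\<Sum>i. a i * indicator B (x i)))"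
      using exists_diff_probability[OF a, of "snd X" x] \<mu>.prob_space_axioms x le unfolding s_def M_def by blast
    obtain \<psi> where \<psi>: "\<psi> \<in> measurable unit_leb mborel" "distr unit_leb mborel \<psi> = \<rho>"
      using exists_measure_parameter[OF \<rho>(1)] \<rho>(2) mm_space_polish(2)[OF X] by metis
    have \<psi>X: "\<psi> \<in> measurable unit_leb (snd X)"
      using \<psi>(1) measurable_cong_sets[OF refl mm_space_polish(2)[OF X]] by blast
    have "emeasure lborel {t \<in> {s..<1}. \<psi> ((t - s) / (1 - s)) \<in> B} =
      ennreal (measure (snd X) B - (\<Sum>i. a i * indicator B (x i)))" if B: "B \<in> sets (snd X)" for B
    proof -
      let ?A = "{t \<in> {s..<1}. \<psi> ((t - s) / (1 - s)) \<in> B}"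
      have pre: "\<psi> -` B \<inter> {0..<1} \<in> sets borel"
        using measurable_sets[OF \<psi>X B] by (simp add: sets_unit_leb)
      have "?A = (\<lambda>t. (t - s) / (1 - s)) -` (\<psi> -` B \<inter> {0..<1}) \<inter> space borel"
        using True by (auto simp: field_simps)
      also have "\<dots> \<in> sets borel"
        by (rule measurable_sets[OF _ pre]) measurable
      finally have As: "?A \<in> sets borel" .
      have "emeasure lborel ?A = ennreal (1 - s) * emeasure unit_leb {u \<in> {0..<1}. s + (1 - s) * u \<in> ?A}"
        by (rule emeasure_lborel_rescale[OF True _ As]) auto
      also have "{u \<in> {0..<1}. s + (1 - s) * u \<in> ?A} = \<psi> -` B \<inter> space unit_leb"
      proof -
        have "s + (1 - s) * u \<in> {s..<1}" if "u \<in> {0..<1}" for u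
        proof -
          have "(1 - s) * u < (1 - s) * 1" using that True by (intro mult_strict_left_mono) auto
          then have "(1 - s) * u < 1 - s" by (simp only: mult_1_right)
          moreover have "0 \<le> (1 - s) * u" using that True by simp
          ultimately show ?thesis unfolding atLeastLessThan_iff by (intro conjI) linarith+
        qed
        then show ?thesis using True by auto
      qed
      also have "emeasure unit_leb \<dots> = emeasure \<rho> B"
        unfolding \<psi>(2)[symmetric] using \<psi>(1) B mm_space_polish(2)[OF X] by (simp add: emeasure_distr)
      finally show ?thesis using \<rho>(3)[OF B] by (simp add: s_def)
    qed
    then show ?thesis using \<psi>X by blast
  next
    case False
    then have s1: "s = 1" using s01 by simp
    obtain \<psi> where \<psi>: "parameter \<psi> X" using exists_parameter[OF X] by blast
    \<comment> \<open>For s = 1 nothing is left over: domination on B and on its complement compares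
      two pairs of numbers that both add up to 1, which forces equality. Any parameter then serves
      as \<psi>.\<close>
    have "measure (snd X) B - (\<Sum>i. a i * indicator B (x i)) = 0" if B: "B \<in> sets (snd X)" for B
    proof -
      have sm: "summable (\<lambda>i. a i * indicator B (x i))" for B
        by (rule seqA_summable_restrict[OF a])
      have "(\<Sum>i. a i * indicator (space (snd X) - B) (x i)) \<le> measure (snd X) (space (snd X) - B)"
        using B by (intro le) auto
      also have "\<dots> = 1 - measure (snd X) B" by (rule \<mu>.prob_compl[OF B])
      finally have "(\<Sum>i. a i * indicator B (x i)) + (\<Sum>i. a i * indicator (space (snd X) - B) (x i)) \<le> (\<Sum>i. a i * indicator B (x i)) + 1 - measure (snd X) B"
        by simp
      also have "(\<Sum>i. a i * indicator B (x i)) + (\<Sum>i. a i * indicator (space (snd X) - B) (x i)) =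
         (\<Sum>i. a i * indicator B (x i) + a i * indicator (space (snd X) - B) (x i))"
        by (rule suminf_add[OF sm sm])
      also have "\<dots> = suminf a"
        by (rule suminf_cong) (use x in \<open>auto simp: indicator_def M_def\<close>)
      finally show ?thesis using le[OF B] s1 by (simp add: s_def)
    qed
    then show ?thesis using parameter_measurable[OF \<psi>] s1 by auto
  qed
  then obtain \<psi> where \<psi>: "\<psi> \<in> measurable unit_leb (snd X)"
    and em\<psi>: "\<And>B. B \<in> sets (snd X) \<Longrightarrow> emeasure lborel {t \<in> {s..<1}. \<psi> ((t - s) / (1 - s)) \<in> B} =
      ennreal (measure (snd X) B - (\<Sum>i. a i * indicator B (x i)))" by blast
  define \<phi> where "\<phi> t = (if t < s then x (THE i. t \<in> mass_interval a i) else \<psi> ((t - s) / (1 - s)))" for t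
  have the: "(THE i. t \<in> mass_interval a i) = i" if "t \<in> mass_interval a i" for t i
    using that mass_interval_disjoint[OF a] by blast
  have \<phi>J: "\<phi> t = x i" if "t \<in> mass_interval a i" for t i
    using the[OF that] that mass_interval_subset(1)[OF a, of i] by (auto simp: \<phi>_def s_def)
  have split: "{t \<in> {0..<1}. \<phi> t \<in> B} =
      (\<Union>i\<in>{i. x i \<in> B}. mass_interval a i) \<union> {t \<in> {s..<1}. \<psi> ((t - s) / (1 - s)) \<in> B}" for B
  proof (intro equalityI subsetI)
    fix t assume t: "t \<in> {t \<in> {0..<1}. \<phi> t \<in> B}"
    show "t \<in> (\<Union>i\<in>{i. x i \<in> B}. mass_interval a i) \<union> {t \<in> {s..<1}. \<psi> ((t - s) / (1 - s)) \<in> B}"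
    proof (cases "t < s")
      case True
      then obtain i where "t \<in> mass_interval a i"
        using mass_interval_cover[OF a, of t] t by (auto simp: s_def)
      then show ?thesis using \<phi>J t by auto
    qed (use t in \<open>auto simp: \<phi>_def\<close>)
  next
    fix t assume "t \<in> (\<Union>i\<in>{i. x i \<in> B}. mass_interval a i) \<union> {t \<in> {s..<1}. \<psi> ((t - s) / (1 - s)) \<in> B}"
    then show "t \<in> {t \<in> {0..<1}. \<phi> t \<in> B}"
    proof
      assume "t \<in> (\<Union>i\<in>{i. x i \<in> B}. mass_interval a i)"
      then obtain i where "x i \<in> B" "t \<in> mass_interval a i" by blast
      then show ?thesis using \<phi>J mass_interval_subset(2)[OF a, of i] by auto
    next
      assume "t \<in> {t \<in> {s..<1}. \<psi> ((t - s) / (1 - s)) \<in> B}"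
      then show ?thesis using s01 by (simp add: \<phi>_def)
    qed
  qed
  have tail_sets: "{t \<in> {s..<1}. \<psi> ((t - s) / (1 - s)) \<in> B} \<in> sets borel" if B: "B \<in> sets (snd X)" for B
  proof -
    have pre: "\<psi> -` B \<inter> {0..<1} \<in> sets borel"
      using measurable_sets[OF \<psi> B] by (simp add: sets_unit_leb)
    \<comment> \<open>The quotient degenerates for s = 1, where [s,1) is empty.\<close>
    have "{t \<in> {s..<1}. \<psi> ((t - s) / (1 - s)) \<in> B} =
      (if s < 1 then (\<lambda>t. (t - s) / (1 - s)) -` (\<psi> -` B \<inter> {0..<1}) \<inter> space borel else {})"
      by (auto simp: field_simps)
    also have "\<dots> \<in> sets borel"
      using measurable_sets[OF _ pre, of "\<lambda>t. (t - s) / (1 - s)" borel] by simp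
    finally show ?thesis .
  qed
  have \<phi>m: "\<phi> \<in> measurable unit_leb (snd X)"
  proof (rule measurableI)
    show "\<phi> t \<in> space (snd X)" if t: "t \<in> space unit_leb" for t
    proof (cases "t < s")
      case True
      then show ?thesis using x by (simp add: \<phi>_def M_def)
    next
      case False
      then have "(t - s) / (1 - s) \<in> space unit_leb" using t s01 by (auto simp: field_simps)
      then show ?thesis using False measurable_space[OF \<psi>] by (simp add: \<phi>_def)
    qed
    fix B assume B: "B \<in> sets (snd X)"
    have "\<phi> -` B \<inter> space unit_leb = {t \<in> {0..<1}. \<phi> t \<in> B}" by auto
    moreover have "{t \<in> {0..<1}. \<phi> t \<in> B} \<in> sets borel"
      unfolding split using tail_sets[OF B] by (intro sets.Un sets.countable_UN') auto
    ultimately show "\<phi> -` B \<inter> space unit_leb \<in> sets unit_leb" by (auto simp: sets_unit_leb)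
  qed
  have "distr unit_leb (snd X) \<phi> = snd X"
  proof (rule measure_eqI)
    fix B assume "B \<in> sets (distr unit_leb (snd X) \<phi>)"
    then have B: "B \<in> sets (snd X)" by simp
    have "emeasure (distr unit_leb (snd X) \<phi>) B = emeasure unit_leb (\<phi> -` B \<inter> space unit_leb)"
      by (rule emeasure_distr[OF \<phi>m B])
    also have "\<phi> -` B \<inter> space unit_leb = {t \<in> {0..<1}. \<phi> t \<in> B}" by auto
    also have "emeasure unit_leb \<dots> = emeasure lborel \<dots>" by (rule emeasure_unit_leb) auto
    also have "\<dots> = emeasure lborel (\<Union>i\<in>{i. x i \<in> B}. mass_interval a i) +
        emeasure lborel {t \<in> {s..<1}. \<psi> ((t - s) / (1 - s)) \<in> B}"
      unfolding split
    proof (rule plus_emeasure[symmetric])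
      show "(\<Union>i\<in>{i. x i \<in> B}. mass_interval a i) \<inter> {t \<in> {s..<1}. \<psi> ((t - s) / (1 - s)) \<in> B} = {}"
        using mass_interval_subset(1)[OF a] by (fastforce simp: s_def)
    qed (use tail_sets[OF B] in \<open>auto intro!: sets.countable_UN'\<close>)
    also have "\<dots> = ennreal (\<Sum>i. a i * indicator B (x i)) +
        ennreal (measure (snd X) B - (\<Sum>i. a i * indicator B (x i)))"
      using emeasure_UN_mass_interval[OF a, of "{i. x i \<in> B}"] em\<psi>[OF B] by (simp add: indicator_def)
    also have "\<dots> = ennreal (measure (snd X) B)"
    proof -
      have "0 \<le> (\<Sum>i. a i * indicator B (x i))"
      proof (rule suminf_nonneg)
        show "summable (\<lambda>i. a i * indicator B (x i))"
          by (rule seqA_summable_restrict[OF a])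
      qed (use seqA_nonneg[OF a] in simp)
      then show ?thesis using le[OF B] by (simp add: ennreal_plus[symmetric] del: ennreal_plus)
    qed
    finally show "emeasure (distr unit_leb (snd X) \<phi>) B = emeasure (snd X) B"
      by (simp add: \<mu>.emeasure_eq_measure)
  qed simp
  with \<phi>m have "parameter \<phi> X" by (simp add: parameter_def)
  moreover have "constant_on_masses a \<phi>"
    unfolding constant_on_masses_def using \<phi>J by auto
  ultimately show thesis by (rule that)
qed

section \<open>Box distance and pyramids\<close>

lemma box_dist_bdd_below: "bdd_below {\<epsilon>. \<epsilon> \<ge> 0 \<and>
     (\<exists>\<phi> \<psi> I0. parameter \<phi> X \<and> parameter \<psi> Y \<and> I0 \<in> sets unit_leb \<and>
        measure unit_leb I0 \<ge> 1 - \<epsilon> \<and>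
        (\<forall>s\<in>I0. \<forall>t\<in>I0. \<bar>fst X (\<phi> s) (\<phi> t) - fst Y (\<psi> s) (\<psi> t)\<bar> \<le> \<epsilon>))}"
  by (rule bdd_belowI[of _ 0]) auto

lemma box_dist_le:
  assumes "\<epsilon> \<ge> 0" "parameter \<phi> X" "parameter \<psi> Y" "I0 \<in> sets unit_leb" "measure unit_leb I0 \<ge> 1 - \<epsilon>"
    "\<And>s t. s \<in> I0 \<Longrightarrow> t \<in> I0 \<Longrightarrow> \<bar>fst X (\<phi> s) (\<phi> t) - fst Y (\<psi> s) (\<psi> t)\<bar> \<le> \<epsilon>"
  shows "box_dist X Y \<le> \<epsilon>"
  unfolding box_dist_def using assms by (intro cInf_lower box_dist_bdd_below) blast

text \<open>At \<epsilon> = 1 the empty set is an admissible \<open>I0\<close>, so any two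
  parameters are witnesses.\<close>

lemma box_dist_ne:
  assumes "mm_space X" "mm_space Y"
  shows "{\<epsilon>. \<epsilon> \<ge> 0 \<and>
     (\<exists>\<phi> \<psi> I0. parameter \<phi> X \<and> parameter \<psi> Y \<and> I0 \<in> sets unit_leb \<and>
        measure unit_leb I0 \<ge> 1 - \<epsilon> \<and>
        (\<forall>s\<in>I0. \<forall>t\<in>I0. \<bar>fst X (\<phi> s) (\<phi> t) - fst Y (\<psi> s) (\<psi> t)\<bar> \<le> \<epsilon>))} \<noteq> {}" (is "?S \<noteq> {}")
proof -
  obtain \<phi> \<psi> where "parameter \<phi> X" "parameter \<psi> Y"
    using exists_parameter[OF assms(1)] exists_parameter[OF assms(2)] by metis
  then have "(1::real) \<ge> 0 \<and> parameter \<phi> X \<and> parameter \<psi> Y \<and> {} \<in> sets unit_leb \<and>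
      measure unit_leb {} \<ge> 1 - 1 \<and> (\<forall>s\<in>{}. \<forall>t\<in>{}. \<bar>fst X (\<phi> s) (\<phi> t) - fst Y (\<psi> s) (\<psi> t)\<bar> \<le> 1)"
    by simp
  then show ?thesis by blast
qed

lemma box_dist_nonneg:
  assumes "mm_space X" "mm_space Y" shows "0 \<le> box_dist X Y"
  unfolding box_dist_def by (rule cInf_greatest[OF box_dist_ne[OF assms]]) blast

lemma box_dist_lessE:
  assumes "mm_space X" "mm_space Y" "box_dist X Y < \<epsilon>"
  obtains \<phi> \<psi> I0 where "parameter \<phi> X" "parameter \<psi> Y" "I0 \<in> sets unit_leb" "measure unit_leb I0 \<ge> 1 - \<epsilon>"
    "\<And>s t. s \<in> I0 \<Longrightarrow> t \<in> I0 \<Longrightarrow> \<bar>fst X (\<phi> s) (\<phi> t) - fst Y (\<psi> s) (\<psi> t)\<bar> \<le> \<epsilon>"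
proof -
  obtain \<delta> \<phi> \<psi> I0 where *: "\<delta> < \<epsilon>" "parameter \<phi> X" "parameter \<psi> Y" "I0 \<in> sets unit_leb" "measure unit_leb I0 \<ge> 1 - \<delta>"
    "\<forall>s\<in>I0. \<forall>t\<in>I0. \<bar>fst X (\<phi> s) (\<phi> t) - fst Y (\<psi> s) (\<psi> t)\<bar> \<le> \<delta>"
    using cInf_lessD[OF box_dist_ne[OF assms(1,2)] assms(3)[unfolded box_dist_def]] by blast
  show thesis
    by (rule that[OF *(2-4)]) (use * in force)+
qed

lemma box_dist_set_le:
  assumes "mm_space X" "P \<subseteq> {X. mm_space X}" "Y \<in> P"
  shows "box_dist_set X P \<le> box_dist X Y"
  unfolding box_dist_set_def
proof (rule cINF_lower[OF bdd_belowI2[of _ 0]])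
  show "0 \<le> box_dist X Y" if "Y \<in> P" for Y
    using assms that by (intro box_dist_nonneg) auto
qed fact

lemma box_dist_set_nonneg:
  assumes "mm_space X" "P \<subseteq> {X. mm_space X}" "P \<noteq> {}"
  shows "0 \<le> box_dist_set X P"
  unfolding box_dist_set_def
proof (rule cINF_greatest)
  show "0 \<le> box_dist X Y" if "Y \<in> P" for Y
    using assms that by (intro box_dist_nonneg) auto
qed fact

lemma box_dist_set_lessE:
  assumes "P \<noteq> {}" "box_dist_set X P < \<epsilon>"
  obtains Y where "Y \<in> P" "box_dist X Y < \<epsilon>"
  using cInf_lessD[OF _ assms(2)[unfolded box_dist_set_def]] assms(1) by auto

section \<open>Nonemptiness, downward closedness and directedness of P_A\<close>

lemma pyrA_mm_space: "pyrA a \<subseteq> {X. mm_space X}"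
  by (auto simp: pyrA_def)

text \<open>The device by which elements of \<open>pyrA a\<close> are produced: it suffices to write
  down a map on [0,1). The null-set correction g acts after \<theta> and so keeps constancy on the
  intervals.\<close>

lemma law_in_pyrA:
  assumes a: "a \<in> seqA" and "polish_metric M d" and "\<theta> \<in> measurable unit_leb (polish_metric.mborel M d)"
    and c: "constant_on_masses a \<theta>"
  obtains Z g where "Z \<in> pyrA a" "fst Z = d" "space (snd Z) \<subseteq> M" "parameter (g \<circ> \<theta>) Z"
    "AE t in unit_leb. g (\<theta> t) = \<theta> t"
proof -
  obtain Z g where Z: "mm_space Z" "fst Z = d" "space (snd Z) \<subseteq> M" "parameter (g \<circ> \<theta>) Z"
    "AE t in unit_leb. g (\<theta> t) = \<theta> t"
    using law_mm_space[OF assms(2,3)] by blast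
  have "constant_on_masses a (g \<circ> \<theta>)"
    using c unfolding constant_on_masses_def comp_def by metis
  then have "Z \<in> pyrA a" by (rule in_pyrA_if_parameter[OF a Z(1) Z(4)])
  then show thesis using that Z by blast
qed

lemma polish_metricI:
  assumes "Metric_space M d" "Metric_space.mcomplete M d"
    and q: "\<And>n::nat. q n \<in> M" "\<And>x e. \<lbrakk>x \<in> M; e > 0\<rbrakk> \<Longrightarrow> \<exists>n. d x (q n) < e"
  shows "polish_metric M d"
proof -
  interpret Metric_space M d by fact
  have "mtopology closure_of range q = M"
    unfolding metric_closure_of using q by fastforce
  then have "separable_space mtopology"
    unfolding separable_space_def using q(1) by (intro exI[of _ "range q"]) auto
  then show ?thesis
    using assms(2) q(1) by unfold_locales auto
qed

lemma polish_metric_real: "polish_metric (UNIV :: real set) dist"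
proof (rule polish_metricI[where q = "from_nat_into \<rat>"])
  show "Metric_space (UNIV :: real set) dist" by (rule Met_TC.Metric_space_axioms)
  show "Metric_space.mcomplete (UNIV :: real set) dist"
    by (simp add: complete_UNIV)
  show "\<exists>n. dist x (from_nat_into \<rat> n) < e" if "e > 0" for x e :: real
  proof -
    obtain r where r: "r \<in> \<rat>" "x < r" "r < x + e"
      using Rats_dense_in_real[of x "x + e"] \<open>e > 0\<close> by auto
    then obtain n where "from_nat_into \<rat> n = r"
      using from_nat_into_surj[OF countable_rat] by metis
    then show ?thesis using r by (intro exI[of _ n]) (simp add: dist_real_def)
  qed
qed simp

lemma measurable_mborel_real:
  fixes f :: "'b \<Rightarrow> real"
  assumes "f \<in> borel_measurable N"
  shows "f \<in> measurable N (polish_metric.mborel UNIV dist)"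
  by (rule polish_metric.measurable_mborelI[OF polish_metric_real]) (use assms in simp_all)

lemma pyrA_nonempty:
  assumes "a \<in> seqA" shows "pyrA a \<noteq> {}"
proof -
  have "(\<lambda>_. 0) \<in> measurable unit_leb (polish_metric.mborel (UNIV :: real set) dist)"
    by (rule measurable_mborel_real) simp
  moreover have "constant_on_masses a (\<lambda>_. 0 :: real)"
    by (simp add: constant_on_masses_def)
  ultimately show ?thesis
    using law_in_pyrA[OF assms polish_metric_real] by blast
qed

text \<open>Composition with the dominating map turns a constant-on-intervals parameter of X into
  one of Y.\<close>

lemma pyrA_downward:
  assumes a: "a \<in> seqA" and "X \<in> pyrA a" "mm_space Y" "lip_dom Y X"
  shows "Y \<in> pyrA a"
proof -
  obtain \<phi> where \<phi>: "parameter \<phi> X" "constant_on_masses a \<phi>"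
    using exists_constant_parameter[OF assms(1,2)] .
  obtain f where f: "f \<in> measurable (snd X) (snd Y)" "distr (snd X) (snd Y) f = snd Y"
    using assms(4) unfolding lip_dom_def by blast
  have "distr unit_leb (snd Y) (f \<circ> \<phi>) = distr (distr unit_leb (snd X) \<phi>) (snd Y) f"
    by (rule distr_distr[OF f(1) parameter_measurable[OF \<phi>(1)], symmetric])
  then have "distr unit_leb (snd Y) (f \<circ> \<phi>) = snd Y"
    using \<phi>(1) f(2) by (simp add: parameter_def)
  then have "parameter (f \<circ> \<phi>) Y"
    unfolding parameter_def using measurable_comp[OF parameter_measurable[OF \<phi>(1)] f(1)] by blast
  moreover have "constant_on_masses a (f \<circ> \<phi>)"
    using \<phi>(2) unfolding constant_on_masses_def comp_def by metis
  ultimately show ?thesis using in_pyrA_if_parameter[OF a assms(3)] by blast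
qed

text \<open>The law of f is read off from f (\<zeta> t) = \<phi> t almost everywhere, the form in
  which parameters corrected on a null set come. Measurability is a consequence of the Lipschitz
  bound: the sets where fst X z (f w) < r are open.\<close>

lemma lip_domI:
  assumes X: "mm_space X" and Z: "mm_space Z"
    and f: "f ` space (snd Z) \<subseteq> space (snd X)"
    and lip: "\<And>p p'. p \<in> space (snd Z) \<Longrightarrow> p' \<in> space (snd Z) \<Longrightarrow> fst X (f p) (f p') \<le> fst Z p p'"
    and \<zeta>: "parameter \<zeta> Z" and \<phi>: "parameter \<phi> X" and ae: "AE t in unit_leb. f (\<zeta> t) = \<phi> t"
  shows "lip_dom X Z"
proof -
  interpret X: polish_metric "space (snd X)" "fst X" using X by (rule mm_space_polish)
  interpret Z: polish_metric "space (snd Z)" "fst Z" using Z by (rule mm_space_polish)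
  have "f \<in> measurable (snd Z) X.mborel"
  proof (rule X.measurable_mborelI)
    show "f \<in> space (snd Z) \<rightarrow> space (snd X)" using f by auto
    fix z assume z: "z \<in> space (snd X)"
    show "(\<lambda>w. fst X z (f w)) \<in> borel_measurable (snd Z)"
    proof (rule borel_measurableI_less)
      fix r
      let ?U = "{w \<in> space (snd Z). fst X z (f w) < r}"
      have "openin Z.mtopology ?U"
        unfolding Z.openin_mtopology
      proof (intro conjI allI impI)
        fix p assume p: "p \<in> ?U"
        have "Z.mball p (r - fst X z (f p)) \<subseteq> ?U"
        proof
          fix w assume w: "w \<in> Z.mball p (r - fst X z (f p))"
          then have "fst X z (f w) \<le> fst X z (f p) + fst X (f p) (f w)"
            using f z by (intro X.triangle) auto
          then show "w \<in> ?U" using lip[of p w] w by auto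
        qed
        then show "\<exists>\<epsilon>>0. Z.mball p \<epsilon> \<subseteq> ?U" using p by (intro exI[of _ "r - fst X z (f p)"]) auto
      qed blast
      then show "?U \<in> sets (snd Z)"
        using Z.openin_sets_mborel mm_space_polish(2)[OF Z] by blast
    qed
  qed
  then have fm: "f \<in> measurable (snd Z) (snd X)"
    using measurable_cong_sets[OF refl mm_space_polish(2)[OF X]] by blast
  have "distr (snd Z) (snd X) f = distr (distr unit_leb (snd Z) \<zeta>) (snd X) f"
    using \<zeta> by (simp add: parameter_def)
  also have "\<dots> = distr unit_leb (snd X) (f \<circ> \<zeta>)"
    by (rule distr_distr[OF fm parameter_measurable[OF \<zeta>]])
  also have "\<dots> = distr unit_leb (snd X) \<phi>"
    by (rule distr_cong_AE)
      (use ae measurable_comp[OF parameter_measurable[OF \<zeta>] fm] parameter_measurable[OF \<phi>] in auto)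
  also have "\<dots> = snd X" using \<phi> by (simp add: parameter_def)
  finally show ?thesis
    unfolding lip_dom_def using f lip fm by blast
qed

text \<open>This is the sum metric on M1 \<times> M2, carried by h into another type, with k as
  decoding. Cauchy sequences, limits and dense points are treated coordinatewise, and both
  projections are 1-Lipschitz.\<close>

lemma polish_metric_prod:
  fixes h :: "'a \<times> 'b \<Rightarrow> 'c"
  assumes P1: "polish_metric M1 d1" and P2: "polish_metric M2 d2"
    and k: "\<And>x y. k (h (x, y)) = (x, y)"
  defines "D \<equiv> \<lambda>p p'. d1 (fst (k p)) (fst (k p')) + d2 (snd (k p)) (snd (k p'))"
  shows "polish_metric (h ` (M1 \<times> M2)) D"
proof -
  interpret A: polish_metric M1 d1 by fact
  interpret B: polish_metric M2 d2 by fact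
  let ?M = "h ` (M1 \<times> M2)"
  have Dh: "D (h (x, y)) (h (x', y')) = d1 x x' + d2 y y'" for x y x' y'
    by (simp add: D_def k)
  have kM: "fst (k p) \<in> M1" "snd (k p) \<in> M2" "h (fst (k p), snd (k p)) = p" if "p \<in> ?M" for p
    using that by (auto simp: k)
  interpret Metric_space ?M D
  proof
    show "0 \<le> D x y" for x y by (simp add: D_def)
    show "D x y = D y x" for x y by (simp add: D_def A.commute B.commute)
    show "D p p' = 0 \<longleftrightarrow> p = p'" if "p \<in> ?M" "p' \<in> ?M" for p p'
    proof
      assume "D p p' = 0"
      then have "d1 (fst (k p)) (fst (k p')) = 0" "d2 (snd (k p)) (snd (k p')) = 0"
        using A.nonneg B.nonneg by (auto simp: D_def add_nonneg_eq_0_iff)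
      then have "fst (k p) = fst (k p')" "snd (k p) = snd (k p')"
        using kM[OF that(1)] kM[OF that(2)] by auto
      then show "p = p'" using kM(3)[OF that(1)] kM(3)[OF that(2)] by simp
    next
      assume "p = p'"
      then show "D p p' = 0" using kM[OF that(1)] by (simp add: D_def)
    qed
    show "D p p'' \<le> D p p' + D p' p''" if "p \<in> ?M" "p' \<in> ?M" "p'' \<in> ?M" for p p' p''
      using A.triangle[OF kM(1)[OF that(1)] kM(1)[OF that(2)] kM(1)[OF that(3)]]
        B.triangle[OF kM(2)[OF that(1)] kM(2)[OF that(2)] kM(2)[OF that(3)]]
      by (simp add: D_def)
  qed
  obtain q :: "nat \<Rightarrow> 'a" where q: "\<And>n. q n \<in> M1" "\<And>x e. \<lbrakk>x \<in> M1; e > 0\<rbrakk> \<Longrightarrow> \<exists>n. d1 x (q n) < e"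
    using A.dense_sequence by metis
  obtain r :: "nat \<Rightarrow> 'b" where r: "\<And>n. r n \<in> M2" "\<And>x e. \<lbrakk>x \<in> M2; e > 0\<rbrakk> \<Longrightarrow> \<exists>n. d2 x (r n) < e"
    using B.dense_sequence by metis
  show ?thesis
  proof (rule polish_metricI[where q = "\<lambda>n. h (q (fst (prod_decode n)), r (snd (prod_decode n)))"])
    show "Metric_space ?M D" by (rule Metric_space_axioms)
    show "h (q (fst (prod_decode n)), r (snd (prod_decode n))) \<in> ?M" for n
      using q r by blast
    show "\<exists>n. D p (h (q (fst (prod_decode n)), r (snd (prod_decode n)))) < e" if p: "p \<in> ?M" and e: "e > 0" for p e
    proof -
      obtain i where i: "d1 (fst (k p)) (q i) < e / 2" using q(2) kM(1)[OF p] e by (meson half_gt_zero)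
      obtain j where j: "d2 (snd (k p)) (r j) < e / 2" using r(2) kM(2)[OF p] e by (meson half_gt_zero)
      show ?thesis
        by (rule exI[of _ "prod_encode (i, j)"]) (use i j in \<open>simp add: D_def k\<close>)
    qed
    show "mcomplete"
      unfolding mcomplete_def
    proof (intro allI impI)
      fix \<sigma> assume \<sigma>: "MCauchy \<sigma>"
      then have \<sigma>M: "\<sigma> n \<in> ?M" for n unfolding MCauchy_def by blast
      have *: "\<exists>N. \<forall>n m. N \<le> n \<longrightarrow> N \<le> m \<longrightarrow> D (\<sigma> n) (\<sigma> m) < e" if "e > 0" for e
        using \<sigma> that unfolding MCauchy_def by blast
      have le: "d1 (fst (k p)) (fst (k p')) \<le> D p p'" "d2 (snd (k p)) (snd (k p')) \<le> D p p'" for p p'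
        by (simp_all add: D_def)
      have "A.MCauchy (\<lambda>n. fst (k (\<sigma> n)))"
        unfolding A.MCauchy_def using kM(1)[OF \<sigma>M] * le(1) by (meson image_subsetI le_less_trans)
      then obtain x where x: "limitin A.mtopology (\<lambda>n. fst (k (\<sigma> n))) x sequentially"
        using A.complete unfolding A.mcomplete_def by blast
      have "B.MCauchy (\<lambda>n. snd (k (\<sigma> n)))"
        unfolding B.MCauchy_def using kM(2)[OF \<sigma>M] * le(2) by (meson image_subsetI le_less_trans)
      then obtain y where y: "limitin B.mtopology (\<lambda>n. snd (k (\<sigma> n))) y sequentially"
        using B.complete unfolding B.mcomplete_def by blast
      have "(\<lambda>n. d1 (fst (k (\<sigma> n))) x + d2 (snd (k (\<sigma> n))) y) \<longlonglongrightarrow> 0 + 0"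
        using x y unfolding A.limitin_metric_dist_null B.limitin_metric_dist_null by (intro tendsto_add) blast+
      then have "(\<lambda>n. D (\<sigma> n) (h (x, y))) \<longlonglongrightarrow> 0" by (simp add: D_def k)
      moreover have "h (x, y) \<in> ?M"
        using x y A.limitin_mspace B.limitin_mspace by blast
      ultimately show "\<exists>x. limitin mtopology \<sigma> x sequentially"
        unfolding limitin_metric_dist_null using \<sigma>M by (intro exI[of _ "h (x, y)"]) auto
    qed
  qed
qed

text \<open>The pair of two parameters that are constant on the intervals is again constant on them.
  Its law, with the sum metric, dominates X and Y through the projections.\<close>

lemma pyrA_directed:
  assumes a: "a \<in> seqA" and X: "X \<in> pyrA a" and Y: "Y \<in> pyrA a"
  shows "\<exists>Z\<in>pyrA a. lip_dom X Z \<and> lip_dom Y Z"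
proof -
  have mmX: "mm_space X" and mmY: "mm_space Y" using X Y pyrA_mm_space by auto
  obtain \<phi> where \<phi>: "parameter \<phi> X" "constant_on_masses a \<phi>"
    using exists_constant_parameter[OF a X] .
  obtain \<psi> where \<psi>: "parameter \<psi> Y" "constant_on_masses a \<psi>"
    using exists_constant_parameter[OF a Y] .
  let ?M1 = "space (snd X)" and ?M2 = "space (snd Y)"
  interpret A: polish_metric ?M1 "fst X" using mmX by (rule mm_space_polish)
  interpret B: polish_metric ?M2 "fst Y" using mmY by (rule mm_space_polish)
  \<comment> \<open>Carriers of mm-spaces are sets of reals, so pairs of reals are recoded as
    reals.\<close>
  obtain h :: "real \<times> real \<Rightarrow> real" where "bij_betw h (UNIV \<times> UNIV) UNIV"
    using card_of_ordIso[THEN iffD2, OF card_of_Times_same_infinite[OF infinite_UNIV_char_0]] by blast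
  then have inj: "inj h" using bij_betw_imp_inj_on by fastforce
  define k where "k = inv h"
  have k: "k (h p) = p" for p using inj by (simp add: k_def)
  define D where "D = (\<lambda>p p'. fst X (fst (k p)) (fst (k p')) + fst Y (snd (k p)) (snd (k p')))"
  have P: "polish_metric (h ` (?M1 \<times> ?M2)) D"
    unfolding D_def by (rule polish_metric_prod[OF A.polish_metric_axioms B.polish_metric_axioms]) (rule k)
  define \<theta> where "\<theta> t = h (\<phi> t, \<psi> t)" for t
  have "\<theta> \<in> measurable unit_leb (polish_metric.mborel (h ` (?M1 \<times> ?M2)) D)"
  proof (rule polish_metric.measurable_mborelI[OF P])
    show "\<theta> \<in> space unit_leb \<rightarrow> h ` (?M1 \<times> ?M2)"
      using parameter_space[OF \<phi>(1)] parameter_space[OF \<psi>(1)] by (auto simp: \<theta>_def)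
    fix z assume "z \<in> h ` (?M1 \<times> ?M2)"
    then obtain x y where z: "z = h (x, y)" "x \<in> ?M1" "y \<in> ?M2" by blast
    have "\<phi> \<in> measurable unit_leb A.mborel" "\<psi> \<in> measurable unit_leb B.mborel"
      using parameter_measurable[OF \<phi>(1)] measurable_cong_sets[OF refl mm_space_polish(2)[OF mmX]]
        parameter_measurable[OF \<psi>(1)] measurable_cong_sets[OF refl mm_space_polish(2)[OF mmY]] by blast+
    then have "(\<lambda>t. fst X x (\<phi> t)) \<in> borel_measurable unit_leb" "(\<lambda>t. fst Y y (\<psi> t)) \<in> borel_measurable unit_leb"
      using A.borel_measurable_dist[OF z(2)] B.borel_measurable_dist[OF z(3)] measurable_compose by blast+
    then show "(\<lambda>w. D z (\<theta> w)) \<in> borel_measurable unit_leb"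
      unfolding D_def \<theta>_def z(1) k by simp
  qed
  moreover have "constant_on_masses a \<theta>"
    using \<phi>(2) \<psi>(2) unfolding constant_on_masses_def \<theta>_def by metis
  ultimately obtain Z g where Z: "Z \<in> pyrA a" "fst Z = D" "space (snd Z) \<subseteq> h ` (?M1 \<times> ?M2)"
    "parameter (g \<circ> \<theta>) Z" "AE t in unit_leb. g (\<theta> t) = \<theta> t"
    using law_in_pyrA[OF a P] by blast
  have mmZ: "mm_space Z" using Z(1) pyrA_mm_space by auto
  have "lip_dom X Z"
  proof (rule lip_domI[OF mmX mmZ _ _ Z(4) \<phi>(1)])
    show "(fst \<circ> k) ` space (snd Z) \<subseteq> ?M1" using Z(3) by (auto simp: k)
    show "fst X ((fst \<circ> k) p) ((fst \<circ> k) p') \<le> fst Z p p'" for p p'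
      unfolding Z(2) D_def by simp
    show "AE t in unit_leb. (fst \<circ> k) ((g \<circ> \<theta>) t) = \<phi> t"
      using Z(5) by eventually_elim (simp add: \<theta>_def k)
  qed
  moreover have "lip_dom Y Z"
  proof (rule lip_domI[OF mmY mmZ _ _ Z(4) \<psi>(1)])
    show "(snd \<circ> k) ` space (snd Z) \<subseteq> ?M2" using Z(3) by (auto simp: k)
    show "fst Y ((snd \<circ> k) p) ((snd \<circ> k) p') \<le> fst Z p p'" for p p'
      unfolding Z(2) D_def by simp
    show "AE t in unit_leb. (snd \<circ> k) ((g \<circ> \<theta>) t) = \<psi> t"
      using Z(5) by eventually_elim (simp add: \<theta>_def k)
  qed
  ultimately show ?thesis using Z(1) by blast
qed

section \<open>Approximation from inside\<close>

text \<open>Finitely many level sets of L nearly exhaust [0,1). Shrunk to closed subsets they have a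
  compact union, on which L is uniformly continuous; natural numbers at distance below 1 are
  equal.\<close>

lemma nat_valued_lusin:
  fixes L :: "real \<Rightarrow> nat"
  assumes L: "L \<in> measurable unit_leb (count_space UNIV)" and e: "0 < e"
  obtains K \<delta> where "K \<in> sets unit_leb" "measure unit_leb K \<ge> 1 - e" "0 < \<delta>"
    "\<And>s t. s \<in> K \<Longrightarrow> t \<in> K \<Longrightarrow> \<bar>s - t\<bar> < \<delta> \<Longrightarrow> L s = L t"
proof -
  define E where "E j = {t \<in> {0..<1}. L t = j}" for j
  have E: "E j \<in> sets unit_leb" for j
    using measurable_sets[OF L, of "{j}"] by (simp add: E_def vimage_def Int_def conj_commute)
  define F where "F m = (\<Union>j<m. E j)" for m
  have F: "F m \<in> sets unit_leb" for m unfolding F_def using E by auto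
  have "(\<lambda>m. measure unit_leb (F m)) \<longlonglongrightarrow> measure unit_leb (\<Union>m. F m)"
  proof (rule unit_leb.finite_Lim_measure_incseq)
    show "incseq F"
      unfolding incseq_def F_def by (intro allI impI UN_mono) auto
  qed (use F in auto)
  also have "(\<Union>m. F m) = space unit_leb" by (auto simp: F_def E_def)
  finally have "(\<lambda>m. measure unit_leb (F m)) \<longlonglongrightarrow> 1" by (simp only: unit_leb.prob_space)
  then have "\<forall>\<^sub>F m in sequentially. measure unit_leb (F m) > 1 - e / 2"
    by (rule order_tendstoD) (use e in simp)
  then obtain m where m: "measure unit_leb (F m) > 1 - e / 2"
    using eventually_happens by fastforce
  \<comment> \<open>With this loss, m level sets cost at most e/2 together; \<open>Suc m\<close>
    keeps the denominator positive for m = 0.\<close>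
  have "\<exists>T. closed T \<and> T \<subseteq> E j \<and> measure unit_leb (E j - T) \<le> e / (2 * Suc m)" for j
  proof -
    have "E j \<in> sets lebesgue" using E[of j] by (auto simp: sets_unit_leb)
    moreover have pos: "e / (2 * Suc m) > 0" using e by simp
    ultimately obtain T where T: "closed T" "T \<subseteq> E j" "emeasure lebesgue (E j - T) < ennreal (e / (2 * Suc m))"
      using sets_lebesgue_inner_closed by metis
    have sub: "E j - T \<subseteq> {0..<1}" by (auto simp: E_def)
    have "E j - T \<in> sets borel" using E[of j] T(1) by (auto simp: sets_unit_leb)
    then have "emeasure lebesgue (E j - T) = emeasure lborel (E j - T)"
      by simp
    also have "\<dots> = emeasure unit_leb (E j - T)" by (rule emeasure_unit_leb[OF sub, symmetric])
    finally have "ennreal (measure unit_leb (E j - T)) < ennreal (e / (2 * Suc m))"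
      using T(3) by (simp add: unit_leb.emeasure_eq_measure)
    then have "measure unit_leb (E j - T) \<le> e / (2 * Suc m)"
      using pos ennreal_less_iff[OF measure_nonneg] by (meson less_imp_le)
    then show ?thesis using T by blast
  qed
  then obtain T where T: "\<And>j. closed (T j)" "\<And>j. T j \<subseteq> E j" "\<And>j. measure unit_leb (E j - T j) \<le> e / (2 * Suc m)"
    by metis
  define K where "K = (\<Union>j<m. T j)"
  have Ts: "T j \<in> sets unit_leb" for j
    using T(1,2) E[of j] by (auto simp: sets_unit_leb)
  have Ks: "K \<in> sets unit_leb" unfolding K_def using Ts by auto
  have "compact K"
    unfolding K_def
  proof (rule compact_UN)
    fix j assume "j \<in> {..<m}"
    have "bounded (T j)"
      by (rule bounded_subset[of "{0..1}"]) (use T(2)[of j] in \<open>auto simp: E_def\<close>)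
    then show "compact (T j)" using T(1) by (simp add: compact_eq_bounded_closed)
  qed simp
  moreover have "continuous_on K (\<lambda>t. real (L t))"
    unfolding K_def
  proof (rule continuous_on_closed_Union)
    fix j assume "j \<in> {..<m}"
    show "continuous_on (T j) (\<lambda>t. real (L t))"
      by (subst continuous_on_cong[OF refl, of _ _ "\<lambda>_. real j"]) (use T(2)[of j] in \<open>auto simp: E_def\<close>)
  qed (use T(1) in auto)
  ultimately have "uniformly_continuous_on K (\<lambda>t. real (L t))"
    by (intro compact_uniformly_continuous)
  then obtain \<delta> where \<delta>: "\<delta> > 0" "\<forall>s\<in>K. \<forall>t\<in>K. dist t s < \<delta> \<longrightarrow> dist (real (L t)) (real (L s)) < 1"
    unfolding uniformly_continuous_on_def using zero_less_one by blast
  show thesis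
  proof (rule that)
    show "K \<in> sets unit_leb" by (rule Ks)
    show "\<delta> > 0" by (rule \<delta>(1))
    show "L s = L t" if "s \<in> K" "t \<in> K" "\<bar>s - t\<bar> < \<delta>" for s t
    proof -
      have "dist (real (L s)) (real (L t)) < 1" using \<delta>(2) that by (auto simp: dist_real_def)
      then show ?thesis by (simp add: dist_real_def)
    qed
    have "F m \<subseteq> K \<union> (\<Union>j<m. E j - T j)" by (auto simp: F_def K_def)
    then have "measure unit_leb (F m) \<le> measure unit_leb (K \<union> (\<Union>j<m. E j - T j))"
      using Ks E Ts by (intro unit_leb.finite_measure_mono) auto
    also have "\<dots> \<le> measure unit_leb K + measure unit_leb (\<Union>j<m. E j - T j)"
      using Ks E Ts by (intro measure_Un_le) auto
    also have "measure unit_leb (\<Union>j<m. E j - T j) \<le> (\<Sum>j<m. measure unit_leb (E j - T j))"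
      using E Ts by (intro measure_UNION_le) auto
    also have "\<dots> \<le> (\<Sum>j<m. e / (2 * Suc m))" by (intro sum_mono T(3))
    also have "\<dots> \<le> e / 2" using e by (simp add: field_simps)
    finally show "measure unit_leb K \<ge> 1 - e" using m by simp
  qed
qed

lemma measurable_mass_intervals:
  assumes b: "b \<in> seqA" and h: "h \<in> measurable unit_leb N" and v: "\<And>i. v i \<in> space N"
    and f1: "\<And>i t. t \<in> mass_interval b i \<Longrightarrow> f t = v i"
    and f2: "\<And>t. t \<in> {suminf b..<1} \<Longrightarrow> f t = h t"
  shows "f \<in> measurable unit_leb N"
proof (rule measurableI)
  fix t assume t: "t \<in> space unit_leb"
  show "f t \<in> space N"
  proof (cases "t < suminf b")
    case True
    then obtain i where "t \<in> mass_interval b i" using mass_interval_cover[OF b, of t] t by auto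
    then show ?thesis using f1 v by simp
  next
    case False
    then show ?thesis using f2[of t] t measurable_space[OF h t] by simp
  qed
next
  fix B assume B: "B \<in> sets N"
  have "f -` B \<inter> space unit_leb =
      (\<Union>i\<in>{i. v i \<in> B}. mass_interval b i) \<union> (h -` B \<inter> space unit_leb \<inter> {suminf b..<1})"
  proof (intro equalityI subsetI)
    fix t assume t: "t \<in> f -` B \<inter> space unit_leb"
    show "t \<in> (\<Union>i\<in>{i. v i \<in> B}. mass_interval b i) \<union> (h -` B \<inter> space unit_leb \<inter> {suminf b..<1})"
    proof (cases "t < suminf b")
      case True
      then obtain i where "t \<in> mass_interval b i" using mass_interval_cover[OF b, of t] t by auto
      then show ?thesis using f1 t by auto
    next
      case False
      then show ?thesis using f2[of t] t by simp
    qed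
  next
    fix t assume "t \<in> (\<Union>i\<in>{i. v i \<in> B}. mass_interval b i) \<union> (h -` B \<inter> space unit_leb \<inter> {suminf b..<1})"
    then show "t \<in> f -` B \<inter> space unit_leb"
    proof
      assume "t \<in> (\<Union>i\<in>{i. v i \<in> B}. mass_interval b i)"
      then obtain i where "v i \<in> B" "t \<in> mass_interval b i" by blast
      then show ?thesis using f1 mass_interval_subset(2)[OF b, of i] by auto
    next
      assume "t \<in> h -` B \<inter> space unit_leb \<inter> {suminf b..<1}"
      then show ?thesis using f2[of t] by simp
    qed
  qed
  also have "\<dots> \<in> sets unit_leb"
  proof (intro sets.Un sets.countable_UN' sets.Int_space_eq2)
    show "h -` B \<inter> space unit_leb \<inter> {suminf b..<1} \<in> sets unit_leb"
      using measurable_sets[OF h B] by (auto simp: sets_unit_leb)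
  qed (use mass_interval_sets[OF b] in auto)
  finally show "f -` B \<inter> space unit_leb \<in> sets unit_leb" .
qed

text \<open>N is chosen before b. In every b the intervals of index at least N are no longer than
  1/(N+1) < \<delta>, so one Lusin set K controls them all, and only the first N intervals must
  match those of a. One e pays for the complement of K, one for the mismatch.\<close>

lemma pyrA_approximation:
  assumes a: "a \<in> seqA" and X: "X \<in> pyrA a" and e: "0 < e"
  obtains N where "\<And>b. \<lbrakk>b \<in> seqA; measure unit_leb (\<Union>i<N. mass_interval b i - mass_interval a i) \<le> e\<rbrakk>
    \<Longrightarrow> \<exists>Y\<in>pyrA b. box_dist X Y \<le> 2 * e"
proof -
  have mmX: "mm_space X" using X pyrA_mm_space by auto
  let ?d = "fst X" and ?M = "space (snd X)"
  interpret polish_metric ?M ?d using mmX by (rule mm_space_polish)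
  obtain \<phi> where \<phi>: "parameter \<phi> X" "constant_on_masses a \<phi>"
    using exists_constant_parameter[OF a X] .
  have \<phi>m: "\<phi> \<in> measurable unit_leb mborel"
    using parameter_measurable[OF \<phi>(1)] measurable_cong_sets[OF refl mm_space_polish(2)[OF mmX]] by blast
  have \<phi>M: "\<phi> t \<in> ?M" if "t \<in> {0..<1}" for t using parameter_space[OF \<phi>(1) that] .
  obtain q :: "nat \<Rightarrow> real" where q: "\<And>n. q n \<in> ?M" "\<And>x e. \<lbrakk>x \<in> ?M; e > 0\<rbrakk> \<Longrightarrow> \<exists>n. ?d x (q n) < e"
    using dense_sequence by metis
  \<comment> \<open>Discretizes \<phi> up to an error e. With values in the natural numbers,
    closeness of two times in K gives equality of L, so a single value can serve a whole short
    interval.\<close>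
  define L where "L t = (LEAST j. ?d (q j) (\<phi> t) < e)" for t
  have L: "?d (\<phi> t) (q (L t)) < e" if "t \<in> {0..<1}" for t
  proof -
    have "\<exists>j. ?d (q j) (\<phi> t) < e" using q(2)[OF \<phi>M[OF that] e] by (simp add: commute)
    then have "?d (q (L t)) (\<phi> t) < e" unfolding L_def by (rule LeastI_ex)
    then show ?thesis by (simp add: commute)
  qed
  have [measurable]: "(\<lambda>t. ?d (q j) (\<phi> t)) \<in> borel_measurable unit_leb" for j
    using measurable_compose[OF \<phi>m borel_measurable_dist[OF q(1)]] .
  have Lm: "L \<in> measurable unit_leb (count_space UNIV)"
    unfolding L_def by measurable
  obtain K \<delta> where K: "K \<in> sets unit_leb" "measure unit_leb K \<ge> 1 - e" and \<delta>: "0 < \<delta>"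
    "\<And>s t. s \<in> K \<Longrightarrow> t \<in> K \<Longrightarrow> \<bar>s - t\<bar> < \<delta> \<Longrightarrow> L s = L t"
    using nat_valued_lusin[OF Lm e] by metis
  have K01: "K \<subseteq> {0..<1}" using K(1) by (simp add: sets_unit_leb)
  obtain N :: nat where N: "1 / Suc N < \<delta>" using nat_approx_posE[OF \<delta>(1)] by blast
  show thesis
  proof (rule that)
    fix b assume b: "b \<in> seqA" and small: "measure unit_leb (\<Union>i<N. mass_interval b i - mass_interval a i) \<le> e"
    \<comment> \<open>Below N: the value of \<phi> on the corresponding interval of a, or any point
      if that interval is empty. From N on: the dense point that L selects at one time of the
      interval in K. If the interval misses K, the choice is irrelevant, as \<open>I0\<close>
      contains none of its points.\<close>
    define v where "v i = (if i < N then (if mass_interval a i = {} then q 0 else \<phi> (SOME t. t \<in> mass_interval a i))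
      else q (L (SOME u. u \<in> mass_interval b i \<inter> K)))" for i
    have vM: "v i \<in> ?M" for i
    proof (cases "i < N \<and> mass_interval a i \<noteq> {}")
      case True
      then have "(SOME t. t \<in> mass_interval a i) \<in> mass_interval a i" by (simp add: some_in_eq)
      then show ?thesis using True \<phi>M mass_interval_subset(2)[OF a, of i] by (auto simp: v_def)
    qed (use q(1) in \<open>auto simp: v_def\<close>)
    have v\<phi>: "v i = \<phi> t" if "i < N" "t \<in> mass_interval a i" for i t
    proof -
      have ne: "mass_interval a i \<noteq> {}" using that by blast
      then have "(SOME t. t \<in> mass_interval a i) \<in> mass_interval a i" by (simp add: some_in_eq)
      then have "\<phi> (SOME t. t \<in> mass_interval a i) = \<phi> t"
        using \<phi>(2) that(2) unfolding constant_on_masses_def by blast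
      then show ?thesis using that(1) ne by (simp add: v_def)
    qed
    define \<theta> where "\<theta> t = (if \<exists>i. t \<in> mass_interval b i then v (THE i. t \<in> mass_interval b i) else q (L t))" for t
    have \<theta>1: "\<theta> t = v i" if "t \<in> mass_interval b i" for i t
    proof -
      have "(THE i. t \<in> mass_interval b i) = i"
        using that mass_interval_disjoint[OF b] by blast
      then show ?thesis using that by (auto simp: \<theta>_def)
    qed
    have \<theta>2: "\<theta> t = q (L t)" if "\<nexists>i. t \<in> mass_interval b i" for t
      using that by (simp add: \<theta>_def)
    have "\<theta> \<in> measurable unit_leb mborel"
    proof (rule measurable_mass_intervals[OF b])
      show "(\<lambda>t. q (L t)) \<in> measurable unit_leb mborel"
        using measurable_compose[OF Lm, of q mborel] q(1) by simp
      show "v i \<in> space mborel" for i using vM by simp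
      show "\<theta> t = v i" if "t \<in> mass_interval b i" for i t using \<theta>1[OF that] .
      show "\<theta> t = q (L t)" if "t \<in> {suminf b..<1}" for t
        using mass_interval_subset(1)[OF b] that by (intro \<theta>2) fastforce
    qed
    moreover have "constant_on_masses b \<theta>"
      unfolding constant_on_masses_def using \<theta>1 by simp
    ultimately obtain Y g where Y: "Y \<in> pyrA b" "fst Y = ?d" "parameter (g \<circ> \<theta>) Y"
      "AE t in unit_leb. g (\<theta> t) = \<theta> t"
      using law_in_pyrA[OF b polish_metric_axioms] by metis
    obtain Z where Z: "{t \<in> space unit_leb. \<not> g (\<theta> t) = \<theta> t} \<subseteq> Z" "emeasure unit_leb Z = 0" "Z \<in> sets unit_leb"
      using AE_E[OF Y(4)] by metis
    let ?R = "\<Union>i<N. mass_interval b i - mass_interval a i"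
    define I0 where "I0 = K - ?R - Z"
    have Rs: "?R \<in> sets unit_leb"
      using mass_interval_sets[OF a] mass_interval_sets[OF b] by auto
    have I0s: "I0 \<in> sets unit_leb" unfolding I0_def using K(1) Rs Z(3) by auto
    have close: "?d (\<phi> t) (\<theta> t) < e" if t: "t \<in> I0" for t
    proof -
      have t01: "t \<in> {0..<1}" using t K01 by (auto simp: I0_def)
      consider i where "i < N" "t \<in> mass_interval b i" | i where "\<not> i < N" "t \<in> mass_interval b i"
        | "\<nexists>i. t \<in> mass_interval b i" by blast
      then show ?thesis
      proof cases
        case 1
        then have "t \<in> mass_interval a i" using t by (auto simp: I0_def)
        then have "\<theta> t = \<phi> t" using \<theta>1[OF 1(2)] v\<phi>[OF 1(1)] by simp
        then show ?thesis using e \<phi>M[OF t01] by simp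
      next
        case 2
        define u where "u = (SOME u. u \<in> mass_interval b i \<inter> K)"
        have tK: "t \<in> mass_interval b i \<inter> K" using t 2 by (auto simp: I0_def)
        then have u: "u \<in> mass_interval b i \<inter> K" unfolding u_def by (rule someI)
        have "\<bar>t - u\<bar> < b i" using tK u by (auto simp: mass_interval_def)
        also have "b i \<le> 1 / Suc i" by (rule seqA_le_inverse[OF b])
        also have "\<dots> \<le> 1 / Suc N" using 2(1) by (intro frac_le) auto
        also have "\<dots> < \<delta>" by (rule N)
        finally have "L u = L t" using \<delta>(2)[of t u] tK u by simp
        then have "\<theta> t = q (L t)" using \<theta>1[OF 2(2)] 2(1) by (simp add: v_def u_def)
        then show ?thesis using L[OF t01] by simp
      next
        case 3
        then show ?thesis using \<theta>2 L[OF t01] by simp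
      qed
    qed
    have \<theta>g: "g (\<theta> t) = \<theta> t" if "t \<in> I0" for t
    proof (rule ccontr)
      assume "g (\<theta> t) \<noteq> \<theta> t"
      moreover have "t \<in> space unit_leb" using that K01 by (auto simp: I0_def)
      ultimately have "t \<in> Z" using Z(1) by blast
      then show False using that by (simp add: I0_def)
    qed
    have \<theta>M: "\<theta> t \<in> ?M" for t
      using \<theta>1 \<theta>2 vM q(1) by metis
    have "box_dist X Y \<le> 2 * e"
    proof (rule box_dist_le[OF _ \<phi>(1) Y(3) I0s])
      show "0 \<le> 2 * e" using e by simp
      have "measure unit_leb K \<le> measure unit_leb (I0 \<union> (?R \<union> Z))"
        using I0s Rs Z(3) by (intro unit_leb.finite_measure_mono) (auto simp: I0_def)
      also have "\<dots> \<le> measure unit_leb I0 + measure unit_leb (?R \<union> Z)"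
        using I0s Rs Z(3) by (intro measure_Un_le) auto
      also have "measure unit_leb (?R \<union> Z) \<le> measure unit_leb ?R + measure unit_leb Z"
        using Rs Z(3) by (intro measure_Un_le) auto
      finally show "1 - 2 * e \<le> measure unit_leb I0"
        using K(2) small Z(2) by (simp add: measure_def)
      fix s t assume st: "s \<in> I0" "t \<in> I0"
      have in01: "s \<in> {0..<1}" "t \<in> {0..<1}" using st K01 by (auto simp: I0_def)
      note M = \<phi>M[OF in01(1)] \<phi>M[OF in01(2)] \<theta>M[of s] \<theta>M[of t]
      \<comment> \<open>\<phi> and \<theta> differ by less than e at each of the two times, which
        adds up to 2e.\<close>
      have "?d (\<phi> s) (\<phi> t) \<le> ?d (\<phi> s) (\<theta> s) + ?d (\<theta> s) (\<phi> t)" using M by (intro triangle)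
      moreover have "?d (\<theta> s) (\<phi> t) \<le> ?d (\<theta> s) (\<theta> t) + ?d (\<theta> t) (\<phi> t)" using M by (intro triangle)
      moreover have "?d (\<theta> s) (\<theta> t) \<le> ?d (\<theta> s) (\<phi> s) + ?d (\<phi> s) (\<theta> t)" using M by (intro triangle)
      moreover have "?d (\<phi> s) (\<theta> t) \<le> ?d (\<phi> s) (\<phi> t) + ?d (\<phi> t) (\<theta> t)" using M by (intro triangle)
      ultimately show "\<bar>?d (\<phi> s) (\<phi> t) - fst Y ((g \<circ> \<theta>) s) ((g \<circ> \<theta>) t)\<bar> \<le> 2 * e"
        using close[OF st(1)] close[OF st(2)] \<theta>g[OF st(1)] \<theta>g[OF st(2)] Y(2)
          commute[of "\<theta> s" "\<phi> s"] commute[of "\<theta> t" "\<phi> t"] by (simp add: abs_le_iff)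
    qed
    with Y(1) show "\<exists>Y\<in>pyrA b. box_dist X Y \<le> 2 * e" by blast
  qed
qed

text \<open>The part of [p,q) outside [p',q') lies in the union of [p,p') and [q',q), so its length
  is bounded by the displacements of the endpoints.\<close>

lemma measure_mass_interval_diff:
  assumes a: "a \<in> seqA" and b: "b \<in> seqA"
  shows "measure unit_leb (mass_interval b i - mass_interval a i)
    \<le> \<bar>sum b {..<i} - sum a {..<i}\<bar> + \<bar>sum b {..<Suc i} - sum a {..<Suc i}\<bar>"
proof -
  let ?p = "sum b {..<i}" and ?q = "sum b {..<Suc i}" and ?p' = "sum a {..<i}" and ?q' = "sum a {..<Suc i}"
  have bounds: "0 \<le> ?p" "?q \<le> 1" "0 \<le> ?q'" "?p' \<le> 1"
    using seqA_sum_nonneg[OF b] seqA_sum_le_1[OF b] seqA_sum_nonneg[OF a] seqA_sum_le_1[OF a] by blast+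
  have s: "{?p..<?p'} \<in> sets unit_leb" "{?q'..<?q} \<in> sets unit_leb"
    using bounds by (auto simp: sets_unit_leb)
  have "measure unit_leb (mass_interval b i - mass_interval a i) \<le> measure unit_leb ({?p..<?p'} \<union> {?q'..<?q})"
    using s by (intro unit_leb.finite_measure_mono) (auto simp: mass_interval_def)
  also have "\<dots> \<le> measure unit_leb {?p..<?p'} + measure unit_leb {?q'..<?q}"
    using s by (rule measure_Un_le)
  also have "\<dots> = measure lborel {?p..<?p'} + measure lborel {?q'..<?q}"
    using s by (simp add: measure_unit_leb sets_unit_leb)
  also have "\<dots> \<le> \<bar>?p - ?p'\<bar> + \<bar>?q - ?q'\<bar>"
    by (intro add_mono) (simp_all add: measure_lborel_Ico abs_if not_le)
  finally show ?thesis .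
qed

lemma box_dist_set_pyrA_tendsto_0:
  assumes a: "a \<in> seqA" and A: "\<And>n. A n \<in> seqA" and lim: "\<And>i. (\<lambda>n. A n i) \<longlonglongrightarrow> a i"
    and X: "X \<in> pyrA a"
  shows "(\<lambda>n. box_dist_set X (pyrA (A n))) \<longlonglongrightarrow> 0"
proof (rule LIMSEQ_I)
  fix r :: real assume r: "0 < r"
  \<comment> \<open>The approximation yields 2e, which has to stay strictly below r.\<close>
  define e where "e = r / 4"
  have e: "0 < e" using r by (simp add: e_def)
  have mmX: "mm_space X" using X pyrA_mm_space by auto
  obtain N where N: "\<And>b. \<lbrakk>b \<in> seqA; measure unit_leb (\<Union>i<N. mass_interval b i - mass_interval a i) \<le> e\<rbrakk>
    \<Longrightarrow> \<exists>Y\<in>pyrA b. box_dist X Y \<le> 2 * e"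
    using pyrA_approximation[OF a X e] by blast
  let ?D = "\<lambda>n i. \<bar>sum (A n) {..<i} - sum a {..<i}\<bar> + \<bar>sum (A n) {..<Suc i} - sum a {..<Suc i}\<bar>"
  \<comment> \<open>Only finitely many partial sums enter, so pointwise convergence of the masses
    suffices.\<close>
  have "(\<lambda>n. \<Sum>i<N. ?D n i) \<longlonglongrightarrow> (\<Sum>i<N. \<bar>sum a {..<i} - sum a {..<i}\<bar> + \<bar>sum a {..<Suc i} - sum a {..<Suc i}\<bar>)"
    by (intro tendsto_sum tendsto_add tendsto_rabs tendsto_diff tendsto_const lim)
  then have "(\<lambda>n. \<Sum>i<N. ?D n i) \<longlonglongrightarrow> 0" by simp
  then have "\<forall>\<^sub>F n in sequentially. (\<Sum>i<N. ?D n i) < e"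
    by (rule order_tendstoD) (rule e)
  then obtain n0 where n0: "\<And>n. n \<ge> n0 \<Longrightarrow> (\<Sum>i<N. ?D n i) < e"
    unfolding eventually_sequentially by blast
  have "norm (box_dist_set X (pyrA (A n)) - 0) < r" if n: "n \<ge> n0" for n
  proof -
    have "measure unit_leb (\<Union>i<N. mass_interval (A n) i - mass_interval a i)
        \<le> (\<Sum>i<N. measure unit_leb (mass_interval (A n) i - mass_interval a i))"
      using mass_interval_sets[OF a] mass_interval_sets[OF A] by (intro measure_UNION_le) auto
    also have "\<dots> \<le> (\<Sum>i<N. ?D n i)"
      by (intro sum_mono measure_mass_interval_diff a A)
    finally have "measure unit_leb (\<Union>i<N. mass_interval (A n) i - mass_interval a i) \<le> e"
      using n0[OF n] by simp
    then obtain Y where "Y \<in> pyrA (A n)" "box_dist X Y \<le> 2 * e" using N[OF A] by blast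
    then have "box_dist_set X (pyrA (A n)) \<le> 2 * e"
      using box_dist_set_le[OF mmX pyrA_mm_space] by (meson order_trans)
    moreover have "0 \<le> box_dist_set X (pyrA (A n))"
      by (rule box_dist_set_nonneg[OF mmX pyrA_mm_space pyrA_nonempty[OF A]])
    ultimately show ?thesis using r by (simp add: e_def)
  qed
  then show "\<exists>n0. \<forall>n\<ge>n0. norm (box_dist_set X (pyrA (A n)) - 0) < r" by blast
qed

section \<open>Limits of elements of the pyramids\<close>

context polish_metric
begin

text \<open>Late points at mutual distance at least r have disjoint balls of radius r/2, each of
  mass at least c, so there are at most 1/c of them. A maximal family of this kind is an r-net of
  the tail; the finitely many earlier points are added by hand. What counts as late depends on
  r.\<close>

lemma mtotally_bounded_heavy_balls:
  assumes \<mu>: "prob_space \<mu>" "sets \<mu> = sets mborel" and c: "0 < c" and z: "\<And>k::nat. z k \<in> M"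
    and heavy: "\<And>r. 0 < r \<Longrightarrow> \<forall>\<^sub>F k in sequentially. c \<le> measure \<mu> (mball (z k) r)"
  shows "mtotally_bounded (range z)"
  unfolding mtotally_bounded_def
proof (intro allI impI)
  interpret \<mu>: prob_space \<mu> by fact
  fix r :: real assume r: "0 < r"
  obtain n0 where n0: "\<And>k. n0 \<le> k \<Longrightarrow> c \<le> measure \<mu> (mball (z k) (r / 2))"
    using heavy[of "r / 2"] r unfolding eventually_sequentially by auto
  define sep where "sep J \<longleftrightarrow> finite J \<and> J \<subseteq> {n0..} \<and> (\<forall>i\<in>J. \<forall>j\<in>J. i \<noteq> j \<longrightarrow> r \<le> d (z i) (z j))" for J
  have bound: "card J \<le> nat \<lfloor>1 / c\<rfloor>" if J: "sep J" for J
  proof -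
    have "disjoint_family_on (\<lambda>k. mball (z k) (r / 2)) J"
      unfolding disjoint_family_on_def
    proof (intro ballI impI)
      fix i j assume ij: "i \<in> J" "j \<in> J" "i \<noteq> j"
      then have far: "r \<le> d (z i) (z j)" using J by (simp add: sep_def)
      have False if "w \<in> mball (z i) (r / 2)" "w \<in> mball (z j) (r / 2)" for w
        using that triangle[of "z i" w "z j"] far by (simp add: commute)
      then show "mball (z i) (r / 2) \<inter> mball (z j) (r / 2) = {}" by blast
    qed
    then have "measure \<mu> (\<Union>k\<in>J. mball (z k) (r / 2)) = (\<Sum>k\<in>J. measure \<mu> (mball (z k) (r / 2)))"
      using J \<mu>(2) by (intro \<mu>.finite_measure_finite_Union) (auto simp: sep_def)
    moreover have "(\<Sum>k\<in>J. c) \<le> (\<Sum>k\<in>J. measure \<mu> (mball (z k) (r / 2)))"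
      using J by (intro sum_mono n0) (auto simp: sep_def)
    ultimately have "real (card J) * c \<le> 1"
      using \<mu>.prob_le_1[of "\<Union>k\<in>J. mball (z k) (r / 2)"] by simp
    then have "real (card J) \<le> 1 / c" using c by (simp add: field_simps)
    then show ?thesis by linarith
  qed
  have "sep {}" by (simp add: sep_def)
  then obtain J where J: "sep J" "\<And>J'. sep J' \<Longrightarrow> card J' \<le> card J"
    using ex_has_greatest_nat[of sep "{}" card "Suc (nat \<lfloor>1 / c\<rfloor>)"] bound less_Suc_eq_le by blast
  have fin: "finite J" using J by (simp add: sep_def)
  have near: "\<exists>j\<in>J. d (z j) (z k) < r" if k: "n0 \<le> k" for k
  proof (rule ccontr)
    assume "\<not> ?thesis"
    then have far: "\<And>j. j \<in> J \<Longrightarrow> r \<le> d (z j) (z k)" by force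
    then have "k \<notin> J" using r z[of k] by force
    moreover have "sep (insert k J)"
      using J(1) far k by (auto simp: sep_def commute)
    ultimately show False using J(2)[of "insert k J"] fin by simp
  qed
  show "\<exists>K. finite K \<and> K \<subseteq> range z \<and> range z \<subseteq> (\<Union>x\<in>K. mball x r)"
  proof (intro exI[of _ "z ` ({..<n0} \<union> J)"] conjI subsetI)
    fix w assume "w \<in> range z"
    then obtain k where k: "w = z k" by blast
    show "w \<in> (\<Union>x\<in>z ` ({..<n0} \<union> J). mball x r)"
    proof (cases "k < n0")
      case True
      have "w \<in> mball (z k) r" using k r z by simp
      then show ?thesis using True by blast
    next
      case False
      then obtain j where "j \<in> J" "d (z j) (z k) < r" using near[of k] by auto
      then show ?thesis using k z by auto
    qed
  qed (use fin in auto)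
qed

lemma convergent_subsequence_heavy_balls:
  assumes "prob_space \<mu>" "sets \<mu> = sets mborel" "0 < c" "\<And>k::nat. z k \<in> M"
    and "\<And>r. 0 < r \<Longrightarrow> \<forall>\<^sub>F k in sequentially. c \<le> measure \<mu> (mball (z k) r)"
  obtains r l where "strict_mono r" "limitin mtopology (z \<circ> r) l sequentially"
proof -
  have "\<exists>r. strict_mono r \<and> MCauchy (z \<circ> r)"
    using mtotally_bounded_heavy_balls[OF assms] unfolding mtotally_bounded_sequentially by blast
  then show thesis using complete that unfolding mcomplete_def by blast
qed

text \<open>Continuity from above along the radii 1/(n+1).\<close>

lemma measure_singleton_ge:
  assumes \<mu>: "prob_space \<mu>" "sets \<mu> = sets mborel" and p: "p \<in> M"
    and le: "\<And>r. 0 < r \<Longrightarrow> c \<le> measure \<mu> (mball p r)"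
  shows "c \<le> measure \<mu> {p}"
proof -
  interpret \<mu>: prob_space \<mu> by fact
  have "(\<Inter>n::nat. mball p (1 / Suc n)) = {p}"
  proof (intro equalityI subsetI)
    fix w assume w: "w \<in> (\<Inter>n::nat. mball p (1 / Suc n))"
    then have wM: "w \<in> M" by auto
    have "\<not> 0 < d p w"
    proof
      assume "0 < d p w"
      then obtain n :: nat where "1 / Suc n < d p w" using nat_approx_posE by blast
      moreover have "d p w < 1 / Suc n" using w by auto
      ultimately show False by simp
    qed
    then show "w \<in> {p}" using wM p nonneg[of p w] by simp
  qed (use p in auto)
  moreover have "(\<lambda>n. measure \<mu> (mball p (1 / Suc n))) \<longlonglongrightarrow> measure \<mu> (\<Inter>n::nat. mball p (1 / Suc n))"
  proof (rule \<mu>.finite_Lim_measure_decseq)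
    show "decseq (\<lambda>n. mball p (1 / real (Suc n)))"
      unfolding decseq_def
    proof (intro allI impI)
      fix m n :: nat assume "m \<le> n"
      then have "1 / real (Suc n) \<le> 1 / real (Suc m)" by (intro frac_le) auto
      then show "mball p (1 / real (Suc n)) \<subseteq> mball p (1 / real (Suc m))"
        by (rule mball_subset_concentric)
    qed
    show "range (\<lambda>n. mball p (1 / real (Suc n))) \<subseteq> sets \<mu>"
      unfolding \<mu>(2) by (intro image_subsetI mball_sets_mborel)
  qed
  ultimately have "(\<lambda>n. measure \<mu> (mball p (1 / Suc n))) \<longlonglongrightarrow> measure \<mu> {p}" by simp
  then show ?thesis by (rule LIMSEQ_le_const) (intro exI[of _ 0] allI impI le, simp)
qed

end

text \<open>Several indices may share a point, so domination at single points is required for groups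
  of indices, and partial sums are grouped by the value of x. Indices of mass 0 are left out because
  their points may be placeholders.\<close>

lemma sum_indicator_le_measure:
  assumes a: "a \<in> seqA" and \<mu>: "finite_measure \<mu>" and s: "\<And>i. {x i} \<in> sets \<mu>"
    and le: "\<And>F p. \<lbrakk>finite F; \<And>i. i \<in> F \<Longrightarrow> 0 < a i \<and> x i = p; F \<noteq> {}\<rbrakk> \<Longrightarrow> sum a F \<le> measure \<mu> {p}"
    and B: "B \<in> sets \<mu>"
  shows "(\<Sum>i. a i * indicator B (x i)) \<le> measure \<mu> B"
proof (rule suminf_le_const)
  interpret finite_measure \<mu> by fact
  show "summable (\<lambda>i. a i * indicator B (x i))"
    by (rule seqA_summable_restrict[OF a])
  fix n
  let ?F = "{i \<in> {..<n}. x i \<in> B \<and> 0 < a i}"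
  have "(\<Sum>i<n. a i * indicator B (x i)) = (\<Sum>i<n. if x i \<in> B \<and> 0 < a i then a i else 0)"
    by (intro sum.cong) (use seqA_nonneg[OF a] in \<open>auto simp: indicator_def less_le\<close>)
  also have "\<dots> = sum a ?F" by (rule sum.inter_filter[symmetric]) simp
  also have "\<dots> = (\<Sum>p\<in>x ` ?F. sum a {i \<in> ?F. x i = p})"
    by (rule sum.image_gen) simp
  also have "\<dots> \<le> (\<Sum>p\<in>x ` ?F. measure \<mu> {p})"
    by (intro sum_mono le) auto
  also have "\<dots> = measure \<mu> (x ` ?F)"
    by (rule finite_measure_eq_sum_singleton[symmetric]) (use s in auto)
  also have "\<dots> \<le> measure \<mu> B"
    using B by (intro finite_measure_mono) auto
  finally show "(\<Sum>i<n. a i * indicator B (x i)) \<le> measure \<mu> B" .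
qed

text \<open>The points z i are images in X of the atoms of Y of mass b i > e; for smaller atoms z i is arbitrary.\<close>

lemma pyrA_box_matching:
  assumes b: "b \<in> seqA" and X: "mm_space X" and Y: "Y \<in> pyrA b" and e: "box_dist X Y < e"
  obtains z where "\<And>i. z i \<in> space (snd X)"
    "\<And>F U. \<lbrakk>finite F; \<And>i. i \<in> F \<Longrightarrow> e < b i; U \<in> sets (snd X);
      \<And>i w. \<lbrakk>i \<in> F; w \<in> space (snd X); fst X (z i) w \<le> e\<rbrakk> \<Longrightarrow> w \<in> U\<rbrakk> \<Longrightarrow> sum b F - e \<le> measure (snd X) U"
proof -
  have mmY: "mm_space Y" using Y pyrA_mm_space by auto
  interpret X: polish_metric "space (snd X)" "fst X" using X by (rule mm_space_polish)
  interpret Y: polish_metric "space (snd Y)" "fst Y" using mmY by (rule mm_space_polish)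
  obtain \<phi> \<psi> I where \<phi>: "parameter \<phi> X" and \<psi>: "parameter \<psi> Y" and I: "I \<in> sets unit_leb" "measure unit_leb I \<ge> 1 - e"
    and dis: "\<And>s t. s \<in> I \<Longrightarrow> t \<in> I \<Longrightarrow> \<bar>fst X (\<phi> s) (\<phi> t) - fst Y (\<psi> s) (\<psi> t)\<bar> \<le> e"
    using box_dist_lessE[OF X mmY e] by metis
  obtain y where y: "\<And>i. y i \<in> space (snd Y)"
    and le: "\<And>B. B \<in> sets (snd Y) \<Longrightarrow> (\<Sum>i. b i * indicator B (y i)) \<le> measure (snd Y) B"
    using Y unfolding pyrA_def by blast
  have I01: "I \<subseteq> {0..<1}" using I(1) by (simp add: sets_unit_leb)
  \<comment> \<open>The times in the good set I at which \<psi> sits on an atom with index in F.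
    Intersecting with I costs at most e.\<close>
  define S where "S F = {s \<in> I. \<psi> s \<in> y ` F}" for F
  have S: "S F \<in> sets unit_leb" "sum b F - e \<le> measure unit_leb (S F)" if F: "finite F" for F
  proof -
    have ys: "y ` F \<in> sets (snd Y)"
    proof -
      have "y ` F = (\<Union>i\<in>F. {y i})" by auto
      also have "\<dots> \<in> sets (snd Y)"
        using F Y.singleton_sets_mborel[OF y] mm_space_polish(2)[OF mmY] by (intro sets.finite_UN) auto
      finally show ?thesis .
    qed
    let ?T = "{t \<in> {0..<1}. \<psi> t \<in> y ` F}"
    have T: "?T \<in> sets unit_leb" by (rule parameter_sets[OF \<psi> ys])
    have eq: "S F = ?T \<inter> I" using I01 by (auto simp: S_def)
    show "S F \<in> sets unit_leb" unfolding eq using T I(1) by auto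
    have "sum b F = (\<Sum>i\<in>F. b i * indicator (y ` F) (y i))" by (intro sum.cong) auto
    also have "\<dots> \<le> (\<Sum>i. b i * indicator (y ` F) (y i))"
    proof (rule sum_le_suminf)
      show "summable (\<lambda>i. b i * indicator (y ` F) (y i))"
        by (rule seqA_summable_restrict[OF b])
    qed (use F seqA_nonneg[OF b] in auto)
    also have "\<dots> \<le> measure (snd Y) (y ` F)" by (rule le[OF ys])
    also have "\<dots> = measure unit_leb ?T" by (rule parameter_measure[OF \<psi> ys])
    also have "\<dots> \<le> measure unit_leb (S F \<union> (space unit_leb - I))"
    proof (rule unit_leb.finite_measure_mono)
      show "S F \<union> (space unit_leb - I) \<in> sets unit_leb"
        unfolding eq using T I(1) by (intro sets.Un sets.Int sets.compl_sets)
    qed (auto simp: S_def)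
    also have "\<dots> \<le> measure unit_leb (S F) + measure unit_leb (space unit_leb - I)"
      unfolding eq using T I(1) by (intro measure_Un_le sets.Int sets.compl_sets)
    also have "measure unit_leb (space unit_leb - I) = 1 - measure unit_leb I"
      by (rule unit_leb.prob_compl[OF I(1)])
    finally show "sum b F - e \<le> measure unit_leb (S F)" using I(2) by simp
  qed
  \<comment> \<open>Any time in \<open>S {i}\<close> may represent the i-th atom; \<phi> 0 is the
    default when there is none.\<close>
  define z where "z i = (if S {i} = {} then \<phi> 0 else \<phi> (SOME s. s \<in> S {i}))" for i
  have some: "(SOME s. s \<in> S {i}) \<in> S {i}" if "S {i} \<noteq> {}" for i
    using that by (simp add: some_in_eq)
  show thesis
  proof (rule that)
    show "z i \<in> space (snd X)" for i
    proof (cases "S {i} = {}")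
      case True
      then show ?thesis using parameter_space[OF \<phi>, of 0] by (simp add: z_def)
    next
      case False
      then have "(SOME s. s \<in> S {i}) \<in> {0..<1}" using some[OF False] I01 by (auto simp: S_def)
      then show ?thesis using parameter_space[OF \<phi>] False by (simp add: z_def)
    qed
    fix F U
    assume F: "finite F" and big: "\<And>i. i \<in> F \<Longrightarrow> e < b i" and U: "U \<in> sets (snd X)"
      and near: "\<And>i w. \<lbrakk>i \<in> F; w \<in> space (snd X); fst X (z i) w \<le> e\<rbrakk> \<Longrightarrow> w \<in> U"
    have "\<phi> s \<in> U" if s: "s \<in> S F" for s
    proof -
      obtain i where i: "i \<in> F" "s \<in> S {i}" using s by (auto simp: S_def)
      then have ne: "S {i} \<noteq> {}" by blast
      let ?t = "SOME s. s \<in> S {i}"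
      have t: "?t \<in> S {i}" by (rule some[OF ne])
      \<comment> \<open>Both times sit on the same atom of Y, at distance 0 there, so the box
        estimate leaves at most e between their images in X.\<close>
      have "\<psi> ?t = y i" "\<psi> s = y i" "?t \<in> I" "s \<in> I" using t i(2) by (auto simp: S_def)
      then have "\<bar>fst X (\<phi> ?t) (\<phi> s)\<bar> \<le> e" using dis[of ?t s] y[of i] by simp
      then have "fst X (z i) (\<phi> s) \<le> e" using ne by (simp add: z_def)
      moreover have "\<phi> s \<in> space (snd X)" using parameter_space[OF \<phi>] \<open>s \<in> I\<close> I01 by blast
      ultimately show ?thesis using near[OF i(1)] by blast
    qed
    then have "measure unit_leb (S F) \<le> measure unit_leb {t \<in> {0..<1}. \<phi> t \<in> U}"
      using parameter_sets[OF \<phi> U] I01 by (intro unit_leb.finite_measure_mono) (auto simp: S_def)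
    then show "sum b F - e \<le> measure (snd X) U"
      using S(2)[OF F] parameter_measure[OF \<phi> U] by simp
  qed
qed

text \<open>Since e n tends to 0 and A n i to a i, every i with a i > 0 eventually satisfies e n < A
  n i and leaves a heavy point in X. Indices with a i = 0 are ignored throughout and receive an
  arbitrary point.\<close>

lemma pyrA_limit:
  assumes a: "a \<in> seqA" and A: "\<And>n. A n \<in> seqA" and lim: "\<And>i. (\<lambda>n. A n i) \<longlonglongrightarrow> a i"
    and X: "mm_space X" and Y: "\<And>n. Y n \<in> pyrA (A n)" and box: "(\<lambda>n. box_dist X (Y n)) \<longlonglongrightarrow> 0"
  shows "X \<in> pyrA a"
proof -
  interpret polish_metric "space (snd X)" "fst X" using X by (rule mm_space_polish)
  interpret \<mu>: prob_space "snd X" using X by (rule mm_space_polish)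
  note sX = mm_space_polish(2)[OF X]
  let ?M = "space (snd X)" and ?d = "fst X" and ?\<mu> = "snd X"
  \<comment> \<open>The summand 1/(n+1) makes the comparison with the box distance strict and still
    vanishes in the limit.\<close>
  define e where "e n = box_dist X (Y n) + 1 / Suc n" for n
  have e_lim: "e \<longlonglongrightarrow> 0"
    unfolding e_def using tendsto_add[OF box LIMSEQ_inverse_real_of_nat] by (simp add: inverse_eq_divide)
  have "\<exists>z. (\<forall>i. z i \<in> ?M) \<and> (\<forall>F U. finite F \<longrightarrow> (\<forall>i\<in>F. e n < A n i) \<longrightarrow> U \<in> sets ?\<mu> \<longrightarrow>
      (\<forall>i\<in>F. \<forall>w\<in>?M. ?d (z i) w \<le> e n \<longrightarrow> w \<in> U) \<longrightarrow> sum (A n) F - e n \<le> measure ?\<mu> U)" for n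
  proof -
    have "box_dist X (Y n) < e n" by (simp add: e_def)
    from pyrA_box_matching[OF A X Y this] show ?thesis by metis
  qed
  then obtain z where z: "\<And>n i. z n i \<in> ?M"
    and match: "\<And>n F U. \<lbrakk>finite F; \<And>i. i \<in> F \<Longrightarrow> e n < A n i; U \<in> sets ?\<mu>;
      \<And>i w. \<lbrakk>i \<in> F; w \<in> ?M; ?d (z n i) w \<le> e n\<rbrakk> \<Longrightarrow> w \<in> U\<rbrakk> \<Longrightarrow> sum (A n) F - e n \<le> measure ?\<mu> U"
    by metis
  have sub_lim: "(\<lambda>k. A (s k) i) \<longlonglongrightarrow> a i" "(\<lambda>k. e (s k)) \<longlonglongrightarrow> 0" if "strict_mono s" for s i
    using LIMSEQ_subseq_LIMSEQ[OF lim that] LIMSEQ_subseq_LIMSEQ[OF e_lim that] by (simp_all add: comp_def)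
  have ev_big: "\<forall>\<^sub>F k in sequentially. e (s k) < A (s k) i" if "strict_mono s" "0 < a i" for s i
    using order_tendstoD(1)[OF tendsto_diff[OF sub_lim(1)[OF that(1), of i] sub_lim(2)[OF that(1)]], of 0] that(2)
    by simp
  define P where "P i s \<longleftrightarrow> (0 < a i \<longrightarrow> (\<exists>l. limitin mtopology (\<lambda>k. z (s k) i) l sequentially))" for i and s :: "nat \<Rightarrow> nat"
  interpret subseqs P
  proof
    fix i and s :: "nat \<Rightarrow> nat" assume s: "strict_mono s"
    show "\<exists>r'. strict_mono r' \<and> P i (s \<circ> r')"
    proof (cases "0 < a i")
      case False
      then show ?thesis by (intro exI[of _ id]) (simp add: P_def strict_mono_def)
    next
      case True
      \<comment> \<open>The bound a i / 2 depends on neither k nor r: the mass A (s k) i - e (s k)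
        tends to a i, and the error radius eventually drops below r.\<close>
      have "\<forall>\<^sub>F k in sequentially. a i / 2 \<le> measure ?\<mu> (mball (z (s k) i) r)" if r: "0 < r" for r
      proof -
        have 1: "\<forall>\<^sub>F k in sequentially. e (s k) < r"
          by (rule order_tendstoD(2)[OF sub_lim(2)[OF s] r])
        have 2: "\<forall>\<^sub>F k in sequentially. a i / 2 < A (s k) i - e (s k)"
          by (rule order_tendstoD(1)[OF tendsto_diff[OF sub_lim[OF s]]]) (use True in simp)
        show ?thesis
          using 1 2 ev_big[OF s True]
        proof eventually_elim
          case (elim k)
          have "sum (A (s k)) {i} - e (s k) \<le> measure ?\<mu> (mball (z (s k) i) r)"
            using elim z sX by (intro match) auto
          then show ?case using elim by simp
        qed
      qed
      then obtain r l where "strict_mono r" "limitin mtopology ((\<lambda>k. z (s k) i) \<circ> r) l sequentially"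
        using convergent_subsequence_heavy_balls[OF \<mu>.prob_space_axioms sX, of "a i / 2" "\<lambda>k. z (s k) i"] True z by auto
      then show ?thesis unfolding P_def by (intro exI[of _ r]) (auto simp: comp_def)
    qed
  qed
  have lim_diag: "\<exists>l. limitin mtopology (\<lambda>k. z (diagseq k) i) l sequentially" if ai: "0 < a i" for i
  proof -
    \<comment> \<open>The diagonal sequence is a subsequence of the i-th refinement only after an
      offset of \<open>Suc i\<close>; the shift is undone afterwards.\<close>
    have "P i (diagseq \<circ> ((+) (Suc i)))"
    proof (rule diagseq_holds)
      show "P n (s \<circ> r)" if "strict_mono r" "P n s" for r s n
        using that(2) limitin_subsequence[OF that(1), of mtopology "\<lambda>k. z (s k) n"] unfolding P_def comp_def by blast
    qed
    then obtain l where "limitin mtopology (\<lambda>k. z (diagseq (Suc i + k)) i) l sequentially"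
      using ai by (auto simp: P_def)
    then have "limitin mtopology (\<lambda>k. z (diagseq k) i) l sequentially"
      using limitin_sequentially_offset_rev[of mtopology "\<lambda>k. z (diagseq k) i" "Suc i" l] by (simp add: add.commute)
    then show ?thesis by blast
  qed
  define D where "D = diagseq"
  have D: "strict_mono D" unfolding D_def by (rule subseq_diagseq)
  define x where "x i = (if 0 < a i then SOME l. limitin mtopology (\<lambda>k. z (D k) i) l sequentially else z 0 0)" for i
  have x_lim: "limitin mtopology (\<lambda>k. z (D k) i) (x i) sequentially" if "0 < a i" for i
    unfolding x_def D_def if_P[OF that] by (rule someI_ex[OF lim_diag[OF that]])
  have xM: "x i \<in> ?M" for i
  proof (cases "0 < a i")
    case True
    then show ?thesis by (rule limitin_mspace[OF x_lim])
  next
    case False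
    then have "x i = z 0 0" unfolding x_def by (rule if_not_P)
    then show ?thesis using z by simp
  qed
  \<comment> \<open>Points z n i with different i may converge to the same p, so p must carry the
    mass of the whole group F. The radius r is split into r/2 for the distance of z to p and r/2 for
    the error e.\<close>
  have atom: "sum a F \<le> measure ?\<mu> {p}" if F: "finite F" "\<And>i. i \<in> F \<Longrightarrow> 0 < a i \<and> x i = p" "F \<noteq> {}" for F p
  proof (rule measure_singleton_ge[OF \<mu>.prob_space_axioms sX])
    show pM: "p \<in> ?M" using F xM by blast
    fix r :: real assume r: "0 < r"
    have "(\<lambda>k. sum (A (D k)) F - e (D k)) \<longlonglongrightarrow> sum a F - 0"
      by (intro tendsto_diff tendsto_sum sub_lim D)
    moreover have "\<forall>\<^sub>F k in sequentially. sum (A (D k)) F - e (D k) \<le> measure ?\<mu> (mball p r)"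
    proof -
      have 1: "\<forall>\<^sub>F k in sequentially. \<forall>i\<in>F. e (D k) < A (D k) i"
        using F ev_big[OF D] by (intro eventually_ball_finite) auto
      have 2: "\<forall>\<^sub>F k in sequentially. \<forall>i\<in>F. ?d (z (D k) i) p < r / 2"
      proof (intro eventually_ball_finite ballI F(1))
        fix i assume i: "i \<in> F"
        then have "(\<lambda>k. ?d (z (D k) i) p) \<longlonglongrightarrow> 0"
          using x_lim[of i] F(2)[OF i] unfolding limitin_metric_dist_null by blast
        then show "\<forall>\<^sub>F k in sequentially. ?d (z (D k) i) p < r / 2"
          by (rule order_tendstoD) (use r in simp)
      qed
      have 3: "\<forall>\<^sub>F k in sequentially. e (D k) < r / 2"
        by (rule order_tendstoD(2)[OF sub_lim(2)[OF D]]) (use r in simp)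
      show ?thesis
        using 1 2 3
      proof eventually_elim
        case (elim k)
        show ?case
        proof (rule match[OF F(1)])
          show "e (D k) < A (D k) i" if "i \<in> F" for i using elim that by blast
          show "mball p r \<in> sets ?\<mu>" using sX by simp
          fix i w assume iw: "i \<in> F" "w \<in> ?M" "?d (z (D k) i) w \<le> e (D k)"
          have "?d p w \<le> ?d p (z (D k) i) + ?d (z (D k) i) w"
            using pM z iw(2) by (intro triangle) auto
          then have "?d p w < r" using elim iw by (auto simp: commute)
          then show "w \<in> mball p r" using pM iw(2) by simp
        qed
      qed
    qed
    ultimately have "sum a F - 0 \<le> measure ?\<mu> (mball p r)"
      by (rule tendsto_upperbound) simp
    then show "sum a F \<le> measure ?\<mu> (mball p r)" by simp
  qed
  have "(\<Sum>i. a i * indicator B (x i)) \<le> measure ?\<mu> B" if "B \<in> sets ?\<mu>" for B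
  proof (rule sum_indicator_le_measure[OF a \<mu>.finite_measure_axioms _ atom that])
    show "{x i} \<in> sets ?\<mu>" for i
      unfolding sX by (rule singleton_sets_mborel[OF xM])
  qed
  then show ?thesis using X xM unfolding pyrA_def by blast
qed

section \<open>Topology\<close>

text \<open>Closedness in the box distance is \<open>pyrA_limit\<close> for the constant sequence A
  n = a.\<close>

lemma pyramid_pyrA:
  assumes a: "a \<in> seqA" shows "pyramid (pyrA a)"
  unfolding pyramid_def
proof (intro conjI allI impI ballI)
  show "pyrA a \<noteq> {}" by (rule pyrA_nonempty[OF a])
  show "pyrA a \<subseteq> {X. mm_space X}" by (rule pyrA_mm_space)
  show "Y \<in> pyrA a" if "X \<in> pyrA a" "mm_space Y \<and> lip_dom Y X" for X Y
    using pyrA_downward[OF a that(1)] that(2) by blast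
  show "\<exists>Z\<in>pyrA a. lip_dom X Z \<and> lip_dom Y Z" if "X \<in> pyrA a" "Y \<in> pyrA a" for X Y
    by (rule pyrA_directed[OF a that])
  fix X assume X: "mm_space X \<and> (\<forall>\<epsilon>>0. \<exists>Y\<in>pyrA a. box_dist X Y < \<epsilon>)"
  then have "\<forall>n::nat. \<exists>Y\<in>pyrA a. box_dist X Y < 1 / Suc n" by simp
  then obtain Y where Y: "\<And>n::nat. Y n \<in> pyrA a" "\<And>n. box_dist X (Y n) < 1 / Suc n" by metis
  have "0 \<le> box_dist X (Y n)" for n
    using X Y(1) pyrA_mm_space by (intro box_dist_nonneg) auto
  then have "(\<lambda>n. box_dist X (Y n)) \<longlonglongrightarrow> 0"
    by (intro tendsto_sandwich[OF _ _ tendsto_const LIMSEQ_inverse_real_of_nat] always_eventually)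
      (use Y(2) in \<open>auto intro: less_imp_le simp: inverse_eq_divide\<close>)
  then show "X \<in> pyrA a"
    using pyrA_limit[OF a a tendsto_const, of X Y] X Y(1) by blast
qed

text \<open>If the lower limit were not positive, there would be elements of
  \<open>pyrA (A (r k))\<close> at box distance below 1/(k+1) from X, and \<open>pyrA_limit\<close>
  would put X into \<open>pyrA a\<close>.\<close>

lemma weak_conv_pyrA:
  assumes a: "a \<in> seqA" and A: "\<And>n. A n \<in> seqA" and lim: "\<And>i. (\<lambda>n. A n i) \<longlonglongrightarrow> a i"
  shows "weak_conv (\<lambda>n. pyrA (A n)) (pyrA a)"
  unfolding weak_conv_def
proof (intro conjI ballI allI impI)
  show "(\<lambda>n. box_dist_set X (pyrA (A n))) \<longlonglongrightarrow> 0" if "X \<in> pyrA a" for X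
    by (rule box_dist_set_pyrA_tendsto_0[OF a A lim that])
  fix X assume X: "mm_space X \<and> X \<notin> pyrA a"
  show "0 < liminf (\<lambda>n. ereal (box_dist_set X (pyrA (A n))))"
  proof (rule ccontr)
    assume *: "\<not> ?thesis"
    have "\<exists>n\<ge>k. box_dist_set X (pyrA (A n)) < 1 / Suc k" for k :: nat
    proof (rule ccontr)
      assume "\<not> ?thesis"
      then have "\<forall>\<^sub>F n in sequentially. ereal (1 / Suc k) \<le> ereal (box_dist_set X (pyrA (A n)))"
        unfolding eventually_sequentially by (intro exI[of _ k]) (auto simp: not_less)
      then have "ereal (1 / Suc k) \<le> liminf (\<lambda>n. ereal (box_dist_set X (pyrA (A n))))"
        by (rule Liminf_bounded)
      moreover have "(0::ereal) < ereal (1 / Suc k)" by simp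
      ultimately show False using * by (meson less_le_trans)
    qed
    then obtain r where r: "\<And>k::nat. k \<le> r k" "\<And>k. box_dist_set X (pyrA (A (r k))) < 1 / Suc k" by metis
    have "\<exists>Y\<in>pyrA (A (r k)). box_dist X Y < 1 / Suc k" for k
      using box_dist_set_lessE[OF pyrA_nonempty[OF A] r(2)] by metis
    then obtain Y where Y: "\<And>k. Y k \<in> pyrA (A (r k))" "\<And>k. box_dist X (Y k) < 1 / Suc k" by metis
    have "0 \<le> box_dist X (Y n)" for n
      using X Y(1) pyrA_mm_space by (intro box_dist_nonneg) auto
    then have box: "(\<lambda>n. box_dist X (Y n)) \<longlonglongrightarrow> 0"
      by (intro tendsto_sandwich[OF _ _ tendsto_const LIMSEQ_inverse_real_of_nat] always_eventually)
        (use Y(2) in \<open>auto intro: less_imp_le simp: inverse_eq_divide\<close>)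
    \<comment> \<open>r need not be increasing; r k \<ge> k is enough for convergence along
      it.\<close>
    have "filterlim r sequentially sequentially"
      using filterlim_at_top_mono[OF filterlim_ident, of r] r(1) by simp
    then have "(\<lambda>k. A (r k) i) \<longlonglongrightarrow> a i" for i
      using lim[of i] by (rule filterlim_compose[rotated])
    then have "X \<in> pyrA a"
      using pyrA_limit[OF a A _ _ Y(1) box] X by blast
    then show False using X by blast
  qed
qed

section \<open>Uniqueness of weak limits and the topology of weak convergence\<close>

lemma weak_conv_unique:
  assumes "weak_conv Ps P" "weak_conv Ps Q" "P \<subseteq> {X. mm_space X}" "Q \<subseteq> {X. mm_space X}"
  shows "P = Q"
proof -
  have "X \<in> Q" if "weak_conv Ps P" "weak_conv Ps Q" "P \<subseteq> {X. mm_space X}" "X \<in> P" for P Q X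
  proof (rule ccontr)
    assume "X \<notin> Q"
    then have "0 < liminf (\<lambda>n. ereal (box_dist_set X (Ps n)))"
      using that unfolding weak_conv_def by blast
    moreover have "(\<lambda>n. ereal (box_dist_set X (Ps n))) \<longlonglongrightarrow> ereal 0"
      using that unfolding weak_conv_def by (intro tendsto_ereal) blast
    then have "liminf (\<lambda>n. ereal (box_dist_set X (Ps n))) = ereal 0"
      by (intro lim_imp_Liminf) simp
    ultimately show False by simp
  qed
  then show ?thesis using assms by blast
qed

lemma weak_conv_subseq:
  assumes "weak_conv Ps P" and r: "strict_mono r"
  shows "weak_conv (\<lambda>n. Ps (r n)) P"
  unfolding weak_conv_def
proof (intro conjI ballI allI impI)
  fix X assume "X \<in> P"
  then have "(\<lambda>n. box_dist_set X (Ps n)) \<longlonglongrightarrow> 0" using assms(1) unfolding weak_conv_def by blast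
  from LIMSEQ_subseq_LIMSEQ[OF this r] show "(\<lambda>n. box_dist_set X (Ps (r n))) \<longlonglongrightarrow> 0"
    by (simp add: comp_def)
next
  fix X assume "mm_space X \<and> X \<notin> P"
  then have "0 < liminf (\<lambda>n. ereal (box_dist_set X (Ps n)))" using assms(1) unfolding weak_conv_def by blast
  also have "\<dots> \<le> liminf ((\<lambda>n. ereal (box_dist_set X (Ps n))) \<circ> r)" by (rule liminf_subseq_mono[OF r])
  finally show "0 < liminf (\<lambda>n. ereal (box_dist_set X (Ps (r n))))" by (simp add: comp_def)
qed

lemma openin_weak_Pi_topology:
  "openin weak_Pi_topology U \<longleftrightarrow> U \<subseteq> Pyramids \<and>
     (\<forall>P\<in>U. \<forall>Ps. range Ps \<subseteq> Pyramids \<and> weak_conv Ps P \<longrightarrow> (\<forall>\<^sub>F n in sequentially. Ps n \<in> U))"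
proof -
  have "istopology (\<lambda>U. U \<subseteq> Pyramids \<and>
     (\<forall>P\<in>U. \<forall>Ps. range Ps \<subseteq> Pyramids \<and> weak_conv Ps P \<longrightarrow> (\<forall>\<^sub>F n in sequentially. Ps n \<in> U)))" (is "istopology ?T")
    unfolding istopology_def
  proof (intro conjI allI impI)
    fix S T assume "?T S" "?T T"
    then show "S \<inter> T \<subseteq> Pyramids" by blast
    show "\<forall>P\<in>S \<inter> T. \<forall>Ps. range Ps \<subseteq> Pyramids \<and> weak_conv Ps P \<longrightarrow> (\<forall>\<^sub>F n in sequentially. Ps n \<in> S \<inter> T)"
    proof (intro ballI allI impI)
      fix P Ps assume "P \<in> S \<inter> T" "range Ps \<subseteq> Pyramids \<and> weak_conv Ps P"
      then have "\<forall>\<^sub>F n in sequentially. Ps n \<in> S" "\<forall>\<^sub>F n in sequentially. Ps n \<in> T"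
        using \<open>?T S\<close> \<open>?T T\<close> by blast+
      then show "\<forall>\<^sub>F n in sequentially. Ps n \<in> S \<inter> T" by eventually_elim simp
    qed
  next
    fix K assume K: "\<forall>S\<in>K. ?T S"
    then show "\<Union>K \<subseteq> Pyramids" by blast
    show "\<forall>P\<in>\<Union>K. \<forall>Ps. range Ps \<subseteq> Pyramids \<and> weak_conv Ps P \<longrightarrow> (\<forall>\<^sub>F n in sequentially. Ps n \<in> \<Union>K)"
    proof (intro ballI allI impI)
      fix P Ps assume "P \<in> \<Union>K" and Ps: "range Ps \<subseteq> Pyramids \<and> weak_conv Ps P"
      then obtain S where S: "S \<in> K" "P \<in> S" by blast
      then have "\<forall>\<^sub>F n in sequentially. Ps n \<in> S" using K Ps by blast
      then show "\<forall>\<^sub>F n in sequentially. Ps n \<in> \<Union>K" using S(1) by (auto elim: eventually_mono)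
    qed
  qed
  then show ?thesis unfolding weak_Pi_topology_def by (simp only: topology_inverse')
qed

lemma topspace_weak_Pi_topology: "topspace weak_Pi_topology = Pyramids"
proof
  show "topspace weak_Pi_topology \<subseteq> Pyramids"
    using openin_topspace[of weak_Pi_topology] unfolding openin_weak_Pi_topology by blast
  have "openin weak_Pi_topology Pyramids"
    unfolding openin_weak_Pi_topology by (auto intro!: always_eventually)
  then show "Pyramids \<subseteq> topspace weak_Pi_topology" by (rule openin_subset)
qed

text \<open>Suppose a k < b k and take the space with atoms a i and a diffuse rest. The points
  assigned to b 0, ..., b k have mass above a k each, hence lie among the k atoms of index below k.
  Summing, b 0 + ... + b k is at most a 0 + ... + a (k-1) = b 0 + ... + b (k-1), so b k \<le> 0,
  against 0 \<le> a k < b k.\<close>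

lemma pyrA_subset_imp_le:
  assumes a: "a \<in> seqA" and b: "b \<in> seqA" and sub: "pyrA a \<subseteq> pyrA b" and eq: "\<And>i. i < k \<Longrightarrow> a i = b i"
  shows "b k \<le> a k"
proof (rule ccontr)
  assume "\<not> b k \<le> a k"
  then have lt: "a k < b k" by simp
  \<comment> \<open>The atoms are placed at negative integers, away from the diffuse part in [0,1).\<close>
  define \<theta> where "\<theta> t = (if \<exists>i. t \<in> mass_interval a i then - real (Suc (THE i. t \<in> mass_interval a i)) else t)" for t
  have \<theta>1: "\<theta> t = - real (Suc i)" if "t \<in> mass_interval a i" for i t
  proof -
    have "(THE i. t \<in> mass_interval a i) = i" using that mass_interval_disjoint[OF a] by blast
    then show ?thesis using that by (auto simp: \<theta>_def)
  qed
  have \<theta>2: "\<theta> t = t" if "\<nexists>i. t \<in> mass_interval a i" for t using that by (simp add: \<theta>_def)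
  have \<theta>m: "\<theta> \<in> borel_measurable unit_leb"
  proof (rule measurable_mass_intervals[OF a])
    show "(\<lambda>t. t) \<in> borel_measurable unit_leb"
      unfolding unit_leb_def by (intro measurable_restrict_space1) simp
    show "\<theta> t = t" if "t \<in> {suminf a..<1}" for t
      using mass_interval_subset(1)[OF a] that by (intro \<theta>2) fastforce
  qed (use \<theta>1 in auto)
  moreover have "constant_on_masses a \<theta>"
    unfolding constant_on_masses_def using \<theta>1 by simp
  ultimately obtain Z g where Z: "Z \<in> pyrA a" "parameter (g \<circ> \<theta>) Z" "AE t in unit_leb. g (\<theta> t) = \<theta> t"
    using law_in_pyrA[OF a polish_metric_real measurable_mborel_real] by metis
  have mmZ: "mm_space Z" using Z(1) pyrA_mm_space by auto
  interpret Z: polish_metric "space (snd Z)" "fst Z" using mmZ by (rule mm_space_polish)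
  have "Z \<in> pyrA b" using Z(1) sub by blast
  then obtain x where x: "\<And>i. x i \<in> space (snd Z)"
    and le: "\<And>B. B \<in> sets (snd Z) \<Longrightarrow> (\<Sum>i. b i * indicator B (x i)) \<le> measure (snd Z) B"
    unfolding pyrA_def by blast
  have fin_sets: "x ` F \<in> sets (snd Z)" if "finite F" for F
  proof -
    have "x ` F = (\<Union>i\<in>F. {x i})" by auto
    also have "\<dots> \<in> sets (snd Z)"
      using that Z.singleton_sets_mborel[OF x] mm_space_polish(2)[OF mmZ] by (intro sets.finite_UN) auto
    finally show ?thesis .
  qed
  have mass: "sum b F \<le> measure unit_leb {t \<in> {0..<1}. \<theta> t \<in> x ` F}" if F: "finite F" for F
  proof -
    have "sum b F = (\<Sum>i\<in>F. b i * indicator (x ` F) (x i))" by (intro sum.cong) auto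
    also have "\<dots> \<le> (\<Sum>i. b i * indicator (x ` F) (x i))"
    proof (rule sum_le_suminf)
      show "summable (\<lambda>i. b i * indicator (x ` F) (x i))"
        by (rule seqA_summable_restrict[OF b])
    qed (use F seqA_nonneg[OF b] in auto)
    also have "\<dots> \<le> measure (snd Z) (x ` F)" by (rule le[OF fin_sets[OF F]])
    also have "\<dots> = measure unit_leb {t \<in> {0..<1}. (g \<circ> \<theta>) t \<in> x ` F}"
      by (rule parameter_measure[OF Z(2) fin_sets[OF F]])
    also have "\<dots> = measure unit_leb {t \<in> {0..<1}. \<theta> t \<in> x ` F}"
    proof (rule measure_eq_AE)
      show "AE t in unit_leb. (t \<in> {t \<in> {0..<1}. (g \<circ> \<theta>) t \<in> x ` F}) = (t \<in> {t \<in> {0..<1}. \<theta> t \<in> x ` F})"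
        using Z(3) by eventually_elim simp
      show "{t \<in> {0..<1}. (g \<circ> \<theta>) t \<in> x ` F} \<in> sets unit_leb" by (rule parameter_sets[OF Z(2) fin_sets[OF F]])
      have "\<theta> -` (x ` F) \<inter> space unit_leb \<in> sets unit_leb"
        using F by (intro measurable_sets[OF \<theta>m] borel_closed finite_imp_closed) simp
      then show "{t \<in> {0..<1}. \<theta> t \<in> x ` F} \<in> sets unit_leb" by (simp add: vimage_def Int_def conj_commute)
    qed
    finally show ?thesis .
  qed
  have in_P: "\<exists>j<k. x i = - real (Suc j)" if i: "i \<le> k" for i
  proof (rule ccontr)
    assume no: "\<not> ?thesis"
    \<comment> \<open>A point other than the first k atoms is either an atom of index at least k,
      with mass at most a k, or carries no mass.\<close>
    have small: "measure unit_leb {t \<in> {0..<1}. \<theta> t = x i} \<le> a k"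
    proof (cases "\<exists>j. x i = - real (Suc j)")
      case True
      then obtain j where j: "x i = - real (Suc j)" by blast
      then have "k \<le> j" using no not_less by blast
      have "{t \<in> {0..<1}. \<theta> t = x i} \<subseteq> mass_interval a j"
      proof
        fix t assume t: "t \<in> {t \<in> {0..<1}. \<theta> t = x i}"
        show "t \<in> mass_interval a j"
        proof (cases "\<exists>i. t \<in> mass_interval a i")
          case True
          then obtain l where l: "t \<in> mass_interval a l" by blast
          then have "l = j" using \<theta>1[OF l] t j by simp
          then show ?thesis using l by simp
        next
          case False
          then show ?thesis using \<theta>2[OF False] t j by auto
        qed
      qed
      then have "measure unit_leb {t \<in> {0..<1}. \<theta> t = x i} \<le> measure unit_leb (mass_interval a j)"
        by (intro unit_leb.finite_measure_mono mass_interval_sets[OF a])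
      also have "\<dots> \<le> a k" using measure_mass_interval[OF a] seqA_antimono[OF a \<open>k \<le> j\<close>] by simp
      finally show ?thesis .
    next
      case False
      have "{t \<in> {0..<1}. \<theta> t = x i} \<subseteq> {x i} \<inter> {0..<1}"
      proof
        fix t assume t: "t \<in> {t \<in> {0..<1}. \<theta> t = x i}"
        then have "x i = \<theta> t" by simp
        then have "\<nexists>l. t \<in> mass_interval a l" using \<theta>1 False by metis
        then show "t \<in> {x i} \<inter> {0..<1}" using \<theta>2 t by auto
      qed
      then have "measure unit_leb {t \<in> {0..<1}. \<theta> t = x i} \<le> measure unit_leb ({x i} \<inter> {0..<1})"
        by (intro unit_leb.finite_measure_mono) (auto simp: sets_unit_leb)
      also have "\<dots> = measure lborel ({x i} \<inter> {0..<1})" by (intro measure_unit_leb) auto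
      also have "\<dots> = 0" by (cases "x i \<in> {0..<1}") simp_all
      finally show ?thesis using seqA_nonneg[OF a, of k] by simp
    qed
    have "b k \<le> b i" by (rule seqA_antimono[OF b i])
    also have "b i \<le> measure unit_leb {t \<in> {0..<1}. \<theta> t = x i}" using mass[of "{i}"] by simp
    finally show False using small lt by simp
  qed
  have "sum b {..<Suc k} \<le> measure unit_leb {t \<in> {0..<1}. \<theta> t \<in> x ` {..<Suc k}}" by (rule mass) simp
  also have "\<dots> \<le> measure unit_leb (\<Union>j<k. mass_interval a j)"
  proof (rule unit_leb.finite_measure_mono)
    show "(\<Union>j<k. mass_interval a j) \<in> sets unit_leb" using mass_interval_sets[OF a] by auto
    show "{t \<in> {0..<1}. \<theta> t \<in> x ` {..<Suc k}} \<subseteq> (\<Union>j<k. mass_interval a j)"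
    proof
      fix t assume t: "t \<in> {t \<in> {0..<1}. \<theta> t \<in> x ` {..<Suc k}}"
      then obtain i where "i \<le> k" "\<theta> t = x i" by (auto simp: less_Suc_eq_le)
      then obtain j where j: "j < k" "\<theta> t = - real (Suc j)" using in_P[of i] by auto
      show "t \<in> (\<Union>j<k. mass_interval a j)"
      proof (cases "\<exists>i. t \<in> mass_interval a i")
        case True
        then obtain l where l: "t \<in> mass_interval a l" by blast
        then have "l = j" using \<theta>1[OF l] j by simp
        then show ?thesis using l j by auto
      next
        case False
        then show ?thesis using \<theta>2[OF False] t j by auto
      qed
    qed
  qed
  also have "\<dots> = sum a {..<k}" by (rule measure_UN_mass_interval[OF a]) simp
  also have "\<dots> = sum b {..<k}" using eq by (intro sum.cong) auto
  finally have "b k \<le> 0" by simp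
  then show False using lt seqA_nonneg[OF a, of k] by simp
qed

text \<open>Strong induction: once all earlier entries agree, the two inclusions compare the next
  one in both directions.\<close>

lemma inj_on_pyrA: "inj_on pyrA seqA"
proof (rule inj_onI, rule ext)
  fix a b i assume ab: "a \<in> seqA" "b \<in> seqA" "pyrA a = pyrA b"
  show "a i = b i"
  proof (induction i rule: less_induct)
    case (less i)
    then show ?case
      using pyrA_subset_imp_le[OF ab(1,2), of i] pyrA_subset_imp_le[OF ab(2,1), of i] ab(3) by force
  qed
qed

section \<open>Compactness of A and the weak topology of l^2\<close>

lemma tendsto_coordinate:
  fixes x :: "nat \<Rightarrow> nat \<Rightarrow> real"
  assumes "x \<longlonglongrightarrow> l" shows "(\<lambda>n. x n i) \<longlonglongrightarrow> l i"
proof -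
  have "isCont (\<lambda>x :: nat \<Rightarrow> real. x i) l"
    using continuous_on_product_coordinates[of i] continuous_on_eq_continuous_at[OF open_UNIV] by blast
  then show ?thesis using assms by (rule isCont_tendsto_compose)
qed

text \<open>Each condition on the right involves finitely many coordinates and so survives pointwise
  limits, whereas \<open>suminf\<close> itself need not pass to the limit.\<close>

lemma seqA_iff_partial_sums:
  "a \<in> seqA \<longleftrightarrow> (\<forall>i. 0 \<le> a i) \<and> (\<forall>i. a (Suc i) \<le> a i) \<and> (\<forall>n. sum a {..<n} \<le> 1)"
proof
  assume a: "a \<in> seqA"
  then show "(\<forall>i. 0 \<le> a i) \<and> (\<forall>i. a (Suc i) \<le> a i) \<and> (\<forall>n. sum a {..<n} \<le> 1)"
    by (intro conjI allI seqA_nonneg seqA_antimono seqA_sum_le_1) auto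
next
  assume *: "(\<forall>i. 0 \<le> a i) \<and> (\<forall>i. a (Suc i) \<le> a i) \<and> (\<forall>n. sum a {..<n} \<le> 1)"
  then have "summable a" by (intro summableI_nonneg_bounded[of a 1]) auto
  moreover have "antimono a" using * by (simp add: decseq_Suc_iff)
  ultimately show "a \<in> seqA"
    using * suminf_le_const[of a 1] by (simp add: seqA_def)
qed

text \<open>A closed subset of a product of unit intervals, which is compact by Tychonoff. Sequences
  may test closedness because the product is countable, hence metrizable.\<close>

lemma compact_seqA: "compact seqA"
proof -
  have "compact (UNIV \<rightarrow>\<^sub>E {0..1} :: (nat \<Rightarrow> real) set)"
    using compactin_PiE[of "\<lambda>_. euclidean :: real topology" UNIV "\<lambda>_. {0..1}"]
    by (simp add: euclidean_product_topology)
  moreover have "closed seqA"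
    unfolding closed_sequential_limits
  proof (intro allI impI, elim conjE)
    fix x and l :: "nat \<Rightarrow> real" assume x: "\<forall>n. x n \<in> seqA" and lim: "x \<longlonglongrightarrow> l"
    have "0 \<le> l i" for i
      using tendsto_coordinate[OF lim] seqA_nonneg x by (intro LIMSEQ_le_const[of "\<lambda>n. x n i"]) blast+
    moreover have "l (Suc i) \<le> l i" for i
      by (rule LIMSEQ_le[OF tendsto_coordinate[OF lim] tendsto_coordinate[OF lim]])
        (use x seqA_antimono in auto)
    moreover have "sum l {..<n} \<le> 1" for n
    proof (rule LIMSEQ_le_const2)
      show "(\<lambda>k. sum (x k) {..<n}) \<longlonglongrightarrow> sum l {..<n}"
        by (intro tendsto_sum tendsto_coordinate lim)
    qed (use x seqA_sum_le_1 in blast)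
    ultimately show "l \<in> seqA" by (simp add: seqA_iff_partial_sums)
  qed
  moreover have "seqA \<subseteq> (UNIV \<rightarrow>\<^sub>E {0..1})"
  proof
    fix a :: "nat \<Rightarrow> real" assume a: "a \<in> seqA"
    have "a i \<le> 1" for i
      using seqA_le_inverse[OF a, of i] by (rule order_trans) simp
    then show "a \<in> UNIV \<rightarrow>\<^sub>E {0..1}" using seqA_nonneg[OF a] by auto
  qed
  ultimately show ?thesis by (metis compact_Int_closed inf.absorb_iff2)
qed

lemma seqA_subset_l2: "seqA \<subseteq> l2"
proof
  fix a assume a: "a \<in> seqA"
  have "(a i)\<^sup>2 \<le> a i" for i
  proof -
    have "a i \<le> 1" using seqA_le_inverse[OF a, of i] by (rule order_trans) simp
    then show ?thesis
      using seqA_nonneg[OF a, of i] by (simp add: power2_eq_square mult_left_le)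
  qed
  then have "summable (\<lambda>i. (a i)\<^sup>2)"
    by (intro summable_comparison_test'[OF seqA_summable[OF a], of 0]) simp
  then show "a \<in> l2" by (simp add: l2_def)
qed

text \<open>On \<open>seqA\<close> the bound x i \<le> 1/(i+1) is uniform, so the terms of the
  series are dominated by (y i)^2 + 1/(i+1)^2. By the M-test the inner product is a uniform limit of
  finite combinations of coordinates.\<close>

lemma continuous_on_l2_inner:
  assumes y: "y \<in> l2" shows "continuous_on seqA (\<lambda>x. l2_inner x y)"
  unfolding l2_inner_def
proof (rule uniform_limit_theorem)
  have "summable (\<lambda>i. inverse (real (Suc i) ^ 2))"
    using inverse_power_summable[of 2, where 'a = real] by (subst summable_Suc_iff) simp
  then have "summable (\<lambda>i. (y i)\<^sup>2 + inverse (real (Suc i) ^ 2))"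
    using y by (intro summable_add) (simp_all add: l2_def)
  then show "uniform_limit seqA (\<lambda>n x. \<Sum>i<n. x i * y i) (\<lambda>x. \<Sum>i. x i * y i) sequentially"
  proof (rule Weierstrass_m_test[rotated])
    fix i and x :: "nat \<Rightarrow> real" assume x: "x \<in> seqA"
    let ?c = "inverse (real (Suc i))"
    have "norm (x i * y i) \<le> ?c * \<bar>y i\<bar>"
      using seqA_nonneg[OF x, of i] mult_right_mono[OF seqA_le_inverse[OF x, of i], of "\<bar>y i\<bar>"]
      by (simp add: abs_mult inverse_eq_divide del: of_nat_Suc)
    also have "\<dots> \<le> \<bar>y i\<bar>\<^sup>2 + ?c\<^sup>2"
    proof -
      have "2 * (?c * \<bar>y i\<bar>) \<le> \<bar>y i\<bar>\<^sup>2 + ?c\<^sup>2"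
        using sum_squares_bound[of ?c "\<bar>y i\<bar>"] by (simp add: mult.assoc add.commute)
      moreover have "0 \<le> ?c * \<bar>y i\<bar>" by simp
      ultimately show ?thesis by linarith
    qed
    finally show "norm (x i * y i) \<le> (y i)\<^sup>2 + inverse (real (Suc i) ^ 2)"
      by (simp add: power_inverse del: of_nat_Suc)
  qed
  have "continuous_on seqA (\<lambda>x. x i)" for i :: nat
    by (rule continuous_on_subset[OF continuous_on_product_coordinates]) simp
  then show "\<forall>\<^sub>F n in sequentially. continuous_on seqA (\<lambda>x. \<Sum>i<n. x i * y i)"
    by (intro always_eventually allI continuous_on_sum continuous_on_mult continuous_on_const)
qed simp

text \<open>Unit vectors make every coordinate weakly continuous, which gives one comparison; the
  other is continuity of all inner products on \<open>seqA\<close> in the product topology, the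
  topology that the function type carries.\<close>

lemma weak_l2_topology_seqA: "subtopology weak_l2_topology seqA = top_of_set seqA"
proof -
  let ?W = "subtopology weak_l2_topology seqA"
  have topW: "topspace ?W = seqA"
    unfolding weak_l2_topology_def topspace_subtopology topology_generated_by_topspace
    using seqA_subset_l2 by auto
  have c1: "continuous_map ?W euclidean (\<lambda>x. x)"
    unfolding euclidean_product_topology[symmetric] continuous_map_componentwise_UNIV
  proof
    fix i :: nat
    let ?e = "\<lambda>j. if j = i then 1 else 0 :: real"
    have "?e \<in> l2"
      unfolding l2_def using summable_finite[of "{i}" "\<lambda>j. (?e j)\<^sup>2"] by simp
    have inner: "l2_inner x ?e = x i" for x
      unfolding l2_inner_def by (subst suminf_finite[of "{i}"]) auto
    have "continuous_map ?W euclideanreal (\<lambda>x. l2_inner x ?e)"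
      unfolding continuous_map_def
    proof (intro conjI allI impI)
      fix U :: "real set" assume "openin euclideanreal U"
      then have "openin weak_l2_topology {x \<in> l2. l2_inner x ?e \<in> U}"
        unfolding weak_l2_topology_def using \<open>?e \<in> l2\<close> by (intro topology_generated_by_Basis) auto
      moreover have "{x \<in> topspace ?W. l2_inner x ?e \<in> U} = {x \<in> l2. l2_inner x ?e \<in> U} \<inter> seqA"
        unfolding topW using seqA_subset_l2 by auto
      ultimately show "openin ?W {x \<in> topspace ?W. l2_inner x ?e \<in> U}"
        unfolding openin_subtopology by blast
    qed simp
    then show "continuous_map ?W euclideanreal (\<lambda>x. x i)" unfolding inner .
  qed
  have c2: "continuous_map (top_of_set seqA) weak_l2_topology (\<lambda>x. x)"
    unfolding weak_l2_topology_def
  proof (rule continuous_on_generated_topo)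
    fix V assume "V \<in> insert l2 {{x \<in> l2. l2_inner x y \<in> U} | y U. y \<in> l2 \<and> open U}"
    then consider "V = l2" | y U where "y \<in> l2" "open U" "V = {x \<in> l2. l2_inner x y \<in> U}" by blast
    then show "openin (top_of_set seqA) ((\<lambda>x. x) -` V \<inter> topspace (top_of_set seqA))"
    proof cases
      case 1
      then have "(\<lambda>x. x) -` V \<inter> topspace (top_of_set seqA) = seqA" using seqA_subset_l2 by auto
      then show ?thesis by simp
    next
      case 2
      have "(\<lambda>x. x) -` V \<inter> topspace (top_of_set seqA) = seqA \<inter> (\<lambda>x. l2_inner x y) -` U"
        using 2(3) seqA_subset_l2 by auto
      then show ?thesis
        using continuous_openin_preimage_gen[OF continuous_on_l2_inner[OF 2(1)] 2(2)] by simp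
    qed
  qed (use seqA_subset_l2 in auto)
  show ?thesis
    unfolding topology_eq
  proof (intro allI iffI)
    fix S assume S: "openin ?W S"
    then obtain T where T: "openin weak_l2_topology T" "S = T \<inter> seqA" unfolding openin_subtopology by blast
    have "openin (top_of_set seqA) {x \<in> topspace (top_of_set seqA). x \<in> T}"
      by (rule openin_continuous_map_preimage[OF c2 T(1)])
    moreover have "{x \<in> topspace (top_of_set seqA). x \<in> T} = S" using T(2) by auto
    ultimately show "openin (top_of_set seqA) S" by simp
  next
    fix S assume S: "openin (top_of_set seqA) S"
    then obtain T where T: "open T" "S = T \<inter> seqA" unfolding openin_subtopology by auto
    have "openin ?W {x \<in> topspace ?W. x \<in> T}"
      by (rule openin_continuous_map_preimage[OF c1]) (use T(1) in simp)
    moreover have "{x \<in> topspace ?W. x \<in> T} = S" using T(2) topW by auto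
    ultimately show "openin ?W S" by simp
  qed
qed

text \<open>\<open>seqA\<close> is metrizable, so a preimage that is not open is detected by a
  convergent sequence; its pyramids converge weakly, and open sets of pyramids are defined by just
  such sequences.\<close>

lemma continuous_map_pyrA: "continuous_map (top_of_set seqA) weak_Pi_topology pyrA"
  unfolding continuous_map_def
proof (intro conjI allI impI)
  show "pyrA \<in> topspace (top_of_set seqA) \<rightarrow> topspace weak_Pi_topology"
    unfolding topspace_weak_Pi_topology using pyramid_pyrA by (auto simp: Pyramids_def)
  fix U assume U: "openin weak_Pi_topology U"
  show "openin (top_of_set seqA) {a \<in> topspace (top_of_set seqA). pyrA a \<in> U}"
    unfolding openin_euclidean_subtopology_iff
  proof (intro conjI ballI)
    fix a assume "a \<in> {a \<in> topspace (top_of_set seqA). pyrA a \<in> U}"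
    then have a: "a \<in> seqA" "pyrA a \<in> U" by auto
    show "\<exists>e>0. \<forall>x'\<in>seqA. dist x' a < e \<longrightarrow> x' \<in> {a \<in> topspace (top_of_set seqA). pyrA a \<in> U}"
    proof (rule ccontr)
      assume "\<not> ?thesis"
      then have "\<forall>n::nat. \<exists>x\<in>seqA. dist x a < 1 / Suc n \<and> pyrA x \<notin> U" by force
      then obtain A where A: "\<And>n::nat. A n \<in> seqA" "\<And>n. dist (A n) a < 1 / Suc n" "\<And>n. pyrA (A n) \<notin> U"
        by metis
      have "(\<lambda>n. dist (A n) a) \<longlonglongrightarrow> 0"
        by (intro tendsto_sandwich[OF _ _ tendsto_const LIMSEQ_inverse_real_of_nat] always_eventually)
          (use A(2) in \<open>auto intro: less_imp_le simp: inverse_eq_divide\<close>)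
      then have "A \<longlonglongrightarrow> a" by (simp only: tendsto_dist_iff[symmetric])
      then have "weak_conv (\<lambda>n. pyrA (A n)) (pyrA a)"
        by (intro weak_conv_pyrA a A tendsto_coordinate)
      moreover have "range (\<lambda>n. pyrA (A n)) \<subseteq> Pyramids"
        using pyramid_pyrA A(1) by (auto simp: Pyramids_def)
      ultimately have "\<forall>\<^sub>F n in sequentially. pyrA (A n) \<in> U"
        using U a(2) unfolding openin_weak_Pi_topology by blast
      then have "\<forall>\<^sub>F n in sequentially. False" by (rule eventually_mono) (use A(3) in blast)
      then show False by simp
    qed
  qed auto
qed

text \<open>If infinitely many Ps n came from points of C, some of these points would converge to a
  c0 in C. Then P and \<open>pyrA c0\<close> would be weak limits of the same sequence of pyramids,
  hence equal, although P lies outside the image.\<close>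

lemma closedin_weak_Pi_topology_pyrA_image:
  assumes C: "compact C" "C \<subseteq> seqA"
  shows "closedin weak_Pi_topology (pyrA ` C)"
  unfolding closedin_def topspace_weak_Pi_topology openin_weak_Pi_topology
proof (intro conjI ballI allI impI)
  show "pyrA ` C \<subseteq> Pyramids" using pyramid_pyrA C(2) by (auto simp: Pyramids_def)
  fix P Ps assume P: "P \<in> Pyramids - pyrA ` C" and Ps: "range Ps \<subseteq> Pyramids \<and> weak_conv Ps P"
  show "\<forall>\<^sub>F n in sequentially. Ps n \<in> Pyramids - pyrA ` C"
  proof (rule ccontr)
    assume "\<not> ?thesis"
    moreover have "Ps n \<in> Pyramids" for n using Ps by blast
    ultimately have "infinite {n. Ps n \<in> pyrA ` C}"
      by (simp add: cofinite_eq_sequentially[symmetric] eventually_cofinite)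
    from infinite_enumerate[OF this]
    obtain r :: "nat \<Rightarrow> nat" where r: "strict_mono r" "\<And>n. Ps (r n) \<in> pyrA ` C"
      by auto
    then have "\<forall>n. \<exists>c\<in>C. Ps (r n) = pyrA c" by blast
    then obtain c where c: "\<And>n. c n \<in> C" "\<And>n. Ps (r n) = pyrA (c n)" by metis
    obtain c0 s where s: "c0 \<in> C" "strict_mono s" "(c \<circ> s) \<longlonglongrightarrow> c0"
      using C(1) c(1) compact_imp_seq_compact unfolding seq_compact_def by metis
    have "weak_conv (\<lambda>n. pyrA ((c \<circ> s) n)) (pyrA c0)"
      using C(2) s(1) c(1) by (intro weak_conv_pyrA tendsto_coordinate s(3)) auto
    moreover have "weak_conv (\<lambda>n. Ps (r (s n))) P"
      using weak_conv_subseq[OF weak_conv_subseq[OF _ r(1)] s(2)] Ps by blast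
    ultimately have "P = pyrA c0"
      using P pyrA_mm_space unfolding c(2) comp_def
      by (intro weak_conv_unique) (auto simp: Pyramids_def pyramid_def)
    then show False using P s(1) by blast
  qed
qed auto

theorem theorem1p6:
  shows "homeomorphic_map (subtopology weak_l2_topology seqA)
           (subtopology weak_Pi_topology (pyrA ` seqA)) pyrA"
proof -
  let ?S = "subtopology weak_Pi_topology (pyrA ` seqA)"
  have top: "topspace ?S = pyrA ` seqA"
    using pyramid_pyrA by (auto simp: topspace_weak_Pi_topology Pyramids_def)
  have "homeomorphic_map (top_of_set seqA) ?S pyrA"
  proof (rule bijective_closed_imp_homeomorphic_map)
    show "continuous_map (top_of_set seqA) ?S pyrA"
      using continuous_map_pyrA by (simp add: continuous_map_in_subtopology)
    show "closed_map (top_of_set seqA) ?S pyrA"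
      unfolding closed_map_def
    proof (intro allI impI)
      fix C assume C: "closedin (top_of_set seqA) C"
      then have "C \<subseteq> seqA" using closedin_imp_subset by blast
      moreover have "compact C" by (rule closedin_compact[OF compact_seqA C])
      ultimately have "closedin weak_Pi_topology (pyrA ` C)"
        by (intro closedin_weak_Pi_topology_pyrA_image)
      then show "closedin ?S (pyrA ` C)"
        using \<open>C \<subseteq> seqA\<close> by (intro closedin_subset_topspace) auto
    qed
    show "pyrA ` topspace (top_of_set seqA) = topspace ?S" using top by simp
    show "inj_on pyrA (topspace (top_of_set seqA))" using inj_on_pyrA by simp
  qed
  then show ?thesis by (simp only: weak_l2_topology_seqA)
qed

end
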